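(* Let $0<\alpha<2$, let $T=\mathbb{Z}$ or $T=\mathbb{R}$, and let $\mathbf{X}=(X(t),\,t\in T)$ be a measurable stationary symmetric $\alpha$-stable (S$\alpha$S) process. A decomposition of $\mathbf{X}$ into a sum of two independent stationary S$\alpha$S processes, one of which is generated by a positive flow and the other one by a null flow, is unique in law. That is, if $\mathbf{X}\stackrel{d}{=}\mathbf{Y}_1+\mathbf{Z}_1$ and $\mathbf{X}\stackrel{d}{=}\mathbf{Y}_2+\mathbf{Z}_2$, where for $i=1,2$ the processes $\mathbf{Y}_i$ and $\mathbf{Z}_i$ are independent stationary S$\alpha$S processes indexed by $T$, $\mathbf{Y}_i$ is generated by a positive flow and $\mathbf{Z}_i$ is generated by a null flow, then $\mathbf{Y}_1\stackrel{d}{=}\mathbf{Y}_2$ and $\mathbf{Z}_1\stackrel{d}{=}\mathbf{Z}_2$ (equality of finite-dimensional distributions).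
   Context: **Processes.** $0<\alpha<2$, and $T=\mathbb{Z}$ or $T=\mathbb{R}$. All S$\alpha$S processes are real-valued, or complex-valued and isotropic (rotationally invariant), and are assumed measurable (automatic if $T=\mathbb{Z}$; equivalent to continuity in probability for stationary processes if $T=\mathbb{R}$). **Integral representations.** $M$ is an S$\alpha$S random measure (isotropic in the complex case) on a measurable space $(E,\mathcal{E})$ with $\sigma$-finite control measure $m$, and $f_t\in L^\alpha(m)$; representations $X(t)=\int_Ef_t\,dM$, $t\in T$, are understood in law. In the real case, this means that $E\exp\{i\sum_j\theta_jX(t_j)\}=\exp\{-\int_E|\sum_j\theta_jf_{t_j}|^\alpha dm\}$ for all finite choices of $t_j\in T$, $\theta_j\in\mathbb{R}$; similarly with complex $\theta_j$ in the isotropic complex case. **Flow representations.** A measurable nonsingular flow on $(E,\mathcal{E},m)$ is a (jointly) measurable family $(\phi_t)_{t\in T}$ of maps of $E$ onto $E$ with $\phi_{t+s}(x)=\phi_t(\phi_s(x))$, $\phi_0(x)=x$ for all $s,t\in T$, $x\in E$, and $m\circ\phi_t^{-1}\sim m$ for all $t\in T$. A cocycle for $(\phi_t)$ is a measurable family $(a_t)_{t\in T}$ of $\{-1,1\}$-valued (unit-circle-valued in the complex case) functions on $E$ such that for all $s,t\in T$, $a_{t+s}(x)=a_s(x)a_t(\phi_s(x))$ for $m$-a.e. $x$. A flow representation is an integral representation with kernel $f_t=a_t\,(dm\circ\phi_t/dm)^{1/\alpha}\,f\circ\phi_t$ for a single $f\in L^\alpha(m)$. It has full support if $\mathrm{supp}\{f\circ\phi_t,\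 t\in T\}=E$, i.e. there is no measurable $A$ with $m(A)>0$ such that for every $t\in T$, $f\circ\phi_t=0$ $m$-a.e. on $A$. A process is said to be generated by (or to correspond to) a flow of a particular type if it has a full support flow representation whose flow is of that type. The identically zero process (for which $m(E)=0$) is regarded as generated both by a positive and by a null flow. **Positive and null flows.** A nonsingular map $\phi$ (a bijection of $E$, measurable in both directions, such that $\phi$ and $\phi^{-1}$ map $m$ to equivalent measures) is positive if there is a finite measure equivalent to $m$ and preserved by $\phi$. A measurable set $B$ is weakly wandering for $\phi$ if there is a sequence $0=n_0<n_1<n_2<\dots$ such that the sets $\phi^{-n_k}B$, $k\ge0$, are disjoint. For each nonsingular $\phi$, $E$ decomposes, uniquely modulo $m$-null sets, into disjoint $\phi$-invariant measurable sets $\mathtt{P}$ and $\mathtt{N}$ such that $\phi|_{\mathtt{P}}$ is positive and $\mathtt{N}=\bigcup_{k\ge0}\phi^{-n_k}B$ for a measurable weakly wandering set $B$ and a sequence $0=n_0<n_1<n_2<\dots$ for which the sets $\phi^{-n_k}B$, $k\ge0$, are disjoint. For a measurable nonsingular flow there are invariant measurable sets $\mathtt{P},\mathtt{N}$ which coincide modulo null sets with the positive and null parts of $\phi_t$ for every $t>0$. The flow is positive if $\mathtt{P}=E$, and null if $\mathtt{N}=E$, modulo null sets. *)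

theory Defs
  imports "HOL-Probability.Probability"
begin

text \<open>
  Conventions. The index set \<open>T\<close> is a subset of the reals; it is instantiated with \<open>\<int>\<close> or \<open>UNIV\<close>.
  The scalar field \<open>K\<close> is a subset of the complex numbers; it is instantiated with \<open>\<real>\<close>
  (real-valued processes) or \<open>UNIV\<close> (isotropic complex-valued processes). A process on the
  probability space \<open>P\<close> is a function \<open>X\<close> of which only the values \<open>X t \<omega>\<close> with
  \<open>t \<in> T\<close> and \<open>\<omega> \<in> space P\<close> matter.
\<close>

section \<open>Processes\<close>

definition same_law ::
    "real set \<Rightarrow> 'w measure \<Rightarrow> (real \<Rightarrow> 'w \<Rightarrow> complex) \<Rightarrow>
     'v measure \<Rightarrow> (real \<Rightarrow> 'v \<Rightarrow> complex) \<Rightarrow> bool" where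
  "same_law T P X Q Y \<longleftrightarrow>
     (\<forall>J. finite J \<and> J \<subseteq> T \<longrightarrow>
        distr P (PiM J (\<lambda>_. borel)) (\<lambda>\<omega>. \<lambda>t\<in>J. X t \<omega>) =
        distr Q (PiM J (\<lambda>_. borel)) (\<lambda>\<omega>. \<lambda>t\<in>J. Y t \<omega>))"

definition stationary :: "real set \<Rightarrow> 'w measure \<Rightarrow> (real \<Rightarrow> 'w \<Rightarrow> complex) \<Rightarrow> bool" where
  "stationary T P X \<longleftrightarrow> (\<forall>s\<in>T. same_law T P (\<lambda>t. X (t + s)) P X)"

definition independent_processes ::
    "real set \<Rightarrow> 'w measure \<Rightarrow> (real \<Rightarrow> 'w \<Rightarrow> complex) \<Rightarrow> (real \<Rightarrow> 'w \<Rightarrow> complex) \<Rightarrow> bool" where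
  "independent_processes T P Y Z \<longleftrightarrow>
     prob_space.indep_var P
       (PiM T (\<lambda>_. borel)) (\<lambda>\<omega>. \<lambda>t\<in>T. Y t \<omega>)
       (PiM T (\<lambda>_. borel)) (\<lambda>\<omega>. \<lambda>t\<in>T. Z t \<omega>)"

definition measurable_process ::
    "real set \<Rightarrow> 'w measure \<Rightarrow> (real \<Rightarrow> 'w \<Rightarrow> complex) \<Rightarrow> bool" where
  "measurable_process T P X \<longleftrightarrow>
     (\<lambda>(t, \<omega>). X t \<omega>) \<in> borel_measurable (restrict_space borel T \<Otimes>\<^sub>M P)"

definition SaS_variable :: "real \<Rightarrow> 'w measure \<Rightarrow> ('w \<Rightarrow> real) \<Rightarrow> bool" where
  "SaS_variable \<alpha> P \<xi> \<longleftrightarrow>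
     \<xi> \<in> borel_measurable P \<and>
     (\<exists>\<sigma>\<ge>0. \<forall>u. char (distr P borel \<xi>) u = of_real (exp (- ((\<sigma> * \<bar>u\<bar>) powr \<alpha>))))"

text \<open>
  For \<open>K = UNIV\<close> the third condition says that the real and imaginary parts are jointly
  symmetric stable, and the last one is isotropy. For \<open>K = \<real>\<close> the last condition
  is the symmetry of the law, which already follows from the third one.
\<close>

definition SaS_process ::
    "real set \<Rightarrow> complex set \<Rightarrow> real \<Rightarrow> 'w measure \<Rightarrow> (real \<Rightarrow> 'w \<Rightarrow> complex) \<Rightarrow> bool" where
  "SaS_process T K \<alpha> P X \<longleftrightarrow>
     prob_space P \<and>
     (\<forall>t\<in>T. X t \<in> borel_measurable P \<and> (\<forall>\<omega>\<in>space P. X t \<omega> \<in> K)) \<and>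
     (\<forall>J \<theta>. finite J \<and> J \<subseteq> T \<and> (\<forall>t\<in>J. \<theta> t \<in> K) \<longrightarrow>
        SaS_variable \<alpha> P (\<lambda>\<omega>. Re (\<Sum>t\<in>J. \<theta> t * X t \<omega>))) \<and>
     (\<forall>c\<in>K. norm c = 1 \<longrightarrow> same_law T P (\<lambda>t \<omega>. c * X t \<omega>) P X)"


section \<open>Nonsingular maps and flows\<close>

definition equivalent_measures :: "'e measure \<Rightarrow> 'e measure \<Rightarrow> bool" where
  "equivalent_measures M N \<longleftrightarrow>
     sets M = sets N \<and> absolutely_continuous M N \<and> absolutely_continuous N M"

definition nonsingular_map :: "'e measure \<Rightarrow> ('e \<Rightarrow> 'e) \<Rightarrow> bool" where
  "nonsingular_map M \<phi> \<longleftrightarrow>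
     bij_betw \<phi> (space M) (space M) \<and>
     \<phi> \<in> measurable M M \<and>
     the_inv_into (space M) \<phi> \<in> measurable M M \<and>
     equivalent_measures (distr M M \<phi>) M \<and>
     equivalent_measures (distr M M (the_inv_into (space M) \<phi>)) M"

definition positive_map :: "'e measure \<Rightarrow> ('e \<Rightarrow> 'e) \<Rightarrow> bool" where
  "positive_map M \<phi> \<longleftrightarrow>
     nonsingular_map M \<phi> \<and>
     (\<exists>\<mu>. finite_measure \<mu> \<and> equivalent_measures \<mu> M \<and> distr \<mu> \<mu> \<phi> = \<mu>)"

definition weakly_wandering_along ::
    "'e measure \<Rightarrow> ('e \<Rightarrow> 'e) \<Rightarrow> (nat \<Rightarrow> nat) \<Rightarrow> 'e set \<Rightarrow> bool" where
  "weakly_wandering_along M \<phi> n B \<longleftrightarrow>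
     B \<in> sets M \<and> n 0 = 0 \<and> strict_mono n \<and>
     disjoint_family (\<lambda>k. (\<phi> ^^ n k) -` B \<inter> space M)"

definition positive_null_parts ::
    "'e measure \<Rightarrow> ('e \<Rightarrow> 'e) \<Rightarrow> 'e set \<Rightarrow> 'e set \<Rightarrow> bool" where
  "positive_null_parts M \<phi> Pos Nul \<longleftrightarrow>
     Pos \<in> sets M \<and> Nul \<in> sets M \<and> Pos \<inter> Nul = {} \<and> Pos \<union> Nul = space M \<and>
     \<phi> -` Pos \<inter> space M = Pos \<and> \<phi> -` Nul \<inter> space M = Nul \<and>
     positive_map (restrict_space M Pos) \<phi> \<and>
     (\<exists>B n. weakly_wandering_along M \<phi> n B \<and> Nul = (\<Union>k. (\<phi> ^^ n k) -` B \<inter> space M))"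

definition nonsingular_flow :: "real set \<Rightarrow> 'e measure \<Rightarrow> (real \<Rightarrow> 'e \<Rightarrow> 'e) \<Rightarrow> bool" where
  "nonsingular_flow T M \<phi> \<longleftrightarrow>
     (\<lambda>(t, x). \<phi> t x) \<in> measurable (restrict_space borel T \<Otimes>\<^sub>M M) M \<and>
     (\<forall>t\<in>T. \<phi> t ` space M = space M) \<and>
     (\<forall>s\<in>T. \<forall>t\<in>T. \<forall>x\<in>space M. \<phi> (t + s) x = \<phi> t (\<phi> s x)) \<and>
     (\<forall>x\<in>space M. \<phi> 0 x = x) \<and>
     (\<forall>t\<in>T. equivalent_measures (distr M M (\<phi> t)) M)"

definition positive_null_parts_flow ::
    "real set \<Rightarrow> 'e measure \<Rightarrow> (real \<Rightarrow> 'e \<Rightarrow> 'e) \<Rightarrow> 'e set \<Rightarrow> 'e set \<Rightarrow> bool" where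
  "positive_null_parts_flow T M \<phi> Pos Nul \<longleftrightarrow>
     Pos \<in> sets M \<and> Nul \<in> sets M \<and>
     (\<forall>t\<in>T. \<phi> t -` Pos \<inter> space M = Pos \<and> \<phi> t -` Nul \<inter> space M = Nul) \<and>
     (\<forall>t\<in>T. t > 0 \<longrightarrow>
        (\<exists>Pt Nt. positive_null_parts M (\<phi> t) Pt Nt \<and>
           sym_diff Pos Pt \<in> null_sets M \<and> sym_diff Nul Nt \<in> null_sets M))"

definition positive_flow :: "real set \<Rightarrow> 'e measure \<Rightarrow> (real \<Rightarrow> 'e \<Rightarrow> 'e) \<Rightarrow> bool" where
  "positive_flow T M \<phi> \<longleftrightarrow>
     nonsingular_flow T M \<phi> \<and>
     (\<exists>Pos Nul. positive_null_parts_flow T M \<phi> Pos Nul \<and> space M - Pos \<in> null_sets M)"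

definition null_flow :: "real set \<Rightarrow> 'e measure \<Rightarrow> (real \<Rightarrow> 'e \<Rightarrow> 'e) \<Rightarrow> bool" where
  "null_flow T M \<phi> \<longleftrightarrow>
     nonsingular_flow T M \<phi> \<and>
     (\<exists>Pos Nul. positive_null_parts_flow T M \<phi> Pos Nul \<and> space M - Nul \<in> null_sets M)"

definition cocycle ::
    "real set \<Rightarrow> complex set \<Rightarrow> 'e measure \<Rightarrow> (real \<Rightarrow> 'e \<Rightarrow> 'e) \<Rightarrow> (real \<Rightarrow> 'e \<Rightarrow> complex) \<Rightarrow> bool"
  where
  "cocycle T K M \<phi> a \<longleftrightarrow>
     (\<lambda>(t, x). a t x) \<in> borel_measurable (restrict_space borel T \<Otimes>\<^sub>M M) \<and>
     (\<forall>t\<in>T. \<forall>x\<in>space M. a t x \<in> K \<and> norm (a t x) = 1) \<and>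
     (\<forall>s\<in>T. \<forall>t\<in>T. AE x in M. a (t + s) x = a s x * a t (\<phi> s x))"


section \<open>Integral and flow representations\<close>

definition L_alpha :: "complex set \<Rightarrow> real \<Rightarrow> 'e measure \<Rightarrow> ('e \<Rightarrow> complex) set" where
  "L_alpha K \<alpha> M =
     {f \<in> borel_measurable M. (\<forall>x\<in>space M. f x \<in> K) \<and> integrable M (\<lambda>x. norm (f x) powr \<alpha>)}"

text \<open>
  A representation \<open>X(t) = \<integral> F\<^sub>t dM\<close> is understood in law, so the random measure enters only
  through its control measure, here the measure \<open>M\<close>.
\<close>

definition integral_representation ::
    "real set \<Rightarrow> complex set \<Rightarrow> real \<Rightarrow> 'w measure \<Rightarrow> (real \<Rightarrow> 'w \<Rightarrow> complex) \<Rightarrow>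
     'e measure \<Rightarrow> (real \<Rightarrow> 'e \<Rightarrow> complex) \<Rightarrow> bool" where
  "integral_representation T K \<alpha> P X M F \<longleftrightarrow>
     sigma_finite_measure M \<and>
     (\<forall>t\<in>T. F t \<in> L_alpha K \<alpha> M) \<and>
     (\<forall>J \<theta>. finite J \<and> J \<subseteq> T \<and> (\<forall>t\<in>J. \<theta> t \<in> K) \<longrightarrow>
        (CLINT \<omega>|P. iexp (Re (\<Sum>t\<in>J. \<theta> t * X t \<omega>))) =
        of_real (exp (- (LINT x|M. norm (\<Sum>t\<in>J. \<theta> t * F t x) powr \<alpha>))))"

text \<open>
  The measure \<open>m \<circ> \<phi>\<^sub>t\<close>, i.e. \<open>A \<mapsto> m (\<phi>\<^sub>t A)\<close>, is the image of \<open>m\<close> under the inverse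
  map \<open>\<phi>\<^sub>-\<^sub>t\<close>.
\<close>

definition flow_kernel ::
    "real \<Rightarrow> 'e measure \<Rightarrow> (real \<Rightarrow> 'e \<Rightarrow> 'e) \<Rightarrow> (real \<Rightarrow> 'e \<Rightarrow> complex) \<Rightarrow> ('e \<Rightarrow> complex) \<Rightarrow>
     real \<Rightarrow> 'e \<Rightarrow> complex" where
  "flow_kernel \<alpha> M \<phi> a f t x =
     a t x * of_real (enn2real (RN_deriv M (distr M M (\<phi> (- t))) x) powr (1 / \<alpha>)) * f (\<phi> t x)"

definition flow_representation ::
    "real set \<Rightarrow> complex set \<Rightarrow> real \<Rightarrow> 'w measure \<Rightarrow> (real \<Rightarrow> 'w \<Rightarrow> complex) \<Rightarrow>
     'e measure \<Rightarrow> (real \<Rightarrow> 'e \<Rightarrow> 'e) \<Rightarrow> (real \<Rightarrow> 'e \<Rightarrow> complex) \<Rightarrow> ('e \<Rightarrow> complex) \<Rightarrow> bool" where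
  "flow_representation T K \<alpha> P X M \<phi> a f \<longleftrightarrow>
     nonsingular_flow T M \<phi> \<and> cocycle T K M \<phi> a \<and> f \<in> L_alpha K \<alpha> M \<and>
     integral_representation T K \<alpha> P X M (flow_kernel \<alpha> M \<phi> a f)"

definition full_support ::
    "real set \<Rightarrow> 'e measure \<Rightarrow> (real \<Rightarrow> 'e \<Rightarrow> 'e) \<Rightarrow> ('e \<Rightarrow> complex) \<Rightarrow> bool" where
  "full_support T M \<phi> f \<longleftrightarrow>
     \<not> (\<exists>A\<in>sets M. emeasure M A > 0 \<and> (\<forall>t\<in>T. AE x in M. x \<in> A \<longrightarrow> f (\<phi> t x) = 0))"

text \<open>
  The carrier of the flow ranges over all measure spaces on the type \<open>'e\<close>; a statement that
  assumes these predicates for a free type variable \<open>'e\<close> covers flows on arbitrary spaces.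
  The space of the measure may be null or even empty, so the zero process satisfies both
  predicates.
\<close>

definition generated_by_positive_flow ::
    "'e itself \<Rightarrow> real set \<Rightarrow> complex set \<Rightarrow> real \<Rightarrow> 'w measure \<Rightarrow>
     (real \<Rightarrow> 'w \<Rightarrow> complex) \<Rightarrow> bool" where
  "generated_by_positive_flow (_ :: 'e itself) T K \<alpha> P X \<longleftrightarrow>
     (\<exists>(M :: 'e measure) \<phi> a f.
        flow_representation T K \<alpha> P X M \<phi> a f \<and> full_support T M \<phi> f \<and> positive_flow T M \<phi>)"

definition generated_by_null_flow ::
    "'e itself \<Rightarrow> real set \<Rightarrow> complex set \<Rightarrow> real \<Rightarrow> 'w measure \<Rightarrow>
     (real \<Rightarrow> 'w \<Rightarrow> complex) \<Rightarrow> bool" where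
  "generated_by_null_flow (_ :: 'e itself) T K \<alpha> P X \<longleftrightarrow>
     (\<exists>(M :: 'e measure) \<phi> a f.
        flow_representation T K \<alpha> P X M \<phi> a f \<and> full_support T M \<phi> f \<and> null_flow T M \<phi>)"

definition measurable_stationary_SaS ::
    "real set \<Rightarrow> complex set \<Rightarrow> real \<Rightarrow> 'w measure \<Rightarrow> (real \<Rightarrow> 'w \<Rightarrow> complex) \<Rightarrow> bool" where
  "measurable_stationary_SaS T K \<alpha> P X \<longleftrightarrow>
     SaS_process T K \<alpha> P X \<and> measurable_process T P X \<and> stationary T P X"

end

theory Submission
  imports Defs
begin

text \<open>
  The Levy measure of a stationary stable process on path space is the image of \<open>m \<Otimes> \<kappa>\<close>, where
  \<open>\<kappa>\<close> is the isotropic measure on \<open>K\<close> homogeneous of degree \<open>- \<alpha>\<close>, under \<open>(x, z) \<mapsto> (z F\<^sub>t x)\<^sub>t\<close>.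
  It is shift invariant, because \<open>(x, z) \<mapsto> (\<phi>\<^sub>1 x, c x z)\<close> preserves \<open>m \<Otimes> \<kappa>\<close> when
  \<open>F\<^sub>t\<^sub>+\<^sub>1 = c F\<^sub>t \<circ> \<phi>\<^sub>1\<close>. For a positive flow it is equivalent, off the zero path, to a finite shift
  invariant measure; for a null flow the weakly wandering set makes it singular to every such
  measure. Levy measures are determined by the law, so from \<open>\<nu>\<^sub>1 + \<nu>\<^sub>2 = \<nu>\<^sub>3 + \<nu>\<^sub>4\<close> with \<open>\<nu>\<^sub>1 \<bottom> \<nu>\<^sub>4\<close>
  and \<open>\<nu>\<^sub>3 \<bottom> \<nu>\<^sub>2\<close> one gets \<open>\<nu>\<^sub>1 = \<nu>\<^sub>3\<close>. Only the time-one map is needed, also for \<open>T = UNIV\<close>: a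
  finite set of times is completed to a countable one by integer translation.
\<close>

section \<open>Characteristic functions of finite measures\<close>

text \<open>The Levy measure can have infinite mass near the zero path, and the image measure may
  even charge the zero path itself with infinite mass, so uniqueness of characteristic functions
  does not apply to it directly. For a fixed linear form it is therefore weighted by 1 - cos of that
  form. The weight vanishes at the zero path, the resulting mass is a constant times the exponent of
  the process at the form, and the identity (1 - cos a) cos b = ((1 - cos (b + a)) + (1 - cos (b -
  a))) / 2 - (1 - cos b) expresses the characteristic function of the weighted measure through
  exponents alone. The conclusion is likewise read off from total masses, one form at a time. The
  weakly wandering set lies in the space of the flow, while singularity is wanted on paths, and many
  points may share a path; its indicator is therefore replaced by a density on path space. The
  equation between the kernel at times t and t + 1 holds off a null set that depends on t; countably
  many times allow a single null set.\<close>

lemma finite_measure_eq_of_cos_sin: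
  fixes M N :: "real measure"
  assumes fM: "finite_measure M" and fN: "finite_measure N"
    and sM: "sets M = sets borel" and sN: "sets N = sets borel"
    and c: "\<And>t. (LINT x|M. cos (t * x)) = (LINT x|N. cos (t * x))"
    and s: "\<And>t. (LINT x|M. sin (t * x)) = (LINT x|N. sin (t * x))"
  shows "M = N"
proof -
  interpret M: finite_measure M by fact
  interpret N: finite_measure N by fact
  note [measurable_cong] = sM sN
  have m: "measure M (space M) = measure N (space N)"
    using c[of 0] by simp
  \<comment> \<open>\<open>Levy_uniqueness\<close> is about probability distributions, so both
    measures are divided by the mass \<open>r\<close>, which the cosine integral at frequency 0
    shows to be common; if \<open>r = 0\<close> both are the zero measure.\<close>
  define r where "r = measure M (space M)"
  have eM: "emeasure M (space M) = ennreal r" and eN: "emeasure N (space N) = ennreal r"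
    by (simp_all add: r_def m M.emeasure_eq_measure N.emeasure_eq_measure)
  show ?thesis
  proof (cases "r = 0")
    case True
    show ?thesis
    proof (rule measure_eqI)
      fix A assume A: "A \<in> sets M"
      have "emeasure M A \<le> emeasure M (space M)" "emeasure N A \<le> emeasure N (space N)"
        by (intro emeasure_space)+
      then show "emeasure M A = emeasure N A" using True eM eN by simp
    qed (simp add: sM sN)
  next
    case False
    then have r: "r > 0" by (simp add: r_def less_le)
    have ri: "ennreal (1 / r) * ennreal r = 1"
      using r by (simp add: ennreal_mult[symmetric] ennreal_1[symmetric] del: ennreal_1)
    let ?d = "\<lambda>M. density M (\<lambda>_. ennreal (1 / r))"
    have "emeasure (?d M) (space M) = 1" "emeasure (?d N) (space N) = 1"
      using eM eN ri by (simp_all add: emeasure_density nn_integral_cmult)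
    then have rd: "real_distribution (?d M)" "real_distribution (?d N)"
      by (auto intro!: prob_spaceI simp: real_distribution_def real_distribution_axioms_def
          emeasure_density sM sN nn_integral_cmult eM eN ri)
    have ch: "char (?d L) t = of_real (1 / r) * of_real (LINT x|L. cos (t * x))
        + \<i> * of_real (1 / r) * of_real (LINT x|L. sin (t * x))"
      if "finite_measure L" "sets L = sets borel" for L t
    proof -
      interpret L: finite_measure L by fact
      note [measurable_cong] = that(2)
      have i: "integrable L (\<lambda>x. iexp (t * x))" "integrable L (\<lambda>x. cos (t * x))" "integrable L (\<lambda>x. sin (t * x))"
        by (intro L.integrable_const_bound[where B=1]; simp)+
      have "char (?d L) t = (1 / r) *\<^sub>R (CLINT x|L. iexp (t * x))"
        using r by (simp add: char_def integral_density)
      also have "(CLINT x|L. iexp (t * x)) = (CLINT x|L. of_real (cos (t * x)) + \<i> * of_real (sin (t * x)))"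
        by (intro Bochner_Integration.integral_cong refl) (simp add: cis_conv_exp[symmetric] complex_eq_iff del: of_real_mult)
      also have "\<dots> = of_real (LINT x|L. cos (t * x)) + \<i> * of_real (LINT x|L. sin (t * x))"
        using i by simp
      finally show ?thesis by (simp add: scaleR_conv_of_real algebra_simps)
    qed
    have "?d M = ?d N"
      by (intro Levy_uniqueness rd ext) (simp add: ch fM fN sM sN c s)
    show ?thesis
    proof (rule measure_eqI)
      fix A assume A: "A \<in> sets M"
      have "ennreal r * emeasure (?d L) A = emeasure L A" if "sets L = sets M" for L
        using A that ri by (simp add: emeasure_density nn_integral_cmult mult.assoc[symmetric] mult.commute[of "ennreal r"])
      then show "emeasure M A = emeasure N A"
        using \<open>?d M = ?d N\<close> sM sN by metis
    qed (simp add: sM sN)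
  qed
qed

text \<open>The conditions g x in A are brought in one at a time by the one-dimensional uniqueness
  theorem. Weighted by 1 + h (f x), where h is 0, cos or sin, the law of \<open>g\<close> has a
  characteristic function that the product-to-sum formulas reduce to trigonometric integrals covered
  by the induction hypothesis. Equal laws give equal integrals of the indicator of \<open>A\<close>.
  The form \<open>f\<close> stays arbitrary in the induction because the hypothesis is used at
  linear combinations of \<open>f\<close> and \<open>g\<close>.\<close>

lemma integral_indicator_cos_sin_eq:
  fixes M N :: "'a measure"
  assumes fM: "finite_measure M" and fN: "finite_measure N" and sN: "sets N = sets M"
    and V: "\<And>f. f \<in> V \<Longrightarrow> f \<in> borel_measurable M"
    and V_add: "\<And>f g. f \<in> V \<Longrightarrow> g \<in> V \<Longrightarrow> (\<lambda>x. f x + g x) \<in> V"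
    and V_scale: "\<And>f c. f \<in> V \<Longrightarrow> (\<lambda>x. c * f x) \<in> V"
    and c: "\<And>f. f \<in> V \<Longrightarrow> (LINT x|M. cos (f x)) = (LINT x|N. cos (f x))"
    and s: "\<And>f. f \<in> V \<Longrightarrow> (LINT x|M. sin (f x)) = (LINT x|N. sin (f x))"
    and zs: "\<forall>(g, A) \<in> set zs. g \<in> V \<and> A \<in> sets borel"
    and f: "f \<in> V"
  defines "C \<equiv> \<lambda>zs x. of_bool (\<forall>(g, A) \<in> set zs. g x \<in> A) :: real"
  shows "(LINT x|M. C zs x * cos (f x)) = (LINT x|N. C zs x * cos (f x)) \<and>
    (LINT x|M. C zs x * sin (f x)) = (LINT x|N. C zs x * sin (f x))"
  using zs f
proof (induction zs arbitrary: f)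
  case Nil
  then show ?case using c s by (simp add: C_def)
next
  case (Cons z zs)
  obtain g A where z: "z = (g, A)" by (cases z)
  have gA: "g \<in> V" "A \<in> sets borel" "\<forall>(g, A) \<in> set zs. g \<in> V \<and> A \<in> sets borel"
    using Cons.prems z by auto
  note [measurable] = V[OF gA(1)] V[OF Cons.prems(2)] gA(2)
  note [measurable_cong] = sN
  have Cm[measurable]: "C zs \<in> borel_measurable M" "C zs \<in> borel_measurable N"
  proof -
    have "Measurable.pred M (\<lambda>x. \<forall>(g, A) \<in> set zs. g x \<in> A)"
      unfolding split_beta
      using V gA(3) by (intro pred_intros_finite finite_set pred_sets2[OF _ V]) auto
    then show "C zs \<in> borel_measurable M" by (simp add: C_def)
    then show "C zs \<in> borel_measurable N" by simp
  qed
  have C01: "0 \<le> C zs x" "C zs x \<le> 1" for x by (auto simp: C_def)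
  have key: "(LINT x|M. C zs x * indicator A (g x) * (1 + h (f x))) = (LINT x|N. C zs x * indicator A (g x) * (1 + h (f x)))"
    if h: "h = (\<lambda>x. 0) \<or> h = cos \<or> h = sin" for h :: "real \<Rightarrow> real"
  proof -
    have [measurable]: "h \<in> borel_measurable borel" using h by auto
    have hb: "\<bar>h u\<bar> \<le> 1" for u using h by auto
    \<comment> \<open>The weight must be nonnegative for \<open>D\<close> to be a measure, hence 1 +
      h in place of h; the case h = 0 is subtracted at the end.\<close>
    define D where "D L = distr (density L (\<lambda>x. ennreal (C zs x * (1 + h (f x))))) borel g" for L
    have h0: "0 \<le> 1 + h u" for u using hb[of u] by (simp add: abs_le_iff)
    have b2: "\<bar>C zs x * (1 + h (f x))\<bar> \<le> 2" for x
      using C01[of x] h0[of "f x"] hb[of "f x"]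
      by (auto simp: abs_mult abs_le_iff intro!: order_trans[OF mult_left_le_one_le])
    have Dint: "(LINT x|D L. k x) = (LINT x|L. C zs x * (1 + h (f x)) * k (g x))"
      if "sets L = sets M" "k \<in> borel_measurable borel" for L and k :: "real \<Rightarrow> real"
    proof -
      note [measurable] = that(2)
      note [measurable_cong] = that(1)
      show ?thesis
        unfolding D_def using C01 h0 by (subst integral_distr; simp add: integral_density)
    qed
    have Dfin: "finite_measure (D L)" if "finite_measure L" "sets L = sets M" for L
    proof (rule finite_measureI)
      interpret L: finite_measure L by fact
      note [measurable_cong] = that(2)
      have "emeasure (D L) (space (D L)) = (\<integral>\<^sup>+ x. ennreal (C zs x * (1 + h (f x))) \<partial>L)"
        unfolding D_def by (simp add: emeasure_distr emeasure_density cong: nn_integral_cong)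
      also have "\<dots> \<le> (\<integral>\<^sup>+ x. ennreal 2 \<partial>L)"
        using b2 by (intro nn_integral_mono ennreal_leI) (simp add: abs_le_iff)
      also have "\<dots> < \<infinity>" using L.emeasure_finite[of "space L"] by (simp add: ennreal_mult_less_top ennreal_mult_eq_top_iff less_top[symmetric])
      finally show "emeasure (D L) (space (D L)) \<noteq> \<infinity>" by simp
    qed
    have int: "integrable L (\<lambda>x. C zs x * k x)"
      if "finite_measure L" "sets L = sets M" "k \<in> borel_measurable M" "\<And>x. \<bar>k x\<bar> \<le> 1" for L and k :: "'a \<Rightarrow> real"
    proof -
      interpret L: finite_measure L by fact
      note [measurable_cong] = that(2)
      note [measurable] = that(3)
      show ?thesis using that(4) C01
        by (intro L.integrable_const_bound[where B=1]) (auto simp: abs_mult intro!: mult_le_one)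
    qed
    have lin: "(\<lambda>x. a * f x + b * g x) \<in> V" for a b
      by (intro V_add V_scale Cons.prems(2) gA(1))
    have eqc: "(LINT x|M. C zs x * cos (a * f x + b * g x)) = (LINT x|N. C zs x * cos (a * f x + b * g x))"
     and eqs: "(LINT x|M. C zs x * sin (a * f x + b * g x)) = (LINT x|N. C zs x * sin (a * f x + b * g x))" for a b
      using Cons.IH[OF gA(3) lin] by auto
    have comb: "(LINT x|M. C zs x * (q x + (r x + e * u x) / 2)) = (LINT x|N. C zs x * (q x + (r x + e * u x) / 2))"
      if "\<And>L. L = M \<or> L = N \<Longrightarrow> integrable L (\<lambda>x. C zs x * q x)"
        "\<And>L. L = M \<or> L = N \<Longrightarrow> integrable L (\<lambda>x. C zs x * r x)"
        "\<And>L. L = M \<or> L = N \<Longrightarrow> integrable L (\<lambda>x. C zs x * u x)"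
        "(LINT x|M. C zs x * q x) = (LINT x|N. C zs x * q x)"
        "(LINT x|M. C zs x * r x) = (LINT x|N. C zs x * r x)"
        "(LINT x|M. C zs x * u x) = (LINT x|N. C zs x * u x)"
      for q r u :: "'a \<Rightarrow> real" and e :: real
    proof -
      have *: "(LINT x|L. C zs x * (q x + (r x + e * u x) / 2)) =
        (LINT x|L. C zs x * q x) + ((LINT x|L. C zs x * r x) + e * (LINT x|L. C zs x * u x)) / 2"
        if L: "L = M \<or> L = N" for L
      proof -
        have "(LINT x|L. C zs x * (q x + (r x + e * u x) / 2)) =
          (LINT x|L. C zs x * q x + (C zs x * r x + e * (C zs x * u x)) / 2)"
          by (intro Bochner_Integration.integral_cong refl) (simp add: algebra_simps)
        then show ?thesis
          using \<open>\<And>L. L = M \<or> L = N \<Longrightarrow> integrable L (\<lambda>x. C zs x * q x)\<close>[OF L]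
            \<open>\<And>L. L = M \<or> L = N \<Longrightarrow> integrable L (\<lambda>x. C zs x * r x)\<close>[OF L]
            \<open>\<And>L. L = M \<or> L = N \<Longrightarrow> integrable L (\<lambda>x. C zs x * u x)\<close>[OF L] by simp
      qed
      then show ?thesis using that(4-6) by (simp add: *)
    qed
    have eqc0: "(LINT x|M. C zs x * cos (t * g x)) = (LINT x|N. C zs x * cos (t * g x))"
     and eqs0: "(LINT x|M. C zs x * sin (t * g x)) = (LINT x|N. C zs x * sin (t * g x))" for t
      using eqc[of 0 t] eqs[of 0 t] by simp_all
    have eqc1: "(LINT x|M. C zs x * cos (f x + t * g x)) = (LINT x|N. C zs x * cos (f x + t * g x))"
     and eqs1: "(LINT x|M. C zs x * sin (f x + t * g x)) = (LINT x|N. C zs x * sin (f x + t * g x))" for t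
      using eqc[of 1 t] eqs[of 1 t] by simp_all
    have eqc2: "(LINT x|M. C zs x * cos (f x - t * g x)) = (LINT x|N. C zs x * cos (f x - t * g x))"
     and eqs2: "(LINT x|M. C zs x * sin (f x - t * g x)) = (LINT x|N. C zs x * sin (f x - t * g x))" for t
      using eqc[of 1 "-t"] eqs[of 1 "-t"] by simp_all
    have ii: "integrable L (\<lambda>x. C zs x * k x)"
      if "L = M \<or> L = N" "k \<in> borel_measurable M" "\<And>x. \<bar>k x\<bar> \<le> 1" for L and k :: "'a \<Rightarrow> real"
      using int that fM fN sN by auto
    have hc: "(LINT x|M. C zs x * ((1 + h (f x)) * cos (t * g x))) = (LINT x|N. C zs x * ((1 + h (f x)) * cos (t * g x)))" (is ?hc)
      and hs: "(LINT x|M. C zs x * ((1 + h (f x)) * sin (t * g x))) = (LINT x|N. C zs x * ((1 + h (f x)) * sin (t * g x)))" (is ?hs) for t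
    proof -
      consider "h = (\<lambda>x. 0)" | "h = cos" | "h = sin" using h by blast
      then have "?hc \<and> ?hs"
      proof cases
        case 1 then show ?thesis using eqc0 eqs0 by simp
      next
        case 2
        have a: "(1 + cos a) * cos b = cos b + (cos (a + b) + 1 * cos (a - b)) / 2"
          "(1 + cos a) * sin b = sin b + (sin (a + b) + (-1) * sin (a - b)) / 2" for a b :: real
          by (simp_all add: cos_add cos_diff sin_add sin_diff algebra_simps)
        show ?thesis unfolding 2 a
          by (intro conjI comb ii eqc0 eqs0 eqc1 eqs1 eqc2 eqs2) simp_all
      next
        case 3
        have a: "(1 + sin a) * cos b = cos b + (sin (a + b) + 1 * sin (a - b)) / 2"
          "(1 + sin a) * sin b = sin b + (cos (a - b) + (-1) * cos (a + b)) / 2" for a b :: real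
          by (simp_all add: cos_add cos_diff sin_add sin_diff algebra_simps)
        show ?thesis unfolding 3 a
          by (intro conjI comb ii eqc0 eqs0 eqc1 eqs1 eqc2 eqs2) simp_all
      qed
      then show ?hc ?hs by auto
    qed
    have "D M = D N"
    proof (rule finite_measure_eq_of_cos_sin)
      fix t
      show "(LINT x|D M. cos (t * x)) = (LINT x|D N. cos (t * x))"
        using hc[of t] by (simp add: Dint sN mult.assoc)
      show "(LINT x|D M. sin (t * x)) = (LINT x|D N. sin (t * x))"
        using hs[of t] by (simp add: Dint sN mult.assoc)
    qed (use Dfin fM fN sN in \<open>auto simp: D_def\<close>)
    then have "(LINT x|D M. indicator A x :: real) = (LINT x|D N. indicator A x)" by simp
    then have "(LINT x|M. C zs x * (1 + h (f x)) * indicator A (g x)) = (LINT x|N. C zs x * (1 + h (f x)) * indicator A (g x))"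
      by (simp only: Dint sN gA(2) borel_measurable_indicator)
    then show ?thesis by (simp only: mult_ac)
  qed
  have C_Cons: "C (z # zs) x = C zs x * indicator A (g x)" for x
    by (auto simp: C_def z indicator_def)
  have split: "(LINT x|L. C zs x * indicator A (g x) * (1 + h (f x))) - (LINT x|L. C zs x * indicator A (g x) * (1 + 0)) =
      (LINT x|L. C (z # zs) x * h (f x))"
    if L: "L = M \<or> L = N" and h: "h = cos \<or> h = sin" for L h
  proof -
    interpret L: finite_measure L using L fM fN by auto
    have [measurable_cong]: "sets L = sets M" using L sN by auto
    have [measurable]: "h \<in> borel_measurable borel" using h by auto
    have hb: "\<bar>h u\<bar> \<le> 1" for u using h by auto
    have i: "integrable L (\<lambda>x. C zs x * indicator A (g x))" "integrable L (\<lambda>x. C zs x * indicator A (g x) * h (f x))"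
      using hb C01 by (auto intro!: L.integrable_const_bound[where B=1] mult_le_one eventuallyI simp: abs_mult indicator_def)
    show ?thesis using i by (simp add: C_Cons distrib_left)
  qed
  show ?case
    using key[of cos] key[of sin] key[of "\<lambda>_. 0"] split[of M cos] split[of N cos] split[of M sin] split[of N sin]
    by simp
qed

section \<open>Real linear forms on complex product spaces\<close>

definition lin_form :: "('i \<Rightarrow> complex) \<Rightarrow> 'i set \<Rightarrow> ('i \<Rightarrow> complex) \<Rightarrow> real" where
  "lin_form \<theta> J w = Re (\<Sum>t\<in>J. \<theta> t * w t)"

lemma lin_form_measurable [measurable]:
  assumes "J \<subseteq> I"
  shows "lin_form \<theta> J \<in> borel_measurable (PiM I (\<lambda>_. borel))"
proof -
  have "(\<lambda>w. \<theta> t * w t) \<in> borel_measurable (PiM I (\<lambda>_. borel))" if "t \<in> J" for t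
  proof -
    have [measurable]: "t \<in> I" using that assms by auto
    show ?thesis by measurable
  qed
  then have [measurable]: "(\<lambda>w. \<Sum>t\<in>J. \<theta> t * w t) \<in> borel_measurable (PiM I (\<lambda>_. borel))"
    by (intro borel_measurable_sum)
  show ?thesis unfolding lin_form_def by measurable
qed

text \<open>Coefficients outside their index set are arbitrary, so they are set to 0 before being
  added on the union.\<close>

lemma lin_form_add:
  assumes "finite J" "finite J'"
  shows "lin_form \<theta> J w + lin_form \<theta>' J' w =
    lin_form (\<lambda>t. (if t \<in> J then \<theta> t else 0) + (if t \<in> J' then \<theta>' t else 0)) (J \<union> J') w"
proof -
  have "(\<Sum>t\<in>J \<union> J'. (if t \<in> J then \<theta> t else 0) * w t) = (\<Sum>t\<in>J. \<theta> t * w t)"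
    "(\<Sum>t\<in>J \<union> J'. (if t \<in> J' then \<theta>' t else 0) * w t) = (\<Sum>t\<in>J'. \<theta>' t * w t)"
    using assms by (intro sum.mono_neutral_cong_right; auto)+
  then show ?thesis
    by (simp add: lin_form_def distrib_right sum.distrib)
qed

lemma lin_form_scale: "c * lin_form \<theta> J w = lin_form (\<lambda>t. of_real c * \<theta> t) J w"
proof -
  have "(\<Sum>t\<in>J. of_real c * \<theta> t * w t) = of_real c * (\<Sum>t\<in>J. \<theta> t * w t)"
    by (simp add: sum_distrib_left mult.assoc)
  then show ?thesis by (simp add: lin_form_def)
qed

text \<open>The conditions handled so far concern one real form each, whereas a box in a complex
  product has subsets of the plane as sides. Hence \<open>h\<close> sends a path to its real and
  imaginary parts, a point of a product of real lines over \<open>I'\<close>, where boxes with real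
  sides determine a finite measure; \<open>k\<close> brings the equality back.\<close>

proposition PiM_complex_eqI:
  fixes M N :: "('i \<Rightarrow> complex) measure"
  assumes fM: "finite_measure M" and fN: "finite_measure N"
    and sM: "sets M = sets (PiM I (\<lambda>_. borel))" and sN: "sets N = sets (PiM I (\<lambda>_. borel))"
    and c: "\<And>J \<theta>. finite J \<Longrightarrow> J \<subseteq> I \<Longrightarrow> (LINT w|M. cos (lin_form \<theta> J w)) = (LINT w|N. cos (lin_form \<theta> J w))"
    and s: "\<And>J \<theta>. finite J \<Longrightarrow> J \<subseteq> I \<Longrightarrow> (LINT w|M. sin (lin_form \<theta> J w)) = (LINT w|N. sin (lin_form \<theta> J w))"
  shows "M = N"
proof -
  let ?P = "PiM I (\<lambda>_. borel :: complex measure)"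
  note [measurable_cong] = sM sN
  define V where "V = {lin_form \<theta> J | \<theta> J. finite J \<and> J \<subseteq> I}"
  define L where "L = (\<lambda>(t :: 'i, b) w. if b then Im (w t) else Re (w t))"
  define I' where "I' = I \<times> (UNIV :: bool set)"
  let ?Q = "PiM I' (\<lambda>_. borel :: real measure)"
  have L_V: "L j \<in> V" if "j \<in> I'" for j
  proof -
    obtain t b where j: "j = (t, b)" by (cases j)
    have "L j = lin_form (\<lambda>_. if b then -\<i> else 1) {t}"
      by (auto simp: L_def j lin_form_def fun_eq_iff)
    then show ?thesis using that by (auto simp: V_def j I'_def)
  qed
  have L_meas: "L j \<in> borel_measurable ?P" if "j \<in> I'" for j
    using L_V[OF that] by (auto simp: V_def)
  define h where "h w = (\<lambda>j\<in>I'. L j w)" for w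
  define k :: "('i \<times> bool \<Rightarrow> real) \<Rightarrow> 'i \<Rightarrow> complex"
    where "k v = (\<lambda>t\<in>I. Complex (v (t, False)) (v (t, True)))" for v
  have h: "h \<in> measurable ?P ?Q" unfolding h_def by (intro measurable_restrict L_meas)
  have k: "k \<in> measurable ?Q ?P"
    unfolding k_def
  proof (intro measurable_restrict)
    fix t assume "t \<in> I"
    then have [measurable]: "(t, b) \<in> I'" for b by (auto simp: I'_def)
    show "(\<lambda>v. Complex (v (t, False)) (v (t, True))) \<in> borel_measurable ?Q"
      unfolding Complex_eq by measurable
  qed
  have kh: "k (h w) = w" if "w \<in> space ?P" for w
    using that by (auto simp: k_def h_def L_def I'_def fun_eq_iff space_PiM PiE_def extensional_def)
  have "distr M ?Q h = distr N ?Q h"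
  proof (rule measure_eqI_PiM_infinite)
    show "finite_measure (distr M ?Q h)" using fM h by (intro finite_measure.finite_measure_distr) auto
    fix A J assume J: "finite J" "J \<subseteq> I'" and A: "\<And>i. i \<in> J \<Longrightarrow> A i \<in> sets (borel :: real measure)"
    obtain js where js: "set js = J" using finite_list[OF J(1)] by blast
    define zs where "zs = map (\<lambda>j. (L j, A j)) js"
    define E where "E = {w \<in> space ?P. \<forall>j\<in>J. L j w \<in> A j}"
    have E: "E \<in> sets ?P" unfolding E_def
      using J L_meas A by (intro sets.sets_Collect_finite_All pred_sets2) auto
    have "(\<lambda>w. 0) \<in> V" unfolding V_def by (rule CollectI, rule exI, rule exI[of _ "{}"]) (auto simp: lin_form_def fun_eq_iff)
    note zero = this
    \<comment> \<open>With the zero form as \<open>f\<close> the cosine is 1, and what remains are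
      the measures of a box.\<close>
    have "(LINT w|M. of_bool (\<forall>(g, A) \<in> set zs. g w \<in> A) * cos (0 :: real)) =
      (LINT w|N. of_bool (\<forall>(g, A) \<in> set zs. g w \<in> A) * cos (0 :: real))"
    proof (rule integral_indicator_cos_sin_eq[where V = V and f = "\<lambda>_. 0", THEN conjunct1, OF fM fN])
      show "(\<lambda>x. f x + g x) \<in> V" if "f \<in> V" "g \<in> V" for f g
      proof -
        from that obtain \<theta> J \<theta>' J' where *: "f = lin_form \<theta> J" "g = lin_form \<theta>' J'"
          "finite J" "finite J'" "J \<subseteq> I" "J' \<subseteq> I" by (auto simp: V_def)
        show ?thesis unfolding V_def *(1,2) lin_form_add[OF *(3,4)] using *(3-6) by blast
      qed
      show "(\<lambda>x. c * f x) \<in> V" if "f \<in> V" for f c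
      proof -
        from that obtain \<theta> J where *: "f = lin_form \<theta> J" "finite J" "J \<subseteq> I" by (auto simp: V_def)
        show ?thesis unfolding V_def *(1) lin_form_scale using *(2,3) by blast
      qed
      show "sets N = sets M" by (simp add: sM sN)
      show "f \<in> borel_measurable M" if "f \<in> V" for f
        using that by (auto simp: V_def)
      show "(LINT w|M. cos (f w)) = (LINT w|N. cos (f w))"
        "(LINT w|M. sin (f w)) = (LINT w|N. sin (f w))" if "f \<in> V" for f
        using that c s unfolding V_def by blast+
      show "\<forall>(g, A) \<in> set zs. g \<in> V \<and> A \<in> sets borel"
        using L_V A J js by (auto simp: zs_def)
    qed (rule zero)
    moreover have "(LINT w|R. of_bool (\<forall>(g, A) \<in> set zs. g w \<in> A) * cos (0 :: real)) = measure R E"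
      if "sets R = sets ?P" for R
    proof -
      have "(LINT w|R. of_bool (\<forall>(g, A) \<in> set zs. g w \<in> A) * cos (0 :: real)) = (LINT w|R. indicator E w)"
        using js sets_eq_imp_space_eq[OF that]
        by (intro Bochner_Integration.integral_cong refl) (auto simp: E_def zs_def indicator_def)
      moreover have "E \<subseteq> space R" using sets_eq_imp_space_eq[OF that] by (auto simp: E_def)
      ultimately show ?thesis by (simp add: Int_absorb2)
    qed
    ultimately have "measure M E = measure N E" using sM sN by simp
    then have eE: "emeasure M E = emeasure N E"
      using fM fN by (simp add: finite_measure.emeasure_eq_measure)
    have hE: "h -` (prod_emb I' (\<lambda>_. borel) J (Pi\<^sub>E J A)) \<inter> space ?P = E"
    proof -
      have "restrict (h w) J = (\<lambda>j\<in>J. L j w)" for w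
        using J(2) by (auto simp: h_def fun_eq_iff)
      then have "h w \<in> prod_emb I' (\<lambda>_. borel) J (Pi\<^sub>E J A) \<longleftrightarrow> (\<forall>j\<in>J. L j w \<in> A j)" for w
        by (auto simp: prod_emb_def h_def restrict_PiE_iff)
      then show ?thesis by (auto simp: E_def)
    qed
    have "emeasure (distr R ?Q h) (prod_emb I' (\<lambda>_. borel) J (Pi\<^sub>E J A)) = emeasure R E"
      if "sets R = sets ?P" for R
    proof -
      have "h \<in> measurable R ?Q" using h that by (simp cong: measurable_cong_sets)
      moreover have "prod_emb I' (\<lambda>_. borel) J (Pi\<^sub>E J A) \<in> sets ?Q" using A J by (intro sets_PiM_I) auto
      ultimately show ?thesis using hE by (simp add: emeasure_distr sets_eq_imp_space_eq[OF that])
    qed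
    then show "emeasure (distr M ?Q h) (prod_emb I' (\<lambda>_. borel) J (Pi\<^sub>E J A)) =
      emeasure (distr N ?Q h) (prod_emb I' (\<lambda>_. borel) J (Pi\<^sub>E J A))"
      using eE sM sN by simp
  qed simp_all
  then have "distr (distr M ?Q h) ?P k = distr (distr N ?Q h) ?P k" by simp
  moreover have "distr (distr R ?Q h) ?P k = R" if "sets R = sets ?P" for R
  proof -
    have h': "h \<in> measurable R ?Q" using h that by (simp cong: measurable_cong_sets)
    have "distr (distr R ?Q h) ?P k = distr R ?P (k \<circ> h)" using h' k by (simp add: distr_distr)
    also have "\<dots> = distr R R (\<lambda>w. w)"
      using kh that by (intro distr_cong) (auto simp: sets_eq_imp_space_eq[OF that])
    finally show ?thesis by simp
  qed
  ultimately show ?thesis using sM sN by simp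
qed

section \<open>Sums of two measures\<close>

definition measure_add :: "'a measure \<Rightarrow> 'a measure \<Rightarrow> 'a measure" where
  "measure_add M N = measure_of (space M) (sets M) (\<lambda>A. emeasure M A + emeasure N A)"

context
  fixes M N :: "'a measure"
  assumes sets_eq: "sets N = sets M"
begin

lemma sets_measure_add: "sets (measure_add M N) = sets M"
  by (simp add: measure_add_def)

lemma space_measure_add: "space (measure_add M N) = space M"
  by (simp add: measure_add_def)

lemma emeasure_measure_add:
  assumes "A \<in> sets M"
  shows "emeasure (measure_add M N) A = emeasure M A + emeasure N A"
  unfolding measure_add_def
proof (rule emeasure_measure_of[OF refl])
  show "sets M \<subseteq> Pow (space M)" by (rule sets.space_closed)
  let ?s = "sets (measure_of (space M) (sets M) (\<lambda>A. emeasure M A + emeasure N A))"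
  show "positive ?s (\<lambda>A. emeasure M A + emeasure N A)" by (simp add: positive_def)
  show "countably_additive ?s (\<lambda>A. emeasure M A + emeasure N A)"
  proof (rule countably_additiveI)
    fix A :: "nat \<Rightarrow> 'a set" assume A: "range A \<subseteq> ?s" "disjoint_family A"
    then have "range A \<subseteq> sets M" "range A \<subseteq> sets N" by (simp_all add: sets_eq)
    then show "(\<Sum>i. emeasure M (A i) + emeasure N (A i)) = emeasure M (\<Union>i. A i) + emeasure N (\<Union>i. A i)"
      using A(2) by (simp add: suminf_add[symmetric] suminf_emeasure)
  qed
  show "A \<in> ?s" using assms by simp
qed

lemma nn_integral_measure_add:
  assumes "f \<in> borel_measurable M"
  shows "(\<integral>\<^sup>+x. f x \<partial>measure_add M N) = (\<integral>\<^sup>+x. f x \<partial>M) + (\<integral>\<^sup>+x. f x \<partial>N)"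
  using assms
proof induction
  note [measurable_cong] = sets_measure_add sets_eq
  { case (cong f g)
    then show ?case
      using sets_eq_imp_space_eq[OF sets_eq] by (simp add: space_measure_add cong: nn_integral_cong_simp)
  next
    case (set A)
    then show ?case by (simp add: emeasure_measure_add sets_measure_add sets_eq)
  next
    case (mult u c)
    note [measurable] = mult(2)
    show ?case using mult by (simp add: nn_integral_cmult distrib_left)
  next
    case (add u v)
    note [measurable] = add(1) add(3)
    have "u \<in> borel_measurable M" "v \<in> borel_measurable M" using add by auto
    then show ?case using add by (simp add: nn_integral_add ac_simps)
  next
    case (seq U)
    have [measurable]: "U i \<in> borel_measurable M" for i using seq by auto
    have i: "incseq (\<lambda>i. \<integral>\<^sup>+ x. U i x \<partial>R)" for R
      using \<open>incseq U\<close> by (auto simp: incseq_def le_fun_def intro!: nn_integral_mono)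
    have "(\<integral>\<^sup>+x. (SUP i. U i x) \<partial>R) = (SUP i. \<integral>\<^sup>+x. U i x \<partial>R)" if "sets R = sets M" for R
      using that \<open>incseq U\<close> by (intro nn_integral_monotone_convergence_SUP) (auto cong: measurable_cong_sets)
    then show ?case using seq
      by (simp add: sets_measure_add sets_eq image_comp ennreal_SUP_add[OF i i] SUP_apply)
  }
qed

lemma finite_measure_measure_add:
  assumes "finite_measure M" "finite_measure N"
  shows "finite_measure (measure_add M N)"
  using finite_measure.emeasure_finite[OF assms(1)] finite_measure.emeasure_finite[OF assms(2)]
  by (intro finite_measureI) (simp add: space_measure_add emeasure_measure_add)

text \<open>Additivity is available for nonnegative integrands; adding 1 makes a function bounded by
  1 nonnegative, and the masses of the finite measures are subtracted again.\<close>

lemma integral_measure_add_bounded: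
  fixes f :: "'a \<Rightarrow> real"
  assumes fM: "finite_measure M" and fN: "finite_measure N" and f: "f \<in> borel_measurable M" and b: "\<And>x. \<bar>f x\<bar> \<le> 1"
  shows "(LINT x|measure_add M N. f x) = (LINT x|M. f x) + (LINT x|N. f x)"
proof -
  note [measurable] = f
  note [measurable_cong] = sets_measure_add sets_eq
  have fA: "finite_measure (measure_add M N)" by (rule finite_measure_measure_add[OF fM fN])
  have *: "integrable R f \<and> ennreal ((LINT x|R. f x) + measure R (space R)) = (\<integral>\<^sup>+x. ennreal (f x + 1) \<partial>R)
      \<and> 0 \<le> (LINT x|R. f x) + measure R (space R)"
    if "finite_measure R" "sets R = sets M" for R
  proof -
    interpret R: finite_measure R by fact
    note [measurable_cong] = that(2)
    have i: "integrable R f" by (intro R.integrable_const_bound[where B=1]) (use b in auto)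
    have n: "0 \<le> f x + 1" for x using b[of x] by simp
    have "(\<integral>\<^sup>+x. ennreal (f x + 1) \<partial>R) = ennreal (LINT x|R. f x + 1)"
      using i n by (intro nn_integral_eq_integral) auto
    also have "(LINT x|R. f x + 1) = (LINT x|R. f x) + measure R (space R)"
      using i by simp
    finally show ?thesis using i n Bochner_Integration.integral_nonneg[of R "\<lambda>x. f x + 1"] by simp
  qed
  have sp: "space N = space M" using sets_eq by (rule sets_eq_imp_space_eq)
  have m: "measure (measure_add M N) (space M) = measure M (space M) + measure N (space M)"
    using finite_measure.emeasure_finite[OF fM, of "space M"] finite_measure.emeasure_finite[OF fN, of "space M"]
    by (simp add: measure_def emeasure_measure_add enn2real_plus less_top)
  have "ennreal ((LINT x|measure_add M N. f x) + measure (measure_add M N) (space M)) =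
    (\<integral>\<^sup>+x. ennreal (f x + 1) \<partial>measure_add M N)"
    using *[OF fA sets_measure_add] by (simp add: space_measure_add)
  also have "\<dots> = (\<integral>\<^sup>+x. ennreal (f x + 1) \<partial>M) + (\<integral>\<^sup>+x. ennreal (f x + 1) \<partial>N)"
    by (intro nn_integral_measure_add) simp
  also have "\<dots> = ennreal ((LINT x|M. f x) + measure M (space M)) + ennreal ((LINT x|N. f x) + measure N (space M))"
    using *[OF fM refl] *[OF fN sets_eq] by (simp add: sp)
  also have "\<dots> = ennreal (((LINT x|M. f x) + measure M (space M)) + ((LINT x|N. f x) + measure N (space M)))"
    using *[OF fM refl] *[OF fN sets_eq] by (intro ennreal_plus[symmetric]) (simp_all add: sp)
  finally show ?thesis
    using *[OF fA sets_measure_add] *[OF fM refl] *[OF fN sets_eq] m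
    by (subst (asm) ennreal_inj) (simp_all add: space_measure_add sp)
qed

end

section \<open>Null factors of invertible systems\<close>

lemma ennreal_suminf_const_top:
  fixes c :: ennreal
  assumes "c \<noteq> 0"
  shows "(\<Sum>k::nat. c) = \<infinity>"
proof (rule ccontr)
  assume fin: "(\<Sum>k::nat. c) \<noteq> \<infinity>"
  have "(\<Sum>k::nat. c) = c + (\<Sum>k::nat. c)"
    using suminf_offset[of "\<lambda>_::nat. c" 1] by simp
  with fin assms show False
    by (metis add.right_neutral add.commute ennreal_add_left_cancel infinity_ennreal_def)
qed

text \<open>By Markov's inequality the sets where f i exceeds 1 / (j + 1) have finite measure. They
  cover almost everything, and the null remainder is added as one more set.\<close>

lemma sigma_finite_measureI_nn_integral:
  fixes f :: "'i :: countable \<Rightarrow> 'a \<Rightarrow> ennreal"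
  assumes f[measurable]: "\<And>i. f i \<in> borel_measurable M" and fin: "\<And>i. (\<integral>\<^sup>+x. f i x \<partial>M) < \<infinity>"
    and pos: "AE x in M. \<exists>i. f i x > 0"
  shows "sigma_finite_measure M"
proof
  define A where "A = (\<lambda>(i, j). {x \<in> space M. ennreal (1 / Suc j) < f i x})"
  have AM: "A p \<in> sets M" for p by (cases p) (simp add: A_def)
  have A: "emeasure M (A p) \<noteq> \<infinity>" for p
  proof -
    obtain i j where p: "p = (i, j)" by (cases p) auto
    have "ennreal (1 / Suc j) * emeasure M (A p) = (\<integral>\<^sup>+x. ennreal (1 / Suc j) * indicator (A p) x \<partial>M)"
      using AM by (subst nn_integral_cmult_indicator) auto
    also have "\<dots> \<le> (\<integral>\<^sup>+x. f i x \<partial>M)"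
      by (intro nn_integral_mono) (auto simp: A_def p split: split_indicator)
    finally show ?thesis using fin[of i] by (auto simp: top_unique ennreal_mult_top)
  qed
  have "x \<in> (\<Union>p. A p)" if x: "x \<in> space M" "f i x > 0" for x i
  proof -
    have "\<exists>j. ennreal (1 / Suc j) < f i x"
    proof (cases "f i x")
      case (real r)
      then have "0 < r" using x by (simp add: less_le)
      then obtain j where "inverse (real (Suc j)) < r" using reals_Archimedean by blast
      then show ?thesis using real by (auto simp: ennreal_less_iff inverse_eq_divide intro!: exI[of _ j])
    next
      case top
      then show ?thesis by (intro exI[of _ 0]) simp
    qed
    then obtain j where "x \<in> A (i, j)" using x by (auto simp: A_def)
    then show ?thesis by blast
  qed
  note cover = this
  have "AE x in M. x \<in> (\<Union>p. A p)"
    using pos AE_space by eventually_elim (use cover in blast)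
  moreover have U: "(\<Union>p. A p) \<in> sets M" using AM by (intro sets.countable_UN) auto
  ultimately have "emeasure M (space M - (\<Union>p. A p)) = 0"
    by (subst (asm) AE_iff_measurable[where N = "space M - (\<Union>p. A p)"]) auto
  then show "\<exists>\<A>. countable \<A> \<and> \<A> \<subseteq> sets M \<and> \<Union>\<A> = space M \<and> (\<forall>a\<in>\<A>. emeasure M a \<noteq> \<infinity>)"
    using A AM U sets.sets_into_space[OF U]
    by (intro exI[of _ "insert (space M - (\<Union>p. A p)) (range A)"] conjI) auto
qed

lemma distr_funpow_invariant:
  assumes "f \<in> measurable M M" "distr M M f = M"
  shows "distr M M (f ^^ n) = M"
proof (induction n)
  case 0
  show ?case by (simp add: id_def)
next
  case (Suc n)
  have "distr (distr M M (f ^^ n)) M f = distr M M (f \<circ> f ^^ n)"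
    by (rule distr_distr[OF assms(1) measurable_compose_n[OF assms(1)]])
  then show ?case by (simp only: Suc assms(2) funpow.simps)
qed

lemma AE_invariant:
  assumes "f \<in> measurable M M" "distr M M f = M" "AE x in M. P x"
  shows "AE x in M. P (f x)"
  by (rule AE_distrD[OF assms(1)]) (unfold assms(2), rule assms(3))

section \<open>Invertible maps, their orbits and invariant measures\<close>

locale invertible_system =
  fixes W :: "'w measure" and S R :: "'w \<Rightarrow> 'w"
  assumes S_measurable [measurable]: "S \<in> measurable W W"
    and R_measurable [measurable]: "R \<in> measurable W W"
    and SR [simp]: "w \<in> space W \<Longrightarrow> S (R w) = w"
    and RS [simp]: "w \<in> space W \<Longrightarrow> R (S w) = w"
begin

lemma funpow_measurable [measurable]: "S ^^ k \<in> measurable W W" "R ^^ k \<in> measurable W W"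
  by (simp_all add: measurable_compose_n)

lemma funpow_space [simp]:
  "w \<in> space W \<Longrightarrow> (S ^^ k) w \<in> space W" "w \<in> space W \<Longrightarrow> (R ^^ k) w \<in> space W"
  using funpow_measurable[THEN measurable_space] by auto

lemma R_S_funpow [simp]: "w \<in> space W \<Longrightarrow> (R ^^ k) ((S ^^ k) w) = w"
proof (induction k arbitrary: w)
  case (Suc k)
  have "(R ^^ Suc k) ((S ^^ Suc k) w) = (R ^^ k) (R (S ((S ^^ k) w)))"
    by (simp add: funpow_swap1)
  then show ?case using Suc by simp
qed simp

text \<open>The points whose two-sided orbit meets \<open>P\<close> form a set that is invariant
  pointwise and not just up to a null set. This matters because the same set is later measured by
  two measures whose null sets are unrelated.\<close>

definition orbit_ex :: "('w \<Rightarrow> bool) \<Rightarrow> 'w \<Rightarrow> bool" where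
  "orbit_ex P w \<longleftrightarrow> (\<exists>k. P ((S ^^ k) w) \<or> P ((R ^^ k) w))"

lemma orbit_exI: "P w \<Longrightarrow> orbit_ex P w"
  unfolding orbit_ex_def by (rule exI[of _ 0]) simp

lemma orbit_ex_S: "w \<in> space W \<Longrightarrow> orbit_ex P (S w) \<longleftrightarrow> orbit_ex P w"
proof
  assume w: "w \<in> space W" and "orbit_ex P (S w)"
  then obtain k where k: "P ((S ^^ k) (S w)) \<or> P ((R ^^ k) (S w))" by (auto simp: orbit_ex_def)
  show "orbit_ex P w"
  proof (cases k)
    case 0
    then have "P ((S ^^ 1) w)" using k by simp
    then show ?thesis unfolding orbit_ex_def by blast
  next
    case (Suc j)
    then have "P ((S ^^ Suc k) w) \<or> P ((R ^^ j) w)"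
      using k w by (simp add: funpow_swap1)
    then show ?thesis unfolding orbit_ex_def by blast
  qed
next
  assume w: "w \<in> space W" and "orbit_ex P w"
  then obtain k where k: "P ((S ^^ k) w) \<or> P ((R ^^ k) w)" by (auto simp: orbit_ex_def)
  have R: "(R ^^ Suc k) (S w) = (R ^^ k) w" using w by (simp add: funpow_swap1)
  show "orbit_ex P (S w)"
  proof (cases k)
    case 0
    then have "P ((R ^^ 1) (S w))" using k w by simp
    then show ?thesis unfolding orbit_ex_def by blast
  next
    case (Suc j)
    then have "P ((S ^^ j) (S w)) \<or> P ((R ^^ Suc k) (S w))"
      using k R by (simp add: funpow_swap1)
    then show ?thesis unfolding orbit_ex_def by blast
  qed
qed

lemma orbit_ex_funpow: "w \<in> space W \<Longrightarrow> orbit_ex P ((S ^^ k) w) \<longleftrightarrow> orbit_ex P w"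
  by (induction k) (simp_all add: orbit_ex_S)

lemma orbit_ex_measurable [measurable]:
  assumes [measurable]: "Measurable.pred W P"
  shows "Measurable.pred W (orbit_ex P)"
  unfolding orbit_ex_def by measurable

lemma R_invariant:
  assumes "sets N = sets W" "distr N W S = N"
  shows "distr N W R = N"
proof -
  have [measurable_cong]: "sets N = sets W" by fact
  have "distr N W R = distr (distr N W S) W R" using assms(2) by simp
  also have "\<dots> = distr N W (R \<circ> S)" by (simp add: distr_distr)
  also have "\<dots> = distr N N (\<lambda>w. w)"
    using sets_eq_imp_space_eq[OF assms(1)] assms(1) by (intro distr_cong) auto
  finally show ?thesis by simp
qed

lemma funpow_invariant:
  assumes "sets N = sets W" "distr N W S = N"
  shows "distr N W (S ^^ k) = N" "distr N W (R ^^ k) = N"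
proof -
  have [measurable_cong]: "sets N = sets W" by fact
  have *: "distr N N f = distr N W f" for f using assms(1) by (intro distr_cong) auto
  have "distr N N (S ^^ k) = N" using assms * by (intro distr_funpow_invariant) auto
  then show "distr N W (S ^^ k) = N" by (simp add: *)
  have "distr N N (R ^^ k) = N" using R_invariant[OF assms] * by (intro distr_funpow_invariant) auto
  then show "distr N W (R ^^ k) = N" by (simp add: *)
qed

lemma nn_integral_funpow:
  assumes "sets N = sets W" "distr N W S = N" and [measurable]: "f \<in> borel_measurable W"
  shows "(\<integral>\<^sup>+w. f ((S ^^ k) w) \<partial>N) = (\<integral>\<^sup>+w. f w \<partial>N)" "(\<integral>\<^sup>+w. f ((R ^^ k) w) \<partial>N) = (\<integral>\<^sup>+w. f w \<partial>N)"
proof -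
  have [measurable_cong]: "sets N = sets W" by fact
  have "(\<integral>\<^sup>+w. f w \<partial>N) = (\<integral>\<^sup>+w. f w \<partial>distr N W (S ^^ k))"
    "(\<integral>\<^sup>+w. f w \<partial>N) = (\<integral>\<^sup>+w. f w \<partial>distr N W (R ^^ k))"
    using assms by (simp_all add: funpow_invariant)
  then show "(\<integral>\<^sup>+w. f ((S ^^ k) w) \<partial>N) = (\<integral>\<^sup>+w. f w \<partial>N)" "(\<integral>\<^sup>+w. f ((R ^^ k) w) \<partial>N) = (\<integral>\<^sup>+w. f w \<partial>N)"
    by (simp_all add: nn_integral_distr)
qed

lemma AE_funpow:
  assumes "sets N = sets W" "distr N W S = N" "AE w in N. P w"
  shows "AE w in N. P ((S ^^ k) w)" "AE w in N. P ((R ^^ k) w)"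
proof -
  have [measurable_cong]: "sets N = sets W" by fact
  show "AE w in N. P ((S ^^ k) w)"
    by (rule AE_distrD[of _ N W]) (simp, unfold funpow_invariant[OF assms(1,2)], rule assms(3))
  show "AE w in N. P ((R ^^ k) w)"
    by (rule AE_distrD[of _ N W]) (simp, unfold funpow_invariant[OF assms(1,2)], rule assms(3))
qed

text \<open>By invariance all the functions q o S^k and q o R^k have the same finite integral as
  \<open>q\<close>, and on an orbit that meets the set q > 0 at least one of them is
  positive.\<close>

lemma sigma_finite_orbit:
  assumes sN: "sets N = sets W" and inv: "distr N W S = N"
    and [measurable]: "q \<in> borel_measurable W" and fin: "(\<integral>\<^sup>+w. q w \<partial>N) < \<infinity>"
  shows "sigma_finite_measure (density N (indicator {w \<in> space W. orbit_ex (\<lambda>w. q w > 0) w}))"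
    (is "sigma_finite_measure (density N (indicator ?W0))")
proof -
  note [measurable_cong] = sN
  let ?N0 = "density N (indicator ?W0)"
  have [measurable]: "?W0 \<in> sets N" by measurable
  define Q where "Q = (\<lambda>(k :: nat, d) w. q (((if d then S else R) ^^ k) w))"
  have Q: "Q p \<in> borel_measurable W" for p
    by (cases p) (auto simp: Q_def)
  have [measurable]: "Q p \<in> borel_measurable N" for p using Q by simp
  have "(\<integral>\<^sup>+w. Q p w \<partial>N) = (\<integral>\<^sup>+w. q w \<partial>N)" for p
    by (cases p) (auto simp: Q_def nn_integral_funpow[OF sN inv])
  moreover have "(\<integral>\<^sup>+w. Q p w \<partial>?N0) \<le> (\<integral>\<^sup>+w. Q p w \<partial>N)" for p
    by (subst nn_integral_density) (auto intro!: nn_integral_mono split: split_indicator)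
  ultimately have "(\<integral>\<^sup>+w. Q p w \<partial>?N0) < \<infinity>" for p
    using fin by (metis order_le_less_trans)
  moreover have "AE w in ?N0. \<exists>p. Q p w > 0"
  proof (subst AE_density, simp, rule AE_I2, rule impI)
    fix w assume "0 < (indicator ?W0 w :: ennreal)"
    then have "w \<in> ?W0" by (metis indicator_simps(2) less_numeral_extra(3))
    then obtain k where "q ((S ^^ k) w) > 0 \<or> q ((R ^^ k) w) > 0"
      by (auto simp: orbit_ex_def)
    then have "Q (k, True) w > 0 \<or> Q (k, False) w > 0" by (simp add: Q_def)
    then show "\<exists>p. Q p w > 0" by blast
  qed
  ultimately show ?thesis
    by (intro sigma_finite_measureI_nn_integral[where f = Q]) auto
qed

text \<open>
  The conditional weight \<open>b\<close> of the weakly wandering set given the factor \<open>W\<close> turns the partition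
  of the extension into the identity \<open>\<Sum>\<^sub>k b \<circ> S\<^bsup>n k\<^esup> = 1\<close>; under a finite invariant measure
  all the summands have the same integral, which must therefore vanish.
\<close>

proposition null_factor_singular:
  fixes E :: "'e measure" and n :: "nat \<Rightarrow> nat"
  assumes \<phi>[measurable]: "\<phi> \<in> measurable E E" and inv: "distr E E \<phi> = E"
    and \<pi>[measurable]: "\<pi> \<in> measurable E W" and eqv: "AE x in E. \<pi> (\<phi> x) = S (\<pi> x)"
    and B[measurable]: "B \<in> sets E"
    and disj: "disjoint_family (\<lambda>k. (\<phi> ^^ n k) -` B \<inter> space E)"
    and cov: "AE x in E. \<exists>k. (\<phi> ^^ n k) x \<in> B"
    and q[measurable]: "q \<in> borel_measurable W" and fin: "(\<integral>\<^sup>+x. q (\<pi> x) \<partial>E) < \<infinity>"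
    and L: "finite_measure L" "sets L = sets W" "distr L W S = L"
  obtains N where "N \<in> sets W" "(\<integral>\<^sup>+x. q (\<pi> x) * indicator N (\<pi> x) \<partial>E) = 0"
    "emeasure L {w \<in> space W - N. q w > 0} = 0"
proof -
  note [measurable_cong] = L(2)
  define nu where "nu = distr E W \<pi>"
  have snu[simp, measurable_cong]: "sets nu = sets W" by (simp add: nu_def)
  have spnu[simp]: "space nu = space W" by (simp add: nu_def)
  have nu_int: "(\<integral>\<^sup>+w. f w \<partial>nu) = (\<integral>\<^sup>+x. f (\<pi> x) \<partial>E)" if "f \<in> borel_measurable W" for f
    using that by (simp add: nu_def nn_integral_distr)
  have nu_inv: "distr nu W S = nu"
  proof -
    have "distr nu W S = distr E W (S \<circ> \<pi>)" by (simp add: nu_def distr_distr)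
    also have "\<dots> = distr E W (\<pi> \<circ> \<phi>)"
      using eqv by (intro distr_cong_AE) auto
    also have "\<dots> = distr (distr E E \<phi>) W \<pi>" by (simp add: distr_distr)
    finally show ?thesis by (simp add: inv nu_def)
  qed
  have \<phi>pow[measurable]: "\<phi> ^^ k \<in> measurable E E" for k by (simp add: measurable_compose_n)
  have \<phi>pow_inv: "distr E E (\<phi> ^^ k) = E" for k by (rule distr_funpow_invariant[OF \<phi> inv])
  have eqv_pow: "AE x in E. \<pi> ((\<phi> ^^ k) x) = (S ^^ k) (\<pi> x)" for k
  proof (induction k)
    case (Suc k)
    have "AE x in E. \<pi> ((\<phi> ^^ k) (\<phi> x)) = (S ^^ k) (\<pi> (\<phi> x))"
      by (rule AE_invariant[OF \<phi> inv Suc])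
    with eqv show ?case by eventually_elim (simp add: funpow_swap1)
  qed simp
  \<comment> \<open>\<open>nu\<close> may fail to be sigma-finite where \<open>q\<close> vanishes
    along whole orbits, such as the zero path of a path space. Its restriction to \<open>W0\<close>
    is sigma-finite, as the Radon-Nikodym theorem requires, and still invariant.\<close>
  define W0 where "W0 = {w \<in> space W. orbit_ex (\<lambda>w. q w > 0) w}"
  have [measurable]: "W0 \<in> sets W" unfolding W0_def by measurable
  have W0_S: "indicator W0 ((S ^^ k) w) = (indicator W0 w :: ennreal)" if "w \<in> space W" for k w
    using that by (simp add: W0_def indicator_def orbit_ex_funpow)
  define nu0 where "nu0 = density nu (indicator W0)"
  have [simp, measurable_cong]: "sets nu0 = sets W" by (simp add: nu0_def)
  have [simp]: "space nu0 = space W" by (simp add: nu0_def)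
  have nu0_int: "(\<integral>\<^sup>+w. f w \<partial>nu0) = (\<integral>\<^sup>+x. indicator W0 (\<pi> x) * f (\<pi> x) \<partial>E)"
    if [measurable]: "f \<in> borel_measurable W" for f
    by (simp add: nu0_def nn_integral_density nu_int)
  interpret nu0: sigma_finite_measure nu0
    unfolding nu0_def W0_def by (rule sigma_finite_orbit[OF snu nu_inv q]) (use fin in \<open>simp add: nu_int\<close>)
  have nu0_pow: "(\<integral>\<^sup>+w. f ((S ^^ k) w) \<partial>nu0) = (\<integral>\<^sup>+w. f w \<partial>nu0)"
    if [measurable]: "f \<in> borel_measurable W" for f k
  proof -
    have "(\<integral>\<^sup>+w. f ((S ^^ k) w) \<partial>nu0) = (\<integral>\<^sup>+w. indicator W0 w * f ((S ^^ k) w) \<partial>nu)"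
      by (simp add: nu0_def nn_integral_density)
    also have "\<dots> = (\<integral>\<^sup>+w. indicator W0 ((S ^^ k) w) * f ((S ^^ k) w) \<partial>nu)"
      by (intro nn_integral_cong) (simp add: W0_S)
    also have "\<dots> = (\<integral>\<^sup>+w. indicator W0 w * f w \<partial>nu)"
      by (rule nn_integral_funpow(1)[OF snu nu_inv]) measurable
    finally show ?thesis by (simp add: nu0_def nn_integral_density)
  qed
  \<comment> \<open>\<open>beta\<close> is dominated by \<open>nu0\<close>, and its density
    \<open>b\<close> acts as the conditional probability of \<open>B\<close> given the value of
    \<open>\<pi>\<close>.\<close>
  define beta where "beta = distr (density E (\<lambda>x. indicator B x * indicator W0 (\<pi> x))) W \<pi>"
  have beta_int: "(\<integral>\<^sup>+w. f w \<partial>beta) = (\<integral>\<^sup>+x. indicator B x * indicator W0 (\<pi> x) * f (\<pi> x) \<partial>E)"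
    if [measurable]: "f \<in> borel_measurable W" for f
    by (simp add: beta_def nn_integral_distr nn_integral_density)
  have [simp]: "sets beta = sets W" by (simp add: beta_def)
  have "absolutely_continuous nu0 beta"
    unfolding absolutely_continuous_def
  proof
    fix A assume A: "A \<in> null_sets nu0"
    then have [measurable]: "A \<in> sets W" by (auto simp: null_sets_def)
    have "emeasure beta A = (\<integral>\<^sup>+w. indicator A w \<partial>beta)" by simp
    also have "\<dots> \<le> (\<integral>\<^sup>+w. indicator A w \<partial>nu0)"
      unfolding beta_int[OF borel_measurable_indicator[OF \<open>A \<in> sets W\<close>]] nu0_int[OF borel_measurable_indicator[OF \<open>A \<in> sets W\<close>]]
      by (intro nn_integral_mono) (auto split: split_indicator)
    also have "\<dots> = 0" using A by (simp add: null_sets_def)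
    finally show "A \<in> null_sets beta" by (auto simp: null_sets_def)
  qed
  then have dens: "density nu0 (RN_deriv nu0 beta) = beta"
    by (intro nu0.density_RN_deriv) simp_all
  define b where "b = RN_deriv nu0 beta"
  have b[measurable]: "b \<in> borel_measurable W"
    unfolding b_def using borel_measurable_RN_deriv[of nu0 beta] by (simp cong: measurable_cong_sets)
  have b_int: "(\<integral>\<^sup>+w. b w * f w \<partial>nu0) = (\<integral>\<^sup>+x. indicator B x * indicator W0 (\<pi> x) * f (\<pi> x) \<partial>E)"
    if [measurable]: "f \<in> borel_measurable W" for f
  proof -
    have "(\<integral>\<^sup>+w. b w * f w \<partial>nu0) = (\<integral>\<^sup>+w. f w \<partial>density nu0 b)"
      by (simp add: nn_integral_density)
    also have "\<dots> = (\<integral>\<^sup>+w. f w \<partial>beta)" using dens by (simp add: b_def)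
    finally show ?thesis by (simp add: beta_int)
  qed
  \<comment> \<open>Moving \<open>A\<close> forward by k steps to \<open>A'\<close> and using the
    invariance of \<open>E\<close> identifies b o S^k as the conditional weight of the k-step
    preimage of \<open>B\<close>.\<close>
  have piece: "(\<integral>\<^sup>+x. indicator B ((\<phi> ^^ k) x) * (indicator W0 (\<pi> x) * indicator A (\<pi> x)) \<partial>E) =
    (\<integral>\<^sup>+w. b ((S ^^ k) w) * indicator A w \<partial>nu0)" if A[measurable]: "A \<in> sets W" for k A
  proof -
    define A' where "A' = {w \<in> space W. (R ^^ k) w \<in> A}"
    have [measurable]: "A' \<in> sets W" unfolding A'_def by measurable
    have A': "indicator A' ((S ^^ k) w) = (indicator A w :: ennreal)" if "w \<in> space W" for w
      using that by (simp add: A'_def indicator_def)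
    have "(\<integral>\<^sup>+x. indicator B ((\<phi> ^^ k) x) * (indicator W0 (\<pi> x) * indicator A (\<pi> x)) \<partial>E) =
      (\<integral>\<^sup>+x. indicator B ((\<phi> ^^ k) x) * indicator W0 (\<pi> ((\<phi> ^^ k) x)) * indicator A' (\<pi> ((\<phi> ^^ k) x)) \<partial>E)"
    proof (rule nn_integral_cong_AE, use eqv_pow[of k] AE_space in eventually_elim)
      fix x assume "\<pi> ((\<phi> ^^ k) x) = (S ^^ k) (\<pi> x)" "x \<in> space E"
      moreover have "\<pi> x \<in> space W" using \<open>x \<in> space E\<close> \<pi>[THEN measurable_space] by auto
      ultimately show "indicator B ((\<phi> ^^ k) x) * (indicator W0 (\<pi> x) * indicator A (\<pi> x)) =
        (indicator B ((\<phi> ^^ k) x) * indicator W0 (\<pi> ((\<phi> ^^ k) x)) * indicator A' (\<pi> ((\<phi> ^^ k) x)) :: ennreal)"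
        by (simp add: A' W0_S mult.assoc)
    qed
    also have "\<dots> = (\<integral>\<^sup>+x. indicator B x * indicator W0 (\<pi> x) * indicator A' (\<pi> x) \<partial>distr E E (\<phi> ^^ k))"
      by (subst nn_integral_distr) measurable
    also have "\<dots> = (\<integral>\<^sup>+w. b w * indicator A' w \<partial>nu0)"
      by (simp add: \<phi>pow_inv b_int)
    also have "\<dots> = (\<integral>\<^sup>+w. b ((S ^^ k) w) * indicator A' ((S ^^ k) w) \<partial>nu0)"
      by (subst nu0_pow[symmetric]) measurable
    also have "\<dots> = (\<integral>\<^sup>+w. b ((S ^^ k) w) * indicator A w \<partial>nu0)"
      by (intro nn_integral_cong) (simp add: A')
    finally show ?thesis .
  qed
  define g where "g w = (\<Sum>k. b ((S ^^ n k) w))" for w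
  have [measurable]: "g \<in> borel_measurable W" unfolding g_def by measurable
  have "density nu0 g = density nu0 (\<lambda>_. 1)"
  proof (rule measure_eqI)
    fix A assume "A \<in> sets (density nu0 g)"
    then have [measurable]: "A \<in> sets W" by simp
    have one: "AE x in E. (\<Sum>k. indicator B ((\<phi> ^^ n k) x)) = (1 :: ennreal)"
      using cov AE_space
    proof eventually_elim
      fix x assume x: "\<exists>k. (\<phi> ^^ n k) x \<in> B" "x \<in> space E"
      have "(\<Sum>k. indicator B ((\<phi> ^^ n k) x)) =
        (\<Sum>k. indicator ((\<phi> ^^ n k) -` B \<inter> space E) x :: ennreal)"
        using x by (intro suminf_cong) (simp add: indicator_def)
      also have "\<dots> = indicator (\<Union>k. (\<phi> ^^ n k) -` B \<inter> space E) x"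
        by (rule suminf_indicator[OF disj])
      finally show "(\<Sum>k. indicator B ((\<phi> ^^ n k) x)) = (1 :: ennreal)" using x by auto
    qed
    have "emeasure (density nu0 g) A = (\<integral>\<^sup>+w. (\<Sum>k. b ((S ^^ n k) w) * indicator A w) \<partial>nu0)"
      by (subst emeasure_density) (simp_all add: g_def)
    also have "\<dots> = (\<Sum>k. \<integral>\<^sup>+x. indicator B ((\<phi> ^^ n k) x) * (indicator W0 (\<pi> x) * indicator A (\<pi> x)) \<partial>E)"
      by (subst nn_integral_suminf) (simp_all add: piece)
    also have "\<dots> = (\<integral>\<^sup>+x. (\<Sum>k. indicator B ((\<phi> ^^ n k) x)) * (indicator W0 (\<pi> x) * indicator A (\<pi> x)) \<partial>E)"
      by (subst nn_integral_suminf[symmetric]) simp_all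
    also have "\<dots> = (\<integral>\<^sup>+x. indicator W0 (\<pi> x) * indicator A (\<pi> x) \<partial>E)"
      using one by (intro nn_integral_cong_AE) auto
    also have "\<dots> = emeasure (density nu0 (\<lambda>_. 1)) A"
      by (subst nu0_int[symmetric]) (simp_all add: emeasure_density)
    finally show "emeasure (density nu0 g) A = emeasure (density nu0 (\<lambda>_. 1)) A" .
  qed simp
  then have "AE w in nu0. g w = 1" by (intro nu0.density_unique) auto
  then have g1: "AE w in nu. w \<in> W0 \<longrightarrow> g w = 1"
    unfolding nu0_def by (subst (asm) AE_density) (auto simp: indicator_def)
  \<comment> \<open>The identity g = 1 is known only up to \<open>nu\<close>-null sets, and
    \<open>L\<close> may be singular to \<open>nu\<close>. Removing the whole orbits of the
    exceptional points leaves an invariant set on which the identity holds everywhere, so that it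
    can be integrated against \<open>L\<close>.\<close>
  define Bad where "Bad w \<longleftrightarrow> w \<in> W0 \<and> g w \<noteq> 1" for w
  have [measurable]: "Measurable.pred W Bad" unfolding Bad_def by measurable
  have nBad: "AE w in nu. \<not> Bad w" using g1 by (simp add: Bad_def)
  define N where "N = {w \<in> space W. orbit_ex Bad w}"
  have N[measurable]: "N \<in> sets W" unfolding N_def by measurable
  have "AE w in nu. w \<notin> N"
  proof -
    have "AE w in nu. \<forall>k. \<not> Bad ((S ^^ k) w) \<and> \<not> Bad ((R ^^ k) w)"
      unfolding AE_all_countable using AE_funpow[OF snu nu_inv nBad] by (intro allI AE_conjI)
    then show ?thesis by eventually_elim (auto simp: N_def orbit_ex_def)
  qed
  then have "(\<integral>\<^sup>+w. q w * indicator N w \<partial>nu) = (\<integral>\<^sup>+w. 0 \<partial>nu)"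
    by (intro nn_integral_cong_AE) auto
  then have N0: "(\<integral>\<^sup>+x. q (\<pi> x) * indicator N (\<pi> x) \<partial>E) = 0"
    by (simp add: nu_int)
  define C where "C = W0 - N"
  have [measurable]: "C \<in> sets W" unfolding C_def by measurable
  have C_S: "indicator C ((S ^^ k) w) = (indicator C w :: ennreal)" if "w \<in> space W" for k w
    using that by (simp add: C_def W0_def N_def indicator_def orbit_ex_funpow)
  have spL: "space L = space W" using L(2) by (rule sets_eq_imp_space_eq)
  have gC: "g w = 1" if "w \<in> C" for w
    using that orbit_exI[of Bad w] by (auto simp: C_def N_def W0_def Bad_def)
  have "emeasure L C = (\<integral>\<^sup>+w. indicator C w \<partial>L)" by simp
  also have "\<dots> = (\<integral>\<^sup>+w. indicator C w * g w \<partial>L)"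
    by (intro nn_integral_cong) (simp add: gC split: split_indicator)
  also have "\<dots> = (\<Sum>k. \<integral>\<^sup>+w. indicator C w * b ((S ^^ n k) w) \<partial>L)"
    unfolding g_def by (subst nn_integral_suminf[symmetric]) simp_all
  also have "\<dots> = (\<Sum>k. \<integral>\<^sup>+w. indicator C w * b w \<partial>L)"
  proof (intro suminf_cong)
    fix k
    have "(\<integral>\<^sup>+w. indicator C w * b ((S ^^ n k) w) \<partial>L) = (\<integral>\<^sup>+w. indicator C ((S ^^ n k) w) * b ((S ^^ n k) w) \<partial>L)"
      by (intro nn_integral_cong) (simp add: C_S spL)
    also have "\<dots> = (\<integral>\<^sup>+w. indicator C w * b w \<partial>L)"
      by (rule nn_integral_funpow(1)[OF L(2,3)]) measurable
    finally show "(\<integral>\<^sup>+w. indicator C w * b ((S ^^ n k) w) \<partial>L) = (\<integral>\<^sup>+w. indicator C w * b w \<partial>L)" .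
  qed
  finally have LC: "emeasure L C = (\<Sum>k::nat. \<integral>\<^sup>+w. indicator C w * b w \<partial>L)" .
  have "(\<integral>\<^sup>+w. indicator C w * b w \<partial>L) = 0"
  proof (rule ccontr)
    assume "(\<integral>\<^sup>+w. indicator C w * b w \<partial>L) \<noteq> 0"
    then have "(\<Sum>k::nat. \<integral>\<^sup>+w. indicator C w * b w \<partial>L) = \<infinity>"
      by (intro ennreal_suminf_const_top) 
    with LC finite_measure.emeasure_finite[OF L(1)] show False by simp
  qed
  then have "emeasure L C = 0" using LC by simp
  moreover have "{w \<in> space W - N. q w > 0} \<subseteq> C"
    by (auto simp: C_def W0_def intro: orbit_exI)
  ultimately have "emeasure L {w \<in> space W - N. q w > 0} = 0"
    using emeasure_mono[of "{w \<in> space W - N. q w > 0}" C L] L(2) by simp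
  with N N0 show ?thesis by (rule that)
qed

end

section \<open>The homogeneous measure\<close>

text \<open>The rotation invariant measure on the unit sphere of \<open>K\<close>: two atoms in the
  real case, arc length in the complex case. It is left unnormalised, a finite nonzero mass being
  enough.\<close>

definition unit_measure :: "complex set \<Rightarrow> complex measure" where
  "unit_measure K = (if K = \<real> then measure_add (return borel 1) (return borel (-1))
     else distr (density lborel (indicator {0..<2 * pi})) borel cis)"

lemma sets_unit_measure [simp, measurable_cong]: "sets (unit_measure K) = sets borel"
  by (simp add: unit_measure_def sets_measure_add)

lemma nn_integral_unit_measure_real:
  assumes [measurable]: "f \<in> borel_measurable borel"
  shows "(\<integral>\<^sup>+u. f u \<partial>unit_measure \<real>) = f 1 + f (-1)"
  by (simp add: unit_measure_def nn_integral_measure_add nn_integral_return)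

lemma UNIV_neq_Reals: "(UNIV :: complex set) \<noteq> \<real>"
proof
  assume "(UNIV :: complex set) = \<real>"
  then have "\<i> \<in> \<real>" by blast
  then show False by (simp add: complex_is_Real_iff)
qed

lemma cis_measurable [measurable]: "cis \<in> borel_measurable borel"
  by (intro borel_measurable_continuous_onI continuous_intros)

lemma nn_integral_unit_measure_complex:
  assumes [measurable]: "f \<in> borel_measurable borel"
  shows "(\<integral>\<^sup>+u. f u \<partial>unit_measure UNIV) = (\<integral>\<^sup>+x. indicator {0..<2 * pi} x * f (cis x) \<partial>lborel)"
  by (simp add: unit_measure_def UNIV_neq_Reals nn_integral_distr nn_integral_density)

lemma nn_integral_unit_measure_rotate:
  assumes K: "K = \<real> \<or> K = UNIV" and c: "c \<in> K" "norm c = 1"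
    and [measurable]: "f \<in> borel_measurable borel"
  shows "(\<integral>\<^sup>+u. f (c * u) \<partial>unit_measure K) = (\<integral>\<^sup>+u. f u \<partial>unit_measure K)"
  using K
proof
  assume K: "K = \<real>"
  then obtain r where r: "c = of_real r" using c by (auto elim: Reals_cases)
  then have "r = 1 \<or> r = -1" using c(2) by auto
  then show ?thesis using r by (auto simp: K nn_integral_unit_measure_real add.commute)
next
  assume K: "K = UNIV"
  define t where "t = Arg2pi c"
  have t: "0 \<le> t" "t < 2 * pi" "c = cis t"
    using Arg2pi_ge_0 Arg2pi_lt_2pi Arg2pi_eq[of c] c(2) by (auto simp: t_def cis_conv_exp)
  have shift: "(\<integral>\<^sup>+x. h x \<partial>lborel) = (\<integral>\<^sup>+x. h (s + x) \<partial>lborel)"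
    if "h \<in> borel_measurable borel" for h :: "real \<Rightarrow> ennreal" and s
    using nn_integral_real_affine[OF that, of 1 s] by simp
  have "(\<integral>\<^sup>+u. f (c * u) \<partial>unit_measure K) =
    (\<integral>\<^sup>+x. indicator {t..<2 * pi + t} (t + x) * f (cis (t + x)) \<partial>lborel)"
    by (simp add: K t(3) nn_integral_unit_measure_complex cis_mult)
       (auto intro!: nn_integral_cong split: split_indicator)
  also have "\<dots> = (\<integral>\<^sup>+x. indicator {t..<2 * pi + t} x * f (cis x) \<partial>lborel)"
    by (rule shift[symmetric]) measurable
  \<comment> \<open>The shifted interval is cut at 2 pi, and the overhang is moved back by one
    period of \<open>cis\<close>.\<close>
  also have "\<dots> = (\<integral>\<^sup>+x. indicator {t..<2 * pi} x * f (cis x) + indicator {2 * pi..<2 * pi + t} x * f (cis x) \<partial>lborel)"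
    using t by (intro nn_integral_cong) (auto split: split_indicator)
  also have "\<dots> = (\<integral>\<^sup>+x. indicator {t..<2 * pi} x * f (cis x) \<partial>lborel) +
    (\<integral>\<^sup>+x. indicator {2 * pi..<2 * pi + t} x * f (cis x) \<partial>lborel)"
    by (rule nn_integral_add) measurable
  also have "(\<integral>\<^sup>+x. indicator {2 * pi..<2 * pi + t} x * f (cis x) \<partial>lborel) =
    (\<integral>\<^sup>+x. indicator {2 * pi..<2 * pi + t} (2 * pi + x) * f (cis (2 * pi + x)) \<partial>lborel)"
    by (rule shift) measurable
  also have "\<dots> = (\<integral>\<^sup>+x. indicator {0..<t} x * f (cis x) \<partial>lborel)"
    by (intro nn_integral_cong) (auto split: split_indicator simp: cis_mult[symmetric])
  also have "(\<integral>\<^sup>+x. indicator {t..<2 * pi} x * f (cis x) \<partial>lborel) + (\<integral>\<^sup>+x. indicator {0..<t} x * f (cis x) \<partial>lborel) =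
    (\<integral>\<^sup>+x. indicator {t..<2 * pi} x * f (cis x) + indicator {0..<t} x * f (cis x) \<partial>lborel)"
    by (rule nn_integral_add[symmetric]) measurable
  also have "\<dots> = (\<integral>\<^sup>+x. indicator {0..<2 * pi} x * f (cis x) \<partial>lborel)"
    using t by (intro nn_integral_cong) (auto split: split_indicator)
  also have "\<dots> = (\<integral>\<^sup>+u. f u \<partial>unit_measure K)"
    by (simp add: K nn_integral_unit_measure_complex)
  finally show ?thesis .
qed

lemma emeasure_unit_measure:
  assumes K: "K = \<real> \<or> K = UNIV"
  shows "emeasure (unit_measure K) UNIV \<noteq> 0" "emeasure (unit_measure K) UNIV < \<infinity>"
proof -
  have "emeasure (unit_measure K) UNIV = (\<integral>\<^sup>+u. 1 \<partial>unit_measure K)"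
    using sets_eq_imp_space_eq[OF sets_unit_measure[of K]] by simp
  moreover have "(\<integral>\<^sup>+u. 1 \<partial>unit_measure \<real>) = 1 + 1"
    by (rule nn_integral_unit_measure_real) simp
  moreover have "(\<integral>\<^sup>+u. 1 \<partial>unit_measure UNIV) = ennreal (2 * pi)"
    by (subst nn_integral_unit_measure_complex) auto
  ultimately show "emeasure (unit_measure K) UNIV \<noteq> 0" "emeasure (unit_measure K) UNIV < \<infinity>"
    using K by auto
qed

lemma AE_unit_measure:
  assumes K: "K = \<real> \<or> K = UNIV"
  shows "AE u in unit_measure K. u \<in> K \<and> norm u = 1"
proof -
  have sp: "space (unit_measure K) = UNIV"
    using sets_eq_imp_space_eq[OF sets_unit_measure[of K]] by simp
  have cl: "closed {u. u \<in> K \<and> norm u = 1}"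
    using K by (auto intro!: closed_Collect_conj closed_Collect_eq continuous_intros simp: closed_complex_Reals)
  then have m: "{u. \<not> (u \<in> K \<and> norm u = 1)} \<in> sets borel"
    using borel_comp[OF borel_closed[OF cl]] by (simp only: Collect_neg_eq)
  have "emeasure (unit_measure K) {u. \<not> (u \<in> K \<and> norm u = 1)} =
    (\<integral>\<^sup>+u. indicator {u. \<not> (u \<in> K \<and> norm u = 1)} u \<partial>unit_measure K)"
    using m by simp
  also have "\<dots> = 0"
    using K
  proof
    assume "K = \<real>"
    have "(\<integral>\<^sup>+u. indicator {u. \<not> (u \<in> K \<and> norm u = 1)} u \<partial>unit_measure \<real>) =
      indicator {u. \<not> (u \<in> K \<and> norm u = 1)} 1 + indicator {u. \<not> (u \<in> K \<and> norm u = 1)} (-1)"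
      using m by (intro nn_integral_unit_measure_real) simp
    then show ?thesis using \<open>K = \<real>\<close> by simp
  next
    assume "K = UNIV"
    have "(\<integral>\<^sup>+u. indicator {u. \<not> (u \<in> K \<and> norm u = 1)} u \<partial>unit_measure UNIV) =
      (\<integral>\<^sup>+x. indicator {0..<2 * pi} x * indicator {u. \<not> (u \<in> K \<and> norm u = 1)} (cis x) \<partial>lborel)"
      using m by (intro nn_integral_unit_measure_complex) simp
    then show ?thesis using \<open>K = UNIV\<close> by simp
  qed
  finally show ?thesis using m by (subst AE_iff_measurable[OF _ refl]) (simp_all add: sp)
qed

text \<open>The exponent -1 - \<alpha> is dictated by homogeneity: replacing f r by f (s r) has to
  multiply integrals by the \<alpha>-th power of s, which is how the exponent of an \<alpha>-stable
  law scales.\<close>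

definition radial_measure :: "real \<Rightarrow> real measure" where
  "radial_measure \<alpha> = density lborel (\<lambda>r. indicator {0<..} r * ennreal (r powr (- 1 - \<alpha>)))"

lemma sets_radial_measure [simp, measurable_cong]: "sets (radial_measure \<alpha>) = sets borel"
  by (simp add: radial_measure_def)

lemma space_radial_measure [simp]: "space (radial_measure \<alpha>) = UNIV"
  by (simp add: radial_measure_def)

lemma nn_integral_radial_measure:
  assumes [measurable]: "f \<in> borel_measurable borel"
  shows "(\<integral>\<^sup>+r. f r \<partial>radial_measure \<alpha>) = (\<integral>\<^sup>+r. indicator {0<..} r * ennreal (r powr (- 1 - \<alpha>)) * f r \<partial>lborel)"
  by (simp add: radial_measure_def nn_integral_density)

lemma nn_integral_radial_measure_scale:
  assumes s: "s > 0" and [measurable]: "f \<in> borel_measurable borel"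
  shows "(\<integral>\<^sup>+r. f (s * r) \<partial>radial_measure \<alpha>) = ennreal (s powr \<alpha>) * (\<integral>\<^sup>+r. f r \<partial>radial_measure \<alpha>)"
proof -
  have "(\<integral>\<^sup>+r. f r \<partial>radial_measure \<alpha>) =
    ennreal s * (\<integral>\<^sup>+r. indicator {0<..} (0 + s * r) * ennreal ((0 + s * r) powr (- 1 - \<alpha>)) * f (0 + s * r) \<partial>lborel)"
    unfolding nn_integral_radial_measure[OF assms(2)]
    by (subst nn_integral_real_affine[where c = s and t = 0]) (use s in simp_all)
  also have "\<dots> = ennreal s * (\<integral>\<^sup>+r. ennreal (s powr (- 1 - \<alpha>)) * (indicator {0<..} r * ennreal (r powr (- 1 - \<alpha>)) * f (s * r)) \<partial>lborel)"
    using s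
    by (intro arg_cong[where f = "\<lambda>x. ennreal s * x"] nn_integral_cong)
       (auto split: split_indicator simp: powr_mult ennreal_mult mult_ac zero_less_mult_iff)
  also have "\<dots> = ennreal s * (ennreal (s powr (- 1 - \<alpha>)) * (\<integral>\<^sup>+r. f (s * r) \<partial>radial_measure \<alpha>))"
    by (subst nn_integral_cmult) (simp_all add: nn_integral_radial_measure)
  finally have "ennreal (s powr \<alpha>) * (\<integral>\<^sup>+r. f r \<partial>radial_measure \<alpha>) =
    ennreal (s powr \<alpha> * s * s powr (- 1 - \<alpha>)) * (\<integral>\<^sup>+r. f (s * r) \<partial>radial_measure \<alpha>)"
    using s by (simp add: ennreal_mult mult.assoc)
  also have "s powr \<alpha> * s * s powr (- 1 - \<alpha>) = s powr \<alpha> * s powr 1 * s powr (- 1 - \<alpha>)" using s by simp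
  also have "\<dots> = 1" using s by (simp only: powr_add[symmetric]) simp
  finally show ?thesis by simp
qed

lemma has_integral_indicator_UNIV:
  fixes f :: "real \<Rightarrow> real"
  assumes "(f has_integral I) A"
  shows "((\<lambda>x. indicator A x * f x) has_integral I) UNIV"
proof -
  have "(\<lambda>x. indicator A x * f x) = (\<lambda>x. if x \<in> A then f x else 0)" by auto
  then show ?thesis using assms by (simp add: has_integral_restrict_UNIV)
qed

text \<open>Below 1 the integrand is r to the power 1 - \<alpha>, integrable because \<alpha> < 2;
  above 1 it is r to the power -1 - \<alpha>, integrable because \<alpha> > 0.\<close>

lemma nn_integral_radial_measure_finite:
  assumes "0 < \<alpha>" "\<alpha> < 2"
  shows "(\<integral>\<^sup>+r. ennreal (min 1 (r\<^sup>2)) \<partial>radial_measure \<alpha>) < \<infinity>"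
proof -
  have e: "(\<integral>\<^sup>+x. ennreal (indicator {0..1} x * x powr (1 - \<alpha>)) \<partial>lborel) = ennreal (1 powr (1 - \<alpha> + 1) / (1 - \<alpha> + 1))"
  proof (rule nn_integral_has_integral_lborel)
    have "((\<lambda>x. x powr (1 - \<alpha>)) has_integral (1 powr (1 - \<alpha> + 1) / (1 - \<alpha> + 1))) {0..1}"
      using assms by (intro has_integral_powr_from_0) auto
    then show "((\<lambda>x. indicator {0..1} x * x powr (1 - \<alpha>)) has_integral (1 powr (1 - \<alpha> + 1) / (1 - \<alpha> + 1))) UNIV"
      by (rule has_integral_indicator_UNIV)
  qed auto
  have f: "(\<integral>\<^sup>+x. ennreal (indicator {1..} x * x powr (- 1 - \<alpha>)) \<partial>lborel) = ennreal (- (1 powr (- 1 - \<alpha> + 1) / (- 1 - \<alpha> + 1)))"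
  proof (rule nn_integral_has_integral_lborel)
    have "((\<lambda>x. x powr (- 1 - \<alpha>)) has_integral - (1 powr (- 1 - \<alpha> + 1) / (- 1 - \<alpha> + 1))) {1..}"
      using assms has_integral_powr_to_inf[of "- 1 - \<alpha>" 1] by simp
    then show "((\<lambda>x. indicator {1..} x * x powr (- 1 - \<alpha>)) has_integral - (1 powr (- 1 - \<alpha> + 1) / (- 1 - \<alpha> + 1))) UNIV"
      by (rule has_integral_indicator_UNIV)
  qed auto
  have "(\<integral>\<^sup>+r. ennreal (min 1 (r\<^sup>2)) \<partial>radial_measure \<alpha>) =
    (\<integral>\<^sup>+r. indicator {0<..} r * ennreal (r powr (- 1 - \<alpha>)) * ennreal (min 1 (r\<^sup>2)) \<partial>lborel)"
    by (rule nn_integral_radial_measure) simp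
  also have "\<dots> \<le>
    (\<integral>\<^sup>+x. ennreal (indicator {0..1} x * x powr (1 - \<alpha>)) + ennreal (indicator {1..} x * x powr (- 1 - \<alpha>)) \<partial>lborel)"
  proof (rule nn_integral_mono)
    fix r :: real
    show "indicator {0<..} r * ennreal (r powr (- 1 - \<alpha>)) * ennreal (min 1 (r\<^sup>2)) \<le>
      ennreal (indicator {0..1} r * r powr (1 - \<alpha>)) + ennreal (indicator {1..} r * r powr (- 1 - \<alpha>))"
    proof (cases "r > 0")
      case True
      have "r powr (- 1 - \<alpha>) * r\<^sup>2 = r powr (- 1 - \<alpha>) * r powr 2" using True by simp
      also have "\<dots> = r powr (1 - \<alpha>)" by (simp only: powr_add[symmetric]) simp
      finally have sq: "r powr (- 1 - \<alpha>) * r\<^sup>2 = r powr (1 - \<alpha>)" .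
      have "r powr (- 1 - \<alpha>) * min 1 (r\<^sup>2) \<le> indicator {0..1} r * r powr (1 - \<alpha>) + indicator {1..} r * r powr (- 1 - \<alpha>)"
      proof (cases "r < 1")
        case r: True
        then have "min 1 (r\<^sup>2) = r\<^sup>2" using True by (simp add: power_le_one)
        then show ?thesis using r True sq by simp
      next
        case False
        have "r powr (- 1 - \<alpha>) * min 1 (r\<^sup>2) \<le> r powr (- 1 - \<alpha>)"
          by (intro mult_left_le) auto
        also have "\<dots> \<le> indicator {0..1} r * r powr (1 - \<alpha>) + indicator {1..} r * r powr (- 1 - \<alpha>)"
          using False by simp
        finally show ?thesis .
      qed
      then show ?thesis using True by (simp add: ennreal_mult[symmetric] ennreal_plus[symmetric] ennreal_leI del: ennreal_plus)
    qed simp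
  qed
  also have "\<dots> < \<infinity>"
    by (subst nn_integral_add) (simp_all add: e f)
  finally show ?thesis .
qed

lemma emeasure_radial_measure: "emeasure (radial_measure \<alpha>) UNIV \<noteq> 0"
proof
  assume "emeasure (radial_measure \<alpha>) UNIV = 0"
  then have "(\<integral>\<^sup>+r. 1 \<partial>radial_measure \<alpha>) = 0" by simp
  then have "(\<integral>\<^sup>+r. indicator {0<..} r * ennreal (r powr (- 1 - \<alpha>)) * 1 \<partial>lborel) = 0"
    by (subst (asm) nn_integral_radial_measure) simp_all
  then have "AE r :: real in lborel. r \<notin> {0<..<1}"
    by (subst (asm) nn_integral_0_iff_AE) (auto elim!: eventually_mono split: split_indicator)
  then have "emeasure lborel {0 <..< 1 :: real} = 0"
    by (subst (asm) AE_iff_measurable[where N = "{0 <..< 1}"]) auto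
  then show False by simp
qed

lemma AE_radial_measure: "AE r in radial_measure \<alpha>. r > 0"
  unfolding radial_measure_def by (subst AE_density) (auto simp: indicator_def)

text \<open>The constant 2 is the maximum of 1 - cos and also exceeds the factor 1/2 of the
  quadratic bound. \<open>y\<close> is separate from \<open>x\<close> so that the modulus of a
  complex number can bound its real part.\<close>

lemma one_minus_cos_le:
  fixes x y :: real
  assumes "\<bar>x\<bar> \<le> y"
  shows "1 - cos x \<le> 2 * min 1 (y\<^sup>2)"
proof -
  have "1 - cos x = 2 * (sin (x / 2))\<^sup>2" using cos_double_sin[of "x / 2"] by simp
  also have "(sin (x / 2))\<^sup>2 \<le> (x / 2)\<^sup>2"
    using abs_sin_x_le_abs_x[of "x / 2"] by (simp only: abs_le_square_iff)
  also have "2 * (x / 2)\<^sup>2 \<le> x\<^sup>2" by (simp add: power_divide)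
  also have "x\<^sup>2 \<le> y\<^sup>2" using assms by (metis abs_le_square_iff abs_of_nonneg abs_ge_zero order_trans)
  also have "y\<^sup>2 \<le> 2 * y\<^sup>2" by simp
  finally have "1 - cos x \<le> 2 * y\<^sup>2" by simp
  moreover have "1 - cos x \<le> 2" using cos_ge_minus_one[of x] by simp
  ultimately show ?thesis by (simp add: min_def)
qed

section \<open>The homogeneous isotropic measure on the scalar field\<close>

locale stable_index =
  fixes \<alpha> :: real and K :: "complex set"
  assumes \<alpha>: "0 < \<alpha>" "\<alpha> < 2" and K: "K = \<real> \<or> K = UNIV"
begin

lemma K_simps [simp, intro]:
  "x \<in> K \<Longrightarrow> y \<in> K \<Longrightarrow> x * y \<in> K" "x \<in> K \<Longrightarrow> y \<in> K \<Longrightarrow> x / y \<in> K"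
  "x \<in> K \<Longrightarrow> y \<in> K \<Longrightarrow> x + y \<in> K" "x \<in> K \<Longrightarrow> - x \<in> K"
  "of_real r \<in> K" "1 \<in> K" "0 \<in> K"
  using K by auto

text \<open>\<open>\<kappa>\<close> is the Levy measure of the one-dimensional isotropic stable law.\<close>

definition \<kappa> :: "complex measure" where
  "\<kappa> = distr (radial_measure \<alpha> \<Otimes>\<^sub>M unit_measure K) borel (\<lambda>(r, u). of_real r * u)"

lemma sets_\<kappa> [simp, measurable_cong]: "sets \<kappa> = sets borel"
  by (simp add: \<kappa>_def)

lemma space_\<kappa> [simp]: "space \<kappa> = UNIV"
  by (simp add: \<kappa>_def)

lemma space_unit_measure [simp]: "space (unit_measure K) = UNIV"
  using sets_eq_imp_space_eq[OF sets_unit_measure[of K]] by simp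

sublocale unit: finite_measure "unit_measure K"
  by standard (use emeasure_unit_measure[OF K] in simp)

lemma nn_integral_\<kappa>:
  assumes [measurable]: "f \<in> borel_measurable borel"
  shows "(\<integral>\<^sup>+z. f z \<partial>\<kappa>) = (\<integral>\<^sup>+r. \<integral>\<^sup>+u. f (of_real r * u) \<partial>unit_measure K \<partial>radial_measure \<alpha>)"
proof -
  have "(\<integral>\<^sup>+z. f z \<partial>\<kappa>) = (\<integral>\<^sup>+(r, u). f (of_real r * u) \<partial>(radial_measure \<alpha> \<Otimes>\<^sub>M unit_measure K))"
    by (simp add: \<kappa>_def nn_integral_distr split_beta')
  also have "\<dots> = (\<integral>\<^sup>+r. \<integral>\<^sup>+u. f (of_real r * u) \<partial>unit_measure K \<partial>radial_measure \<alpha>)"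
    by (subst unit.nn_integral_fst[symmetric]) simp_all
  finally show ?thesis .
qed

text \<open>The phase of \<open>c\<close>, which again lies in \<open>K\<close>, is absorbed by the
  rotation invariance of the unit measure, and its modulus by the scaling of the radial
  measure.\<close>

lemma nn_integral_\<kappa>_scale:
  assumes c: "c \<in> K" "c \<noteq> 0" and [measurable]: "f \<in> borel_measurable borel"
  shows "(\<integral>\<^sup>+z. f (c * z) \<partial>\<kappa>) = ennreal (norm c powr \<alpha>) * (\<integral>\<^sup>+z. f z \<partial>\<kappa>)"
proof -
  have sK: "c / of_real (norm c) \<in> K" and s1: "norm (c / of_real (norm c)) = 1"
    using c by (auto simp: norm_divide)
  have "(\<integral>\<^sup>+z. f (c * z) \<partial>\<kappa>) = (\<integral>\<^sup>+r. \<integral>\<^sup>+u. f (of_real (norm c * r) * ((c / of_real (norm c)) * u)) \<partial>unit_measure K \<partial>radial_measure \<alpha>)"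
    using c by (subst nn_integral_\<kappa>) (auto simp: mult_ac)
  also have "\<dots> = (\<integral>\<^sup>+r. \<integral>\<^sup>+u. f (of_real (norm c * r) * u) \<partial>unit_measure K \<partial>radial_measure \<alpha>)"
    by (intro nn_integral_cong nn_integral_unit_measure_rotate[OF K sK s1]) measurable
  also have "\<dots> = ennreal (norm c powr \<alpha>) * (\<integral>\<^sup>+r. \<integral>\<^sup>+u. f (of_real r * u) \<partial>unit_measure K \<partial>radial_measure \<alpha>)"
    using c by (intro nn_integral_radial_measure_scale) auto
  finally show ?thesis by (simp add: nn_integral_\<kappa>)
qed

lemma AE_\<kappa>: "AE z in \<kappa>. z \<noteq> 0 \<and> z \<in> K"
proof -
  let ?A = "{z. \<not> (z \<noteq> 0 \<and> z \<in> K)}"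
  have "closed K" using K by (auto simp: closed_complex_Reals)
  then have m: "?A \<in> sets borel"
    using borel_closed[of K] by (auto simp: Collect_conj_eq Collect_neg_eq Collect_disj_eq)
  have "emeasure \<kappa> ?A = (\<integral>\<^sup>+z. indicator ?A z \<partial>\<kappa>)" using m by simp
  also have "\<dots> = (\<integral>\<^sup>+r. \<integral>\<^sup>+u. indicator ?A (of_real r * u) \<partial>unit_measure K \<partial>radial_measure \<alpha>)"
    using m by (intro nn_integral_\<kappa>) simp
  also have "\<dots> = (\<integral>\<^sup>+r. 0 \<partial>radial_measure \<alpha>)"
  proof (rule nn_integral_cong_AE, use AE_radial_measure in eventually_elim)
    fix r :: real assume "r > 0"
    have "AE u in unit_measure K. indicator ?A (of_real r * u) = (0 :: ennreal)"
      by (rule eventually_mono[OF AE_unit_measure[OF K]]) (use \<open>r > 0\<close> in \<open>auto simp: indicator_def\<close>)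
    then have "(\<integral>\<^sup>+u. indicator ?A (of_real r * u) \<partial>unit_measure K) = (\<integral>\<^sup>+u. 0 \<partial>unit_measure K)"
      by (rule nn_integral_cong_AE)
    then show "(\<integral>\<^sup>+u. indicator ?A (of_real r * u) \<partial>unit_measure K) = 0" by simp
  qed
  finally have "emeasure \<kappa> ?A = 0" by simp
  then show ?thesis using m by (subst AE_iff_measurable[OF _ refl]) simp_all
qed

lemma nn_integral_\<kappa>_min_finite: "(\<integral>\<^sup>+z. ennreal (min 1 ((norm z)\<^sup>2)) \<partial>\<kappa>) < \<infinity>"
proof -
  have "(\<integral>\<^sup>+z. ennreal (min 1 ((norm z)\<^sup>2)) \<partial>\<kappa>) =
    (\<integral>\<^sup>+r. \<integral>\<^sup>+u. ennreal (min 1 ((norm (of_real r * u))\<^sup>2)) \<partial>unit_measure K \<partial>radial_measure \<alpha>)"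
    by (rule nn_integral_\<kappa>) simp
  also have "\<dots> = (\<integral>\<^sup>+r. \<integral>\<^sup>+u. ennreal (min 1 (r\<^sup>2)) \<partial>unit_measure K \<partial>radial_measure \<alpha>)"
  proof (rule nn_integral_cong, rule nn_integral_cong_AE)
    fix r :: real
    show "AE u in unit_measure K. ennreal (min 1 ((norm (of_real r * u))\<^sup>2)) = ennreal (min 1 (r\<^sup>2))"
      by (rule eventually_mono[OF AE_unit_measure[OF K]]) (simp add: norm_mult power_mult_distrib)
  qed
  also have "\<dots> = (\<integral>\<^sup>+r. ennreal (min 1 (r\<^sup>2)) \<partial>radial_measure \<alpha>) * emeasure (unit_measure K) UNIV"
    by (simp add: nn_integral_multc)
  also have "\<dots> < \<infinity>"
    using nn_integral_radial_measure_finite[OF \<alpha>] emeasure_unit_measure[OF K] by (simp add: ennreal_mult_less_top)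
  finally show ?thesis .
qed

sublocale \<kappa>: sigma_finite_measure \<kappa>
  by (rule sigma_finite_measureI_nn_integral[where f = "\<lambda>_ :: unit. \<lambda>z. ennreal (min 1 ((norm z)\<^sup>2))"])
     (use AE_\<kappa> nn_integral_\<kappa>_min_finite in \<open>auto elim!: eventually_mono\<close>)

lemma \<kappa>_nonzero: "\<not> (AE z in \<kappa>. False)"
proof
  assume "AE z in \<kappa>. False"
  then have "(\<integral>\<^sup>+z. 1 \<partial>\<kappa>) = (\<integral>\<^sup>+z. 0 \<partial>\<kappa>)" by (intro nn_integral_cong_AE) auto
  moreover have "(\<integral>\<^sup>+z. 1 \<partial>\<kappa>) = emeasure (unit_measure K) UNIV * emeasure (radial_measure \<alpha>) UNIV"
    by (subst nn_integral_\<kappa>) simp_all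
  ultimately show False
    using emeasure_unit_measure[OF K] emeasure_radial_measure[of \<alpha>] by simp
qed

lemma AE_\<kappa>_scale:
  assumes c: "c \<in> K" "c \<noteq> 0" and [measurable]: "Measurable.pred borel P" and P: "AE z in \<kappa>. P z"
  shows "AE z in \<kappa>. P (c * z)"
proof -
  have "(\<integral>\<^sup>+z. indicator {z. \<not> P z} (c * z) \<partial>\<kappa>) = ennreal (norm c powr \<alpha>) * (\<integral>\<^sup>+z. indicator {z. \<not> P z} z \<partial>\<kappa>)"
    by (rule nn_integral_\<kappa>_scale[OF c]) simp
  also have "(\<integral>\<^sup>+z. indicator {z. \<not> P z} z \<partial>\<kappa>) = (\<integral>\<^sup>+z. 0 \<partial>\<kappa>)"
    using P by (intro nn_integral_cong_AE) (auto elim!: eventually_mono simp: indicator_def)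
  finally have "(\<integral>\<^sup>+z. indicator {z. \<not> P z} (c * z) \<partial>\<kappa>) = 0" by simp
  then show ?thesis
    by (subst (asm) nn_integral_0_iff_AE) (auto elim!: eventually_mono simp: indicator_def)
qed

text \<open>The value of the one-dimensional exponent at frequency 1 when \<kappa> is the Levy
  measure. It is the factor between exponents and masses on path space, and is cancelled at the
  end.\<close>

definition C\<^sub>\<alpha> :: ennreal where
  "C\<^sub>\<alpha> = (\<integral>\<^sup>+z. ennreal (1 - cos (Re z)) \<partial>\<kappa>)"

lemma C\<^sub>\<alpha>_finite: "C\<^sub>\<alpha> < \<infinity>"
proof -
  have "C\<^sub>\<alpha> \<le> (\<integral>\<^sup>+z. ennreal 2 * ennreal (min 1 ((norm z)\<^sup>2)) \<partial>\<kappa>)"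
    unfolding C\<^sub>\<alpha>_def
  proof (rule nn_integral_mono)
    fix z
    show "ennreal (1 - cos (Re z)) \<le> ennreal 2 * ennreal (min 1 ((norm z)\<^sup>2))"
      using one_minus_cos_le[OF abs_Re_le_cmod[of z]] by (subst ennreal_mult[symmetric]) (auto intro: ennreal_leI)
  qed
  also have "\<dots> = ennreal 2 * (\<integral>\<^sup>+z. ennreal (min 1 ((norm z)\<^sup>2)) \<partial>\<kappa>)"
    by (rule nn_integral_cmult) simp
  also have "\<dots> < \<infinity>" using nn_integral_\<kappa>_min_finite by (simp add: ennreal_mult_less_top)
  finally show ?thesis .
qed

text \<open>If the integral vanished, Re z would be a multiple of 2 pi almost everywhere, and by
  homogeneity so would Re z / (n + 1) for every n, which leaves only Re z = 0. When \<open>K\<close>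
  is the plane, multiplication by the imaginary unit transfers this to Im z. Then \<kappa> would be
  carried by the origin, which it does not charge, and so would be the zero measure.\<close>

lemma C\<^sub>\<alpha>_nonzero: "C\<^sub>\<alpha> \<noteq> 0"
proof
  assume "C\<^sub>\<alpha> = 0"
  then have 1: "AE z in \<kappa>. cos (Re z) = 1"
    unfolding C\<^sub>\<alpha>_def by (subst (asm) nn_integral_0_iff_AE)
      (auto elim!: eventually_mono simp: ennreal_eq_0_iff intro!: antisym)
  have Re0: "AE z in \<kappa>. Re z = 0"
  proof -
    have "AE z in \<kappa>. \<forall>n. cos (Re (of_real (1 / Suc n) * z)) = 1"
      unfolding AE_all_countable
    proof (intro allI AE_\<kappa>_scale[OF _ _ _ 1])
      fix n
      show "of_real (1 / Suc n) \<in> K" by (rule K_simps)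
      show "of_real (1 / Suc n) \<noteq> (0 :: complex)" by (simp only: of_real_eq_0_iff) simp
    qed simp
    then show ?thesis
    proof eventually_elim
      fix z :: complex assume z: "\<forall>n. cos (Re (of_real (1 / Suc n) * z)) = 1"
      show "Re z = 0"
      proof (rule ccontr)
        assume nz: "Re z \<noteq> 0"
        obtain n where n: "\<bar>Re z\<bar> < real n" using reals_Archimedean2 by blast
        define y where "y = Re z / Suc n"
        have y: "y \<noteq> 0" "\<bar>y\<bar> < 1" using nz n by (auto simp: y_def divide_simps)
        have "cos y = 1" using z[rule_format, of n] by (simp add: y_def)
        moreover have "cos \<bar>y\<bar> < cos 0"
          using y pi_gt3 by (intro cos_monotone_0_pi) auto
        ultimately show False by (simp add: cos_abs_real)
      qed
    qed
  qed
  have "AE z in \<kappa>. Im z = 0"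
    using K
  proof
    assume "K = \<real>"
    then show ?thesis using AE_\<kappa> by (auto elim!: eventually_mono simp: complex_is_Real_iff)
  next
    assume "K = UNIV"
    then have "AE z in \<kappa>. Re (\<i> * z) = 0"
      by (intro AE_\<kappa>_scale[OF _ _ _ Re0]) auto
    then show ?thesis by simp
  qed
  with Re0 AE_\<kappa> have "AE z in \<kappa>. False"
    by eventually_elim (auto simp: complex_eq_iff)
  then show False using \<kappa>_nonzero by simp
qed

lemma nn_integral_\<kappa>_cos:
  assumes v: "v \<in> K"
  shows "(\<integral>\<^sup>+z. ennreal (1 - cos (Re (z * v))) \<partial>\<kappa>) = ennreal (norm v powr \<alpha>) * C\<^sub>\<alpha>"
proof (cases "v = 0")
  case True
  then show ?thesis by simp
next
  case False
  have "(\<integral>\<^sup>+z. ennreal (1 - cos (Re (v * z))) \<partial>\<kappa>) = ennreal (norm v powr \<alpha>) * (\<integral>\<^sup>+z. ennreal (1 - cos (Re z)) \<partial>\<kappa>)"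
    by (rule nn_integral_\<kappa>_scale[OF v False]) simp
  then show ?thesis by (simp add: C\<^sub>\<alpha>_def mult.commute)
qed

end

section \<open>Kernels on path space\<close>

lemma AE_pair_fst:
  assumes "sigma_finite_measure N" "AE x in M. P x"
  shows "AE p in M \<Otimes>\<^sub>M N. P (fst p)"
proof -
  interpret N: sigma_finite_measure N by fact
  obtain A where A: "{x \<in> space M. \<not> P x} \<subseteq> A" "emeasure M A = 0" "A \<in> sets M"
    using assms(2) by (auto elim: AE_E)
  show ?thesis
  proof (rule AE_I)
    show "{p \<in> space (M \<Otimes>\<^sub>M N). \<not> P (fst p)} \<subseteq> A \<times> space N"
      using A(1) by (auto simp: space_pair_measure)
    show "emeasure (M \<Otimes>\<^sub>M N) (A \<times> space N) = 0"
      using A by (simp add: N.emeasure_pair_measure_Times)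
    show "A \<times> space N \<in> sets (M \<Otimes>\<^sub>M N)" using A by simp
  qed
qed

text \<open>For \<alpha> < 1 there is no Minkowski inequality, and for \<alpha> > 1 the power is not
  subadditive; doubling the larger of the two norms covers every positive \<alpha>.\<close>

lemma powr_norm_add_le:
  fixes a b :: complex
  assumes "0 < \<alpha>"
  shows "norm (a + b) powr \<alpha> \<le> 2 powr \<alpha> * (norm a powr \<alpha> + norm b powr \<alpha>)"
proof -
  let ?m = "max (norm a) (norm b)"
  have "norm (a + b) powr \<alpha> \<le> (2 * ?m) powr \<alpha>"
    using assms norm_triangle_ineq[of a b] by (intro powr_mono2) auto
  also have "\<dots> = 2 powr \<alpha> * ?m powr \<alpha>" by (simp add: powr_mult)
  also have "\<dots> \<le> 2 powr \<alpha> * (norm a powr \<alpha> + norm b powr \<alpha>)"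
    by (intro mult_left_mono) (auto simp: max_def)
  finally show ?thesis .
qed

context stable_index
begin

lemma L_alpha_scale: "f \<in> L_alpha K \<alpha> E \<Longrightarrow> c \<in> K \<Longrightarrow> (\<lambda>x. c * f x) \<in> L_alpha K \<alpha> E"
  by (auto simp: L_alpha_def norm_mult powr_mult)

lemma L_alpha_add:
  assumes f: "f \<in> L_alpha K \<alpha> E" and g: "g \<in> L_alpha K \<alpha> E"
  shows "(\<lambda>x. f x + g x) \<in> L_alpha K \<alpha> E"
proof -
  have [measurable]: "f \<in> borel_measurable E" "g \<in> borel_measurable E"
    using f g by (auto simp: L_alpha_def)
  have "integrable E (\<lambda>x. 2 powr \<alpha> * (norm (f x) powr \<alpha> + norm (g x) powr \<alpha>))"
    using f g by (auto simp: L_alpha_def)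
  then have "integrable E (\<lambda>x. norm (f x + g x) powr \<alpha>)"
    by (rule Bochner_Integration.integrable_bound)
       (auto simp: abs_of_nonneg[OF add_nonneg_nonneg] intro!: AE_I2 powr_norm_add_le \<alpha>)
  then show ?thesis using f g by (auto simp: L_alpha_def)
qed

lemma L_alpha_sum:
  assumes "finite J" "\<And>t. t \<in> J \<Longrightarrow> F t \<in> L_alpha K \<alpha> E" "\<And>t. t \<in> J \<Longrightarrow> \<theta> t \<in> K"
  shows "(\<lambda>x. \<Sum>t\<in>J. \<theta> t * F t x) \<in> L_alpha K \<alpha> E"
  using assms
proof (induction J)
  case empty
  show ?case using \<alpha> by (simp add: L_alpha_def)
next
  case (insert t J)
  then have "(\<lambda>x. \<theta> t * F t x + (\<Sum>t\<in>J. \<theta> t * F t x)) \<in> L_alpha K \<alpha> E"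
    by (intro L_alpha_add L_alpha_scale) auto
  then show ?case using insert by simp
qed

end

text \<open>Closure under both unit shifts makes the time shift a bijection of the product over
  \<open>I\<close>. The intended \<open>I\<close> consists of all integer translates of finitely
  many times.\<close>

locale stable_path = stable_index +
  fixes I :: "real set"
  assumes countable_I: "countable I" and I_shift: "t \<in> I \<Longrightarrow> t + 1 \<in> I" "t \<in> I \<Longrightarrow> t - 1 \<in> I"
begin

definition W :: "(real \<Rightarrow> complex) measure" where
  "W = PiM I (\<lambda>_. borel)"

definition S :: "(real \<Rightarrow> complex) \<Rightarrow> real \<Rightarrow> complex" where
  "S w = (\<lambda>t\<in>I. w (t + 1))"

definition R :: "(real \<Rightarrow> complex) \<Rightarrow> real \<Rightarrow> complex" where
  "R w = (\<lambda>t\<in>I. w (t - 1))"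

lemma S_R_measurable: "S \<in> measurable W W" "R \<in> measurable W W"
  unfolding S_def R_def W_def by (auto intro!: measurable_restrict measurable_component_singleton I_shift)

sublocale path: invertible_system W S R
proof
  show "S \<in> measurable W W" "R \<in> measurable W W" by (rule S_R_measurable)+
  fix w assume "w \<in> space W"
  then show "S (R w) = w" "R (S w) = w"
    using I_shift by (auto simp: W_def S_def R_def space_PiM PiE_def extensional_def fun_eq_iff)
qed

definition kernel :: "'e measure \<Rightarrow> (real \<Rightarrow> 'e \<Rightarrow> complex) \<Rightarrow> bool" where
  "kernel E F \<longleftrightarrow> sigma_finite_measure E \<and> (\<forall>t\<in>I. F t \<in> L_alpha K \<alpha> E)"

definition ray :: "(real \<Rightarrow> 'e \<Rightarrow> complex) \<Rightarrow> 'e \<times> complex \<Rightarrow> real \<Rightarrow> complex" where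
  "ray F = (\<lambda>(x, z). \<lambda>t\<in>I. z * F t x)"

lemma ray_measurable:
  assumes "\<And>t. t \<in> I \<Longrightarrow> F t \<in> borel_measurable E" and k: "sets k = sets borel"
  shows "ray F \<in> measurable (E \<Otimes>\<^sub>M k) W"
proof -
  note [measurable_cong] = k
  have [measurable]: "F t \<in> borel_measurable E" if "t \<in> I" for t using assms that by simp
  have "(\<lambda>p. \<lambda>t\<in>I. snd p * F t (fst p)) \<in> measurable (E \<Otimes>\<^sub>M k) W"
    unfolding W_def by (intro measurable_restrict) measurable
  then show ?thesis by (simp add: ray_def split_beta')
qed

lemma kernel_measurable: "kernel E F \<Longrightarrow> t \<in> I \<Longrightarrow> F t \<in> borel_measurable E"
  by (simp add: kernel_def L_alpha_def)

lemma lin_form_ray: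
  assumes "J \<subseteq> I"
  shows "lin_form \<theta> J (ray F (x, z)) = Re (z * (\<Sum>t\<in>J. \<theta> t * F t x))"
proof -
  have "(\<Sum>t\<in>J. \<theta> t * (if t \<in> I then z * F t x else undefined)) = z * (\<Sum>t\<in>J. \<theta> t * F t x)"
    using assms by (auto simp: sum_distrib_left mult_ac intro!: sum.cong)
  then show ?thesis by (simp add: lin_form_def ray_def restrict_def)
qed

text \<open>On the fibre over x the form is Re (z v), with v the linear combination of the values F
  t x; integrating over z gives a constant times the \<alpha>-th power of norm v.\<close>

lemma nn_integral_ray_cos:
  assumes F: "kernel E F" and J: "finite J" "J \<subseteq> I" and \<theta>: "\<forall>t\<in>J. \<theta> t \<in> K"
  shows "(\<integral>\<^sup>+p. ennreal (1 - cos (lin_form \<theta> J (ray F p))) \<partial>(E \<Otimes>\<^sub>M \<kappa>)) =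
    ennreal (LINT x|E. norm (\<Sum>t\<in>J. \<theta> t * F t x) powr \<alpha>) * C\<^sub>\<alpha>"
proof -
  let ?f = "\<lambda>x. \<Sum>t\<in>J. \<theta> t * F t x"
  have L: "?f \<in> L_alpha K \<alpha> E" using F J \<theta> by (intro L_alpha_sum) (auto simp: kernel_def)
  then have [measurable]: "?f \<in> borel_measurable E" by (simp add: L_alpha_def)
  note [measurable] = ray_measurable[OF kernel_measurable[OF F] sets_\<kappa>] lin_form_measurable[OF J(2), folded W_def]
  have "(\<integral>\<^sup>+p. ennreal (1 - cos (lin_form \<theta> J (ray F p))) \<partial>(E \<Otimes>\<^sub>M \<kappa>)) =
    (\<integral>\<^sup>+x. \<integral>\<^sup>+z. ennreal (1 - cos (lin_form \<theta> J (ray F (x, z)))) \<partial>\<kappa> \<partial>E)"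
    by (subst \<kappa>.nn_integral_fst[symmetric]) auto
  also have "\<dots> = (\<integral>\<^sup>+x. ennreal (norm (?f x) powr \<alpha>) * C\<^sub>\<alpha> \<partial>E)"
  proof (rule nn_integral_cong)
    fix x assume "x \<in> space E"
    then have "?f x \<in> K" using L by (simp add: L_alpha_def)
    then show "(\<integral>\<^sup>+z. ennreal (1 - cos (lin_form \<theta> J (ray F (x, z)))) \<partial>\<kappa>) = ennreal (norm (?f x) powr \<alpha>) * C\<^sub>\<alpha>"
      unfolding lin_form_ray[OF J(2)] by (rule nn_integral_\<kappa>_cos)
  qed
  also have "\<dots> = (\<integral>\<^sup>+x. ennreal (norm (?f x) powr \<alpha>) \<partial>E) * C\<^sub>\<alpha>"
    by (rule nn_integral_multc) simp
  also have "(\<integral>\<^sup>+x. ennreal (norm (?f x) powr \<alpha>) \<partial>E) = ennreal (LINT x|E. norm (?f x) powr \<alpha>)"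
    using L by (intro nn_integral_eq_integral) (auto simp: L_alpha_def)
  finally show ?thesis .
qed

text \<open>This keeps of a flow representation only its time-one relation. For a flow,
  \<open>c\<close> is the cocycle at time 1 times the \<alpha>-th root of the Jacobian, and the
  integral identity says that the \<alpha>-th power of norm c is the density of m o \<phi> with
  respect to m.\<close>

definition nonsingular_kernel where
  "nonsingular_kernel E F \<phi> c \<longleftrightarrow> kernel E F \<and> \<phi> \<in> measurable E E \<and> c \<in> borel_measurable E \<and>
    (AE x in E. c x \<in> K \<and> c x \<noteq> 0 \<and> (\<forall>t\<in>I. F (t + 1) x = c x * F t (\<phi> x))) \<and>
    (\<forall>h \<in> borel_measurable E. (\<integral>\<^sup>+x. h (\<phi> x) * ennreal (norm (c x) powr \<alpha>) \<partial>E) = (\<integral>\<^sup>+x. h x \<partial>E))"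

text \<open>The extension is the skew product over \<open>\<phi>\<close> that multiplies the fibre
  by \<open>c\<close>, the factor map is \<open>ray F\<close>, and the integrable weight on paths is
  1 - cos of the chosen form.\<close>

lemma null_kernel_singular:
  assumes ns: "nonsingular_kernel E F \<phi> c"
    and B: "B \<in> sets E" and disj: "disjoint_family (\<lambda>k :: nat. (\<phi> ^^ n k) -` B \<inter> space E)"
    and cov: "AE x in E. \<exists>k. (\<phi> ^^ n k) x \<in> B"
    and J: "finite J" "J \<subseteq> I" and \<theta>: "\<forall>t\<in>J. \<theta> t \<in> K"
    and L: "finite_measure L" "sets L = sets W" "distr L W S = L"
  obtains N where "N \<in> sets W"
    "(\<integral>\<^sup>+p. ennreal (1 - cos (lin_form \<theta> J (ray F p))) * indicator N (ray F p) \<partial>(E \<Otimes>\<^sub>M \<kappa>)) = 0"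
    "emeasure L {w \<in> space W - N. ennreal (1 - cos (lin_form \<theta> J w)) > 0} = 0"
proof -
  have F: "kernel E F" and [measurable]: "\<phi> \<in> measurable E E" "c \<in> borel_measurable E"
    and c: "AE x in E. c x \<in> K \<and> c x \<noteq> 0 \<and> (\<forall>t\<in>I. F (t + 1) x = c x * F t (\<phi> x))"
    and inv: "\<And>h. h \<in> borel_measurable E \<Longrightarrow> (\<integral>\<^sup>+x. h (\<phi> x) * ennreal (norm (c x) powr \<alpha>) \<partial>E) = (\<integral>\<^sup>+x. h x \<partial>E)"
    using ns by (auto simp: nonsingular_kernel_def)
  interpret E: sigma_finite_measure E using F by (simp add: kernel_def)
  interpret pair_sigma_finite E \<kappa> ..
  note [measurable] = B lin_form_measurable[OF J(2), folded W_def]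
  note ray[measurable] = ray_measurable[OF kernel_measurable[OF F] sets_\<kappa>]
  let ?E = "E \<Otimes>\<^sub>M \<kappa>"
  define \<Phi> where "\<Phi> = (\<lambda>(x, z). (\<phi> x, c x * z))"
  have \<Phi>[measurable]: "\<Phi> \<in> measurable ?E ?E" unfolding \<Phi>_def by measurable
  have "distr ?E ?E \<Phi> = ?E"
  proof (rule measure_eqI)
    fix A assume A0: "A \<in> sets (distr ?E ?E \<Phi>)"
    then have A[measurable]: "A \<in> sets ?E" by simp
    have "emeasure (distr ?E ?E \<Phi>) A = (\<integral>\<^sup>+p. indicator A p \<partial>distr ?E ?E \<Phi>)"
      by (rule nn_integral_indicator[OF A0, symmetric])
    also have "\<dots> = (\<integral>\<^sup>+p. indicator A (\<Phi> p) \<partial>?E)" by (rule nn_integral_distr) measurable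
    also have "\<dots> = (\<integral>\<^sup>+x. \<integral>\<^sup>+z. indicator A (\<phi> x, c x * z) \<partial>\<kappa> \<partial>E)"
      by (subst \<kappa>.nn_integral_fst[symmetric]) (simp_all add: \<Phi>_def)
    \<comment> \<open>Homogeneity of \<kappa> under multiplication by c x produces exactly the
      Jacobian factor that \<open>inv\<close> removes.\<close>
    also have "\<dots> = (\<integral>\<^sup>+x. (\<integral>\<^sup>+z. indicator A (\<phi> x, z) \<partial>\<kappa>) * ennreal (norm (c x) powr \<alpha>) \<partial>E)"
    proof (rule nn_integral_cong_AE, use c AE_space in eventually_elim)
      fix x assume x: "c x \<in> K \<and> c x \<noteq> 0 \<and> (\<forall>t\<in>I. F (t + 1) x = c x * F t (\<phi> x))" "x \<in> space E"
      have [measurable]: "\<phi> x \<in> space E" using x by (auto intro: measurable_space)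
      show "(\<integral>\<^sup>+z. indicator A (\<phi> x, c x * z) \<partial>\<kappa>) = (\<integral>\<^sup>+z. indicator A (\<phi> x, z) \<partial>\<kappa>) * ennreal (norm (c x) powr \<alpha>)"
        using x by (subst nn_integral_\<kappa>_scale) (auto simp: mult.commute)
    qed
    also have "\<dots> = (\<integral>\<^sup>+x. \<integral>\<^sup>+z. indicator A (x, z) \<partial>\<kappa> \<partial>E)" by (rule inv) measurable
    also have "\<dots> = emeasure ?E A" by (subst \<kappa>.nn_integral_fst) (simp_all add: nn_integral_indicator[OF A])
    finally show "emeasure (distr ?E ?E \<Phi>) A = emeasure ?E A" .
  qed simp
  have pow: "fst ((\<Phi> ^^ k) p) = (\<phi> ^^ k) (fst p)" for k p
    by (induction k) (simp_all add: \<Phi>_def split_beta')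
  \<comment> \<open>Wandering concerns the first coordinate, on which \<open>\<Phi>\<close> acts as
    \<open>\<phi>\<close>, so whole fibres are taken along.\<close>
  define B' where "B' = B \<times> (UNIV :: complex set)"
  have pre: "(\<Phi> ^^ k) -` B' \<inter> space ?E = ((\<phi> ^^ k) -` B \<inter> space E) \<times> UNIV" for k
    by (simp add: set_eq_iff B'_def space_pair_measure pow mem_Times_iff del: split_paired_All)
  have B': "B' \<in> sets ?E" unfolding B'_def using B by (intro pair_measureI) auto
  have disj': "disjoint_family (\<lambda>k. (\<Phi> ^^ n k) -` B' \<inter> space ?E)"
    using disj unfolding pre disjoint_family_on_def by blast
  have cov': "AE p in ?E. \<exists>k. (\<Phi> ^^ n k) p \<in> B'"
  proof -
    have "AE p in ?E. \<exists>k. (\<phi> ^^ n k) (fst p) \<in> B"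
      by (rule AE_pair_fst[OF \<kappa>.sigma_finite_measure_axioms cov])
    then show ?thesis by (simp add: B'_def mem_Times_iff pow)
  qed
  have eqv: "AE p in ?E. ray F (\<Phi> p) = S (ray F p)"
  proof -
    have "AE x in E. \<forall>t\<in>I. F (t + 1) x = c x * F t (\<phi> x)"
      using c by eventually_elim auto
    then have "AE p in ?E. \<forall>t\<in>I. F (t + 1) (fst p) = c (fst p) * F t (\<phi> (fst p))"
      by (rule AE_pair_fst[OF \<kappa>.sigma_finite_measure_axioms])
    then show ?thesis
      by eventually_elim (auto simp: ray_def \<Phi>_def S_def split_beta' fun_eq_iff I_shift mult_ac)
  qed
  have fin: "(\<integral>\<^sup>+p. ennreal (1 - cos (lin_form \<theta> J (ray F p))) \<partial>?E) < \<infinity>"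
    using nn_integral_ray_cos[OF F J \<theta>] C\<^sub>\<alpha>_finite by (simp add: ennreal_mult_less_top)
  show ?thesis
    by (rule path.null_factor_singular[OF \<Phi> \<open>distr ?E ?E \<Phi> = ?E\<close> ray eqv B' disj' cov' _ fin L])
       (use that in auto)
qed

end

section \<open>Finite invariant path measures for positive kernels\<close>

context stable_path
begin

text \<open>The weight makes the measure finite and is positive off the origin, so null sets are
  those of \<kappa>. It depends on the modulus only, so rotations in \<open>K\<close> still preserve
  the measure, but scaling no longer acts simply: the multiplier \<open>c\<close> has to be brought
  to modulus 1 first.\<close>

definition \<kappa>' :: "complex measure" where
  "\<kappa>' = density \<kappa> (\<lambda>z. ennreal (min 1 ((norm z)\<^sup>2)))"

lemma sets_\<kappa>' [simp, measurable_cong]: "sets \<kappa>' = sets borel"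
  by (simp add: \<kappa>'_def)

lemma space_\<kappa>' [simp]: "space \<kappa>' = UNIV"
  by (simp add: \<kappa>'_def)

sublocale \<kappa>': finite_measure \<kappa>'
  by standard (use nn_integral_\<kappa>_min_finite in \<open>simp add: \<kappa>'_def emeasure_density\<close>)

lemma nn_integral_\<kappa>'_rotate:
  assumes c: "c \<in> K" "norm c = 1" and [measurable]: "f \<in> borel_measurable borel"
  shows "(\<integral>\<^sup>+z. f (c * z) \<partial>\<kappa>') = (\<integral>\<^sup>+z. f z \<partial>\<kappa>')"
proof -
  have "(\<integral>\<^sup>+z. f (c * z) \<partial>\<kappa>') = (\<integral>\<^sup>+z. ennreal (min 1 ((norm (c * z))\<^sup>2)) * f (c * z) \<partial>\<kappa>)"
    using c by (simp add: \<kappa>'_def nn_integral_density norm_mult)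
  also have "\<dots> = ennreal (norm c powr \<alpha>) * (\<integral>\<^sup>+z. ennreal (min 1 ((norm z)\<^sup>2)) * f z \<partial>\<kappa>)"
    using c by (intro nn_integral_\<kappa>_scale) auto
  finally show ?thesis using c by (simp add: \<kappa>'_def nn_integral_density)
qed

lemma AE_\<kappa>'_iff: "(AE z in \<kappa>'. P z) \<longleftrightarrow> (AE z in \<kappa>. P z)"
proof -
  have "(AE z in \<kappa>'. P z) \<longleftrightarrow> (AE z in \<kappa>. z \<noteq> 0 \<longrightarrow> P z)"
    unfolding \<kappa>'_def by (subst AE_density) auto
  also have "\<dots> \<longleftrightarrow> (AE z in \<kappa>. P z)"
    using AE_\<kappa> by (intro eventually_subst) (auto elim: eventually_mono)
  finally show ?thesis .
qed

text \<open>Normalising by the density of \<open>E\<close> with respect to the invariant measure turns the nonsingular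
  kernel into a measure preserving one; dropping the radial mass makes its law on paths finite
  without changing the null sets.\<close>

lemma positive_kernel_dominated:
  assumes ns: "nonsingular_kernel E F \<phi> c"
    and \<psi>: "\<psi> \<in> measurable E E" "\<And>x. x \<in> space E \<Longrightarrow> \<phi> (\<psi> x) = x" "\<And>x. x \<in> space E \<Longrightarrow> \<psi> (\<phi> x) = x"
    and \<mu>: "finite_measure \<mu>" "equivalent_measures \<mu> E" "distr \<mu> \<mu> \<phi> = \<mu>"
  obtains L where "finite_measure L" "sets L = sets W" "distr L W S = L"
    "\<And>A. A \<in> sets W \<Longrightarrow> emeasure L A = 0 \<Longrightarrow> AE p in E \<Otimes>\<^sub>M \<kappa>. ray F p \<notin> A"
proof -
  have F: "kernel E F" and \<phi>[measurable]: "\<phi> \<in> measurable E E" and c[measurable]: "c \<in> borel_measurable E"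
    and cF: "AE x in E. c x \<in> K \<and> c x \<noteq> 0 \<and> (\<forall>t\<in>I. F (t + 1) x = c x * F t (\<phi> x))"
    and inv: "\<And>h. h \<in> borel_measurable E \<Longrightarrow> (\<integral>\<^sup>+x. h (\<phi> x) * ennreal (norm (c x) powr \<alpha>) \<partial>E) = (\<integral>\<^sup>+x. h x \<partial>E)"
    using ns by (auto simp: nonsingular_kernel_def)
  interpret E: sigma_finite_measure E using F by (simp add: kernel_def)
  interpret \<mu>: finite_measure \<mu> by fact
  have s\<mu>[measurable_cong, simp]: "sets \<mu> = sets E" using \<mu>(2) by (simp add: equivalent_measures_def)
  have sp\<mu>[simp]: "space \<mu> = space E" by (rule sets_eq_imp_space_eq) simp
  note [measurable] = \<psi>(1)
  have ac: "absolutely_continuous \<mu> E" "absolutely_continuous E \<mu>"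
    using \<mu>(2) by (auto simp: equivalent_measures_def)
  have E_\<mu>: "(AE x in \<mu>. P x) \<longleftrightarrow> (AE x in E. P x)" for P
    using absolutely_continuous_AE[OF _ ac(1), of P] absolutely_continuous_AE[OF _ ac(2), of P] by auto
  define \<rho> where "\<rho> = RN_deriv \<mu> E"
  have \<rho>m[measurable]: "\<rho> \<in> borel_measurable E"
    unfolding \<rho>_def using borel_measurable_RN_deriv[of \<mu> E] by simp
  have \<rho>: "density \<mu> \<rho> = E" unfolding \<rho>_def by (rule \<mu>.density_RN_deriv[OF ac(1)]) simp
  have \<rho>_fin: "AE x in \<mu>. \<rho> x \<noteq> \<infinity>"
    unfolding \<rho>_def by (rule \<mu>.RN_deriv_finite[OF E.sigma_finite_measure_axioms ac(1)]) simp
  have \<rho>_pos: "AE x in \<mu>. \<rho> x \<noteq> 0"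
  proof -
    have "AE x in density \<mu> \<rho>. \<rho> x \<noteq> 0" by (subst AE_density) auto
    then show ?thesis unfolding \<rho> E_\<mu> .
  qed
  have E_int: "(\<integral>\<^sup>+x. f x \<partial>E) = (\<integral>\<^sup>+x. \<rho> x * f x \<partial>\<mu>)" if [measurable]: "f \<in> borel_measurable E" for f
    by (subst \<rho>[symmetric]) (simp add: nn_integral_density)
  have \<mu>_int: "(\<integral>\<^sup>+x. f (\<phi> x) \<partial>\<mu>) = (\<integral>\<^sup>+x. f x \<partial>\<mu>)" if [measurable]: "f \<in> borel_measurable E" for f
    by (subst (2) \<mu>(3)[symmetric]) (simp add: nn_integral_distr)
  \<comment> \<open>\<open>E\<close> has density \<open>\<rho>\<close> with respect to the invariant
    \<open>\<mu>\<close>. Computing the measure of a set both through the Jacobian of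
    \<open>\<phi>\<close> for \<open>E\<close> and through the invariance of \<open>\<mu>\<close>
    yields two densities, which must agree almost everywhere.\<close>
  have \<rho>_\<phi>: "AE x in \<mu>. \<rho> x * ennreal (norm (c x) powr \<alpha>) = \<rho> (\<phi> x)"
  proof (rule \<mu>.density_unique)
    show "density \<mu> (\<lambda>x. \<rho> x * ennreal (norm (c x) powr \<alpha>)) = density \<mu> (\<lambda>x. \<rho> (\<phi> x))"
    proof (rule measure_eqI)
      fix A assume "A \<in> sets (density \<mu> (\<lambda>x. \<rho> x * ennreal (norm (c x) powr \<alpha>)))"
      then have A[measurable]: "A \<in> sets E" by simp
      have "emeasure (density \<mu> (\<lambda>x. \<rho> x * ennreal (norm (c x) powr \<alpha>))) A =
        (\<integral>\<^sup>+x. \<rho> x * (indicator A x * ennreal (norm (c x) powr \<alpha>)) \<partial>\<mu>)"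
        by (subst emeasure_density) (auto simp: mult_ac)
      also have "\<dots> = (\<integral>\<^sup>+x. indicator A x * ennreal (norm (c x) powr \<alpha>) \<partial>E)"
        by (rule E_int[symmetric]) measurable
      \<comment> \<open>Writing x as \<psi> (\<phi> x) makes the indicator a function of \<phi> x,
        the form that \<open>inv\<close> can integrate.\<close>
      also have "\<dots> = (\<integral>\<^sup>+x. indicator A (\<psi> (\<phi> x)) * ennreal (norm (c x) powr \<alpha>) \<partial>E)"
        by (intro nn_integral_cong) (simp add: \<psi>)
      also have "\<dots> = (\<integral>\<^sup>+x. indicator A (\<psi> x) \<partial>E)" by (rule inv) measurable
      also have "\<dots> = (\<integral>\<^sup>+x. \<rho> x * indicator A (\<psi> x) \<partial>\<mu>)" by (rule E_int) measurable
      also have "\<dots> = (\<integral>\<^sup>+x. \<rho> (\<phi> x) * indicator A (\<psi> (\<phi> x)) \<partial>\<mu>)"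
        by (rule \<mu>_int[symmetric]) measurable
      also have "\<dots> = (\<integral>\<^sup>+x. \<rho> (\<phi> x) * indicator A x \<partial>\<mu>)"
        by (intro nn_integral_cong) (simp add: \<psi>)
      also have "\<dots> = emeasure (density \<mu> (\<lambda>x. \<rho> (\<phi> x))) A"
        by (subst emeasure_density) auto
      finally show "emeasure (density \<mu> (\<lambda>x. \<rho> x * ennreal (norm (c x) powr \<alpha>))) A =
        emeasure (density \<mu> (\<lambda>x. \<rho> (\<phi> x))) A" .
    qed simp
  qed measurable
  \<comment> \<open>Taking the root of the density relation gives g (\<phi> x) = g x * norm (c x).
    Rescaling \<open>F\<close> by \<open>g\<close> therefore leaves only the phase of
    \<open>c\<close> as multiplier.\<close>
  define g where "g x = enn2real (\<rho> x) powr (1 / \<alpha>)" for x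
  have [measurable]: "g \<in> borel_measurable E" unfolding g_def by measurable
  define G where "G t x = of_real (g x) * F t x" for t x
  have F_meas: "F t \<in> borel_measurable E" if "t \<in> I" for t using kernel_measurable[OF F that] .
  have G_meas: "G t \<in> borel_measurable \<mu>" if "t \<in> I" for t
    unfolding G_def using F_meas[OF that] by measurable
  have g_pos: "AE x in E. g x > 0"
    using \<rho>_fin \<rho>_pos unfolding E_\<mu>
    by eventually_elim (auto simp: g_def enn2real_eq_0_iff)
  have G: "AE x in \<mu>. c x \<in> K \<and> c x \<noteq> 0 \<and> (\<forall>t\<in>I. G (t + 1) x = c x / of_real (norm (c x)) * G t (\<phi> x))"
    using cF[folded E_\<mu>] \<rho>_\<phi>
  proof eventually_elim
    fix x assume *: "c x \<in> K \<and> c x \<noteq> 0 \<and> (\<forall>t\<in>I. F (t + 1) x = c x * F t (\<phi> x))"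
      and **: "\<rho> x * ennreal (norm (c x) powr \<alpha>) = \<rho> (\<phi> x)"
    have "g (\<phi> x) = (enn2real (\<rho> x) * norm (c x) powr \<alpha>) powr (1 / \<alpha>)"
      by (simp add: g_def **[symmetric] enn2real_mult)
    also have "\<dots> = g x * norm (c x)"
      using * \<alpha> by (simp add: g_def powr_mult powr_powr)
    finally have "g (\<phi> x) = g x * norm (c x)" .
    then show "c x \<in> K \<and> c x \<noteq> 0 \<and> (\<forall>t\<in>I. G (t + 1) x = c x / of_real (norm (c x)) * G t (\<phi> x))"
      using * by (simp add: G_def)
  qed
  note rayG[measurable] = ray_measurable[OF G_meas sets_\<kappa>']
  define L where "L = distr (\<mu> \<Otimes>\<^sub>M \<kappa>') W (ray G)"
  have sL[measurable_cong]: "sets L = sets W" by (simp add: L_def)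
  have L_int: "(\<integral>\<^sup>+w. f w \<partial>L) = (\<integral>\<^sup>+x. \<integral>\<^sup>+z. f (ray G (x, z)) \<partial>\<kappa>' \<partial>\<mu>)"
    if [measurable]: "f \<in> borel_measurable W" for f
    unfolding L_def by (subst \<kappa>'.nn_integral_fst) (auto simp: nn_integral_distr)
  have fL: "finite_measure L"
    unfolding L_def by (intro finite_measure.finite_measure_distr finite_measure_pair_measure \<mu>(1) \<kappa>'.finite_measure_axioms rayG)
  have ray_z: "(\<lambda>z. ray G (x, z)) \<in> measurable borel W" for x
    unfolding ray_def W_def by (auto intro!: measurable_restrict)
  have invL: "distr L W S = L"
  proof (rule measure_eqI)
    fix A assume A0: "A \<in> sets (distr L W S)"
    then have A[measurable]: "A \<in> sets W" by simp
    have "emeasure (distr L W S) A = (\<integral>\<^sup>+w. indicator A w \<partial>distr L W S)"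
      by (rule nn_integral_indicator[OF A0, symmetric])
    also have "\<dots> = (\<integral>\<^sup>+w. indicator A (S w) \<partial>L)" by (rule nn_integral_distr) measurable
    also have "\<dots> = (\<integral>\<^sup>+x. \<integral>\<^sup>+z. indicator A (S (ray G (x, z))) \<partial>\<kappa>' \<partial>\<mu>)" by (rule L_int) measurable
    also have "\<dots> = (\<integral>\<^sup>+x. \<integral>\<^sup>+z. indicator A (ray G (\<phi> x, z)) \<partial>\<kappa>' \<partial>\<mu>)"
    proof (rule nn_integral_cong_AE, use G in eventually_elim)
      fix x assume *: "c x \<in> K \<and> c x \<noteq> 0 \<and> (\<forall>t\<in>I. G (t + 1) x = c x / of_real (norm (c x)) * G t (\<phi> x))"
      note [measurable] = ray_z
      have "(\<integral>\<^sup>+z. indicator A (S (ray G (x, z))) \<partial>\<kappa>') =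
        (\<integral>\<^sup>+z. indicator A (ray G (\<phi> x, c x / of_real (norm (c x)) * z)) \<partial>\<kappa>')"
      proof (rule nn_integral_cong)
        fix z
        have "S (ray G (x, z)) = ray G (\<phi> x, c x / of_real (norm (c x)) * z)"
          using * by (auto simp: S_def ray_def fun_eq_iff I_shift)
        then show "indicator A (S (ray G (x, z))) = (indicator A (ray G (\<phi> x, c x / of_real (norm (c x)) * z)) :: ennreal)"
          by simp
      qed
      also have "\<dots> = (\<integral>\<^sup>+z. indicator A (ray G (\<phi> x, z)) \<partial>\<kappa>')"
        using * by (intro nn_integral_\<kappa>'_rotate) (auto simp: norm_divide)
      finally show "(\<integral>\<^sup>+z. indicator A (S (ray G (x, z))) \<partial>\<kappa>') = (\<integral>\<^sup>+z. indicator A (ray G (\<phi> x, z)) \<partial>\<kappa>')" .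
    qed
    also have "\<dots> = (\<integral>\<^sup>+x. \<integral>\<^sup>+z. indicator A (ray G (x, z)) \<partial>\<kappa>' \<partial>\<mu>)"
    proof (rule \<mu>_int)
      have "(\<lambda>x. \<integral>\<^sup>+z. indicator A (ray G (x, z)) \<partial>\<kappa>') \<in> borel_measurable \<mu>"
        by (rule \<kappa>'.borel_measurable_nn_integral_fst) measurable
      then show "(\<lambda>x. \<integral>\<^sup>+z. indicator A (ray G (x, z)) \<partial>\<kappa>') \<in> borel_measurable E" by simp
    qed
    also have "\<dots> = (\<integral>\<^sup>+w. indicator A w \<partial>L)" by (rule L_int[symmetric]) measurable
    also have "\<dots> = emeasure L A" using sL by simp
    finally show "emeasure (distr L W S) A = emeasure L A" .
  qed (simp add: sL)
  show thesis
  proof (rule that[OF fL sL invL])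
    fix A assume A[measurable]: "A \<in> sets W" and L0: "emeasure L A = 0"
    note [measurable] = ray_z ray_measurable[OF F_meas sets_\<kappa>]
    have "(\<integral>\<^sup>+x. \<integral>\<^sup>+z. indicator A (ray G (x, z)) \<partial>\<kappa>' \<partial>\<mu>) = (\<integral>\<^sup>+w. indicator A w \<partial>L)"
      by (rule L_int[symmetric]) measurable
    also have "\<dots> = 0" using L0 sL by simp
    finally have "(\<integral>\<^sup>+x. \<integral>\<^sup>+z. indicator A (ray G (x, z)) \<partial>\<kappa>' \<partial>\<mu>) = 0" .
    moreover have "(\<lambda>x. \<integral>\<^sup>+z. indicator A (ray G (x, z)) \<partial>\<kappa>') \<in> borel_measurable \<mu>"
      by (rule \<kappa>'.borel_measurable_nn_integral_fst) measurable
    ultimately have "AE x in \<mu>. (\<integral>\<^sup>+z. indicator A (ray G (x, z)) \<partial>\<kappa>') = 0"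
      by (simp add: nn_integral_0_iff_AE)
    then have "AE x in E. (\<integral>\<^sup>+z. indicator A (ray F (x, z)) \<partial>\<kappa>) = 0"
      unfolding E_\<mu> using g_pos
    proof eventually_elim
      fix x assume 0: "(\<integral>\<^sup>+z. indicator A (ray G (x, z)) \<partial>\<kappa>') = 0" and g: "g x > 0"
      have "AE z in \<kappa>'. ray G (x, z) \<notin> A"
        using 0 by (subst (asm) nn_integral_0_iff_AE) (auto elim!: eventually_mono simp: indicator_def ray_z)
      then have "AE z in \<kappa>. ray G (x, z) \<notin> A" by (simp add: AE_\<kappa>'_iff)
      \<comment> \<open>For fixed x the factor g x merely rescales z, and null sets of \<kappa> are
        preserved by scaling.\<close>
      then have "AE z in \<kappa>. ray G (x, of_real (inverse (g x)) * z) \<notin> A"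
        using g K_simps(5)[of "inverse (g x)"] by (intro AE_\<kappa>_scale[where P = "\<lambda>z. ray G (x, z) \<notin> A"]) auto
      moreover have "ray G (x, of_real (inverse (g x)) * z) = ray F (x, z)" for z
        using g by (auto simp: ray_def G_def fun_eq_iff)
      ultimately have "AE z in \<kappa>. indicator A (ray F (x, z)) = (0 :: ennreal)"
        by (simp add: indicator_def)
      then have "(\<integral>\<^sup>+z. indicator A (ray F (x, z)) \<partial>\<kappa>) = (\<integral>\<^sup>+z. 0 \<partial>\<kappa>)"
        by (rule nn_integral_cong_AE)
      then show "(\<integral>\<^sup>+z. indicator A (ray F (x, z)) \<partial>\<kappa>) = 0" by simp
    qed
    then have "(\<integral>\<^sup>+x. \<integral>\<^sup>+z. indicator A (ray F (x, z)) \<partial>\<kappa> \<partial>E) = (\<integral>\<^sup>+x. 0 \<partial>E)"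
      by (rule nn_integral_cong_AE)
    then have "(\<integral>\<^sup>+p. indicator A (ray F p) \<partial>(E \<Otimes>\<^sub>M \<kappa>)) = 0"
      by (subst \<kappa>.nn_integral_fst[symmetric]) auto
    then show "AE p in E \<Otimes>\<^sub>M \<kappa>. ray F p \<notin> A"
      by (subst (asm) nn_integral_0_iff_AE) (auto elim!: eventually_mono simp: indicator_def)
  qed
qed

end

section \<open>Uniqueness of the exponent\<close>

lemma AE_pair_snd:
  assumes "sigma_finite_measure N" "AE x in N. P x"
  shows "AE p in M \<Otimes>\<^sub>M N. P (snd p)"
proof -
  interpret N: sigma_finite_measure N by fact
  obtain A where A: "{x \<in> space N. \<not> P x} \<subseteq> A" "emeasure N A = 0" "A \<in> sets N"
    using assms(2) by (auto elim: AE_E)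
  show ?thesis
  proof (rule AE_I)
    show "{p \<in> space (M \<Otimes>\<^sub>M N). \<not> P (snd p)} \<subseteq> space M \<times> A"
      using A(1) by (auto simp: space_pair_measure)
    show "emeasure (M \<Otimes>\<^sub>M N) (space M \<times> A) = 0"
      using A by (simp add: N.emeasure_pair_measure_Times)
    show "space M \<times> A \<in> sets (M \<Otimes>\<^sub>M N)" using A by simp
  qed
qed

text \<open>On N \<inter> N' both \<open>M2\<close> and \<open>M4\<close> vanish, so
  \<open>M1\<close> and \<open>M3\<close> agree there. On N - N' the right side M3 + M4 vanishes and
  forces \<open>M1\<close> to vanish, and on N' - N the left side does the same for
  \<open>M3\<close>; hence both are carried by N \<inter> N'.\<close>

lemma measure_space_eq_of_singular:
  assumes s: "sets M2 = sets M1" "sets M3 = sets M1" "sets M4 = sets M1"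
    and add: "\<And>A. A \<in> sets M1 \<Longrightarrow> emeasure M1 A + emeasure M2 A = emeasure M3 A + emeasure M4 A"
    and N: "N \<in> sets M1" "emeasure M4 N = 0" "emeasure M1 (space M1 - N) = 0"
    and N': "N' \<in> sets M1" "emeasure M2 N' = 0" "emeasure M3 (space M1 - N') = 0"
  shows "emeasure M1 (space M1) = emeasure M3 (space M1)"
proof -
  have sub: "emeasure M A = 0" if "A \<subseteq> B" "B \<in> sets M1" "sets M = sets M1" "emeasure M B = 0" for M A B
    using emeasure_mono[of A B M] that by simp
  have part: "emeasure M (space M1) = emeasure M (N \<inter> N')"
    if "sets M = sets M1" "emeasure M (space M1 - N \<inter> N') = 0" for M
  proof -
    have "emeasure M (space M1) = emeasure M (N \<inter> N') + emeasure M (space M1 - N \<inter> N')"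
      using N N' that sets.sets_into_space[OF N(1)] by (subst plus_emeasure) (auto intro!: arg_cong[where f = "emeasure M"])
    then show ?thesis using that by simp
  qed
  have un: "emeasure M (space M1 - N \<inter> N') = 0"
    if "sets M = sets M1" "A \<in> sets M1" "B \<in> sets M1" "space M1 - N \<inter> N' \<subseteq> A \<union> B" "emeasure M A = 0" "emeasure M B = 0" for M A B
    using emeasure_subadditive[of A M B] that by (intro sub[OF that(4)]) auto
  have "emeasure M3 (N - N') = 0" "emeasure M4 (N - N') = 0"
    using N N' s sets.sets_into_space[OF N(1)] by (auto intro: sub[of _ "space M1 - N'"] sub[of _ N])
  then have "emeasure M1 (N - N') = 0" using add[of "N - N'"] N N' by simp
  then have 1: "emeasure M1 (space M1) = emeasure M1 (N \<inter> N')"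
    using N N' by (intro part un[where A = "space M1 - N" and B = "N - N'"]) auto
  have "emeasure M1 (N' - N) = 0" "emeasure M2 (N' - N) = 0"
    using N N' s sets.sets_into_space[OF N'(1)] by (auto intro: sub[of _ "space M1 - N"] sub[of _ N'])
  then have "emeasure M3 (N' - N) = 0" using add[of "N' - N"] N N' by simp
  then have 3: "emeasure M3 (space M1) = emeasure M3 (N \<inter> N')"
    using N N' s by (intro part un[where A = "space M1 - N'" and B = "N' - N"]) auto
  have "emeasure M2 (N \<inter> N') = 0" "emeasure M4 (N \<inter> N') = 0"
    using N N' s by (auto intro: sub[of _ N] sub[of _ N'])
  then show ?thesis using add[of "N \<inter> N'"] N N' 1 3 by simp
qed

context stable_index
begin

text \<open>Uniqueness on a complex product tests all complex coefficients, whereas exponents are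
  controlled for coefficients in \<open>K\<close> only. On real paths the imaginary part of a
  coefficient does not contribute to the form and may be dropped.\<close>

definition restrict_coeff :: "('i \<Rightarrow> complex) \<Rightarrow> 'i \<Rightarrow> complex" where
  "restrict_coeff \<theta> = (if K = \<real> then (\<lambda>t. of_real (Re (\<theta> t))) else \<theta>)"

lemma restrict_coeff_K: "\<forall>t\<in>J. restrict_coeff \<theta> t \<in> K"
  using K by (auto simp: restrict_coeff_def)

lemma lin_form_restrict_coeff:
  assumes "\<forall>t\<in>J. w t \<in> K"
  shows "lin_form \<theta> J w = lin_form (restrict_coeff \<theta>) J w"
proof (cases "K = \<real>")
  case True
  then have "Im (w t) = 0" if "t \<in> J" for t
    using assms that by (auto simp: complex_is_Real_iff)
  moreover have "restrict_coeff \<theta> = (\<lambda>t. of_real (Re (\<theta> t)))" unfolding restrict_coeff_def using True by auto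
  ultimately show ?thesis by (simp add: lin_form_def)
qed (simp add: restrict_coeff_def)

end

section \<open>Weighted path measures and their characteristic functions\<close>

context stable_path
begin

definition null_kernel :: "'e measure \<Rightarrow> (real \<Rightarrow> 'e \<Rightarrow> complex) \<Rightarrow> bool" where
  "null_kernel E F \<longleftrightarrow> (\<exists>\<phi> c B (n :: nat \<Rightarrow> nat). nonsingular_kernel E F \<phi> c \<and> B \<in> sets E \<and>
    disjoint_family (\<lambda>k. (\<phi> ^^ n k) -` B \<inter> space E) \<and> (AE x in E. \<exists>k. (\<phi> ^^ n k) x \<in> B))"

definition positive_kernel :: "'e measure \<Rightarrow> (real \<Rightarrow> 'e \<Rightarrow> complex) \<Rightarrow> bool" where
  "positive_kernel E F \<longleftrightarrow> (\<exists>\<phi> c \<psi> \<mu>. nonsingular_kernel E F \<phi> c \<and>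
    \<psi> \<in> measurable E E \<and> (\<forall>x\<in>space E. \<phi> (\<psi> x) = x \<and> \<psi> (\<phi> x) = x) \<and>
    finite_measure \<mu> \<and> equivalent_measures \<mu> E \<and> distr \<mu> \<mu> \<phi> = \<mu>)"

lemma null_kernelD: "null_kernel E F \<Longrightarrow> kernel E F"
  by (auto simp: null_kernel_def nonsingular_kernel_def)

lemma positive_kernelD: "positive_kernel E F \<Longrightarrow> kernel E F"
  by (auto simp: positive_kernel_def nonsingular_kernel_def)

definition exponent :: "'e measure \<Rightarrow> (real \<Rightarrow> 'e \<Rightarrow> complex) \<Rightarrow> (real \<Rightarrow> complex) \<Rightarrow> real set \<Rightarrow> real" where
  "exponent E F \<theta> J = (LINT x|E. norm (\<Sum>t\<in>J. \<theta> t * F t x) powr \<alpha>)"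

text \<open>The image of \<open>E \<Otimes> \<kappa>\<close> under \<open>ray F\<close> is the Levy measure of the process on path space; the
  weight \<open>1 - cos\<close> makes it finite, with total mass proportional to the exponent.\<close>

definition tilted :: "'e measure \<Rightarrow> (real \<Rightarrow> 'e \<Rightarrow> complex) \<Rightarrow> (real \<Rightarrow> complex) \<Rightarrow> real set \<Rightarrow> (real \<Rightarrow> complex) measure" where
  "tilted E F \<theta> J =
    distr (density (E \<Otimes>\<^sub>M \<kappa>) (\<lambda>p. ennreal (1 - cos (lin_form \<theta> J (ray F p))))) W (ray F)"

lemma lin_form_W: "J \<subseteq> I \<Longrightarrow> lin_form \<theta> J \<in> borel_measurable W"
  unfolding W_def by (rule lin_form_measurable)

context
  fixes \<theta> :: "real \<Rightarrow> complex" and J :: "real set"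
  assumes J: "finite J" "J \<subseteq> I" and \<theta>: "\<forall>t\<in>J. \<theta> t \<in> K"
begin

declare lin_form_W[OF J(2), measurable]

lemma sets_tilted: "sets (tilted E F \<theta> J) = sets W"
  by (simp add: tilted_def)

lemma space_tilted: "space (tilted E F \<theta> J) = space W"
  by (simp add: tilted_def)

lemma emeasure_tilted:
  assumes F: "kernel E F" and [measurable]: "A \<in> sets W"
  shows "emeasure (tilted E F \<theta> J) A =
    (\<integral>\<^sup>+p. ennreal (1 - cos (lin_form \<theta> J (ray F p))) * indicator A (ray F p) \<partial>(E \<Otimes>\<^sub>M \<kappa>))"
proof -
  note [measurable] = ray_measurable[OF kernel_measurable[OF F] sets_\<kappa>]
  have "emeasure (tilted E F \<theta> J) A = (\<integral>\<^sup>+w. indicator A w \<partial>tilted E F \<theta> J)"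
    by (rule nn_integral_indicator[symmetric]) (simp add: sets_tilted)
  also have "\<dots> = (\<integral>\<^sup>+p. ennreal (1 - cos (lin_form \<theta> J (ray F p))) * indicator A (ray F p) \<partial>(E \<Otimes>\<^sub>M \<kappa>))"
    unfolding tilted_def by (subst nn_integral_distr) (simp_all add: nn_integral_density)
  finally show ?thesis .
qed

lemma emeasure_tilted_space:
  assumes F: "kernel E F"
  shows "emeasure (tilted E F \<theta> J) (space W) = ennreal (exponent E F \<theta> J) * C\<^sub>\<alpha>"
proof -
  note [measurable] = ray_measurable[OF kernel_measurable[OF F] sets_\<kappa>]
  have "ray F p \<in> space W" for p
    by (auto simp: ray_def W_def space_PiM split: prod.split)
  then show ?thesis
    using nn_integral_ray_cos[OF F J \<theta>] by (simp add: emeasure_tilted[OF F] exponent_def)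
qed

lemma finite_measure_tilted: "kernel E F \<Longrightarrow> finite_measure (tilted E F \<theta> J)"
  using C\<^sub>\<alpha>_finite by (intro finite_measureI) (auto simp: space_tilted emeasure_tilted_space ennreal_mult_eq_top_iff)

lemma integral_tilted:
  fixes f :: "(real \<Rightarrow> complex) \<Rightarrow> real"
  assumes F: "kernel E F" and [measurable]: "f \<in> borel_measurable W"
  shows "(LINT w|tilted E F \<theta> J. f w) = (LINT p|(E \<Otimes>\<^sub>M \<kappa>). (1 - cos (lin_form \<theta> J (ray F p))) * f (ray F p))"
proof -
  note [measurable] = ray_measurable[OF kernel_measurable[OF F] sets_\<kappa>]
  show ?thesis unfolding tilted_def by (simp add: integral_distr integral_density)
qed

text \<open>The finite invariant measure that dominates the paths of the positive kernel is the one
  against which the null kernel is separated. The separation is only claimed where 1 - cos is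
  positive, and the tilted measure ignores the rest.\<close>

lemma tilted_singular:
  assumes P: "positive_kernel E F" and Nu: "null_kernel E' F'"
  obtains N where "N \<in> sets W" "emeasure (tilted E' F' \<theta> J) N = 0" "emeasure (tilted E F \<theta> J) (space W - N) = 0"
proof -
  from P obtain \<phi> c \<psi> \<mu> where P': "nonsingular_kernel E F \<phi> c" "\<psi> \<in> measurable E E"
    "\<And>x. x \<in> space E \<Longrightarrow> \<phi> (\<psi> x) = x" "\<And>x. x \<in> space E \<Longrightarrow> \<psi> (\<phi> x) = x"
    "finite_measure \<mu>" "equivalent_measures \<mu> E" "distr \<mu> \<mu> \<phi> = \<mu>"
    unfolding positive_kernel_def by blast
  obtain L where L: "finite_measure L" "sets L = sets W" "distr L W S = L"
    and dom: "\<And>A. A \<in> sets W \<Longrightarrow> emeasure L A = 0 \<Longrightarrow> AE p in E \<Otimes>\<^sub>M \<kappa>. ray F p \<notin> A"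
    using positive_kernel_dominated[OF P'] by blast
  from Nu obtain \<phi>' c' B n where N': "nonsingular_kernel E' F' \<phi>' c'" "B \<in> sets E'"
    "disjoint_family (\<lambda>k :: nat. (\<phi>' ^^ n k) -` B \<inter> space E')" "AE x in E'. \<exists>k. (\<phi>' ^^ n k) x \<in> B"
    unfolding null_kernel_def by blast
  obtain N where N[measurable]: "N \<in> sets W"
    and 0: "(\<integral>\<^sup>+p. ennreal (1 - cos (lin_form \<theta> J (ray F' p))) * indicator N (ray F' p) \<partial>(E' \<Otimes>\<^sub>M \<kappa>)) = 0"
    and L0: "emeasure L {w \<in> space W - N. ennreal (1 - cos (lin_form \<theta> J w)) > 0} = 0"
    using null_kernel_singular[OF N' J \<theta> L] by blast
  have "AE p in E \<Otimes>\<^sub>M \<kappa>. ray F p \<notin> {w \<in> space W - N. ennreal (1 - cos (lin_form \<theta> J w)) > 0}"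
    by (rule dom[OF _ L0]) measurable
  then have "AE p in E \<Otimes>\<^sub>M \<kappa>. ennreal (1 - cos (lin_form \<theta> J (ray F p))) * indicator (space W - N) (ray F p) = 0"
    by eventually_elim (auto simp: indicator_def zero_less_iff_neq_zero)
  then have "(\<integral>\<^sup>+p. ennreal (1 - cos (lin_form \<theta> J (ray F p))) * indicator (space W - N) (ray F p) \<partial>(E \<Otimes>\<^sub>M \<kappa>)) =
    (\<integral>\<^sup>+p. 0 \<partial>(E \<Otimes>\<^sub>M \<kappa>))"
    by (rule nn_integral_cong_AE)
  then have "emeasure (tilted E F \<theta> J) (space W - N) = 0"
    by (simp add: emeasure_tilted[OF positive_kernelD[OF P]])
  moreover have "emeasure (tilted E' F' \<theta> J) N = 0"
    using 0 by (simp add: emeasure_tilted[OF null_kernelD[OF Nu]])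
  ultimately show ?thesis using that N by blast
qed

end

lemma integrable_ray_cos:
  assumes F: "kernel E F" and J: "finite J" "J \<subseteq> I" and \<theta>: "\<forall>t\<in>J. \<theta> t \<in> K"
  shows "integrable (E \<Otimes>\<^sub>M \<kappa>) (\<lambda>p. 1 - cos (lin_form \<theta> J (ray F p)))"
    and "(LINT p|(E \<Otimes>\<^sub>M \<kappa>). 1 - cos (lin_form \<theta> J (ray F p))) = exponent E F \<theta> J * enn2real C\<^sub>\<alpha>"
proof -
  note [measurable] = ray_measurable[OF kernel_measurable[OF F] sets_\<kappa>] lin_form_W[OF J(2)]
  have nn: "(\<integral>\<^sup>+p. ennreal (1 - cos (lin_form \<theta> J (ray F p))) \<partial>(E \<Otimes>\<^sub>M \<kappa>)) = ennreal (exponent E F \<theta> J) * C\<^sub>\<alpha>"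
    unfolding exponent_def by (rule nn_integral_ray_cos[OF F J \<theta>])
  then show i: "integrable (E \<Otimes>\<^sub>M \<kappa>) (\<lambda>p. 1 - cos (lin_form \<theta> J (ray F p)))"
    using C\<^sub>\<alpha>_finite by (intro integrableI_nonneg) (auto simp: ennreal_mult_less_top)
  have "exponent E F \<theta> J \<ge> 0" unfolding exponent_def by simp
  then show "(LINT p|(E \<Otimes>\<^sub>M \<kappa>). 1 - cos (lin_form \<theta> J (ray F p))) = exponent E F \<theta> J * enn2real C\<^sub>\<alpha>"
    using nn by (subst integral_eq_nn_integral) (auto simp: enn2real_mult)
qed

lemma AE_ray_K:
  assumes F: "kernel E F"
  shows "AE p in E \<Otimes>\<^sub>M \<kappa>. \<forall>t\<in>I. ray F p t \<in> K"
proof -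
  interpret E: sigma_finite_measure E using F by (simp add: kernel_def)
  have "AE p in E \<Otimes>\<^sub>M \<kappa>. snd p \<noteq> 0 \<and> snd p \<in> K"
    by (rule AE_pair_snd[OF \<kappa>.sigma_finite_measure_axioms AE_\<kappa>])
  with AE_space show ?thesis
    by eventually_elim (use F in \<open>auto simp: ray_def space_pair_measure kernel_def L_alpha_def\<close>)
qed

text \<open>\<open>\<eta> 1\<close> and \<open>\<eta> (-1)\<close> are the coefficients of the test
  form plus and minus the weighting form. The integrand is split into terms 1 - cos rather than bare
  cosines because the product measure may be infinite, where only the former are integrable.\<close>

lemma integral_tilted_cos:
  fixes \<theta>' :: "real \<Rightarrow> complex"
  assumes F: "kernel E F" and J: "finite J" "J \<subseteq> I" and \<theta>: "\<forall>t\<in>J. \<theta> t \<in> K"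
    and J': "finite J'" "J' \<subseteq> I"
  defines "\<eta> \<equiv> (\<lambda>s t. (if t \<in> J' then restrict_coeff \<theta>' t else 0) + (if t \<in> J then of_real s * \<theta> t else 0))"
  shows "(LINT w|tilted E F \<theta> J. cos (lin_form \<theta>' J' w)) =
    enn2real C\<^sub>\<alpha> * ((exponent E F (\<eta> 1) (J' \<union> J) + exponent E F (\<eta> (-1)) (J' \<union> J)) / 2 - exponent E F (restrict_coeff \<theta>') J')"
proof -
  note [measurable] = ray_measurable[OF kernel_measurable[OF F] sets_\<kappa>] lin_form_W[OF J(2)] lin_form_W[OF J'(2)]
  have \<eta>K: "\<forall>t\<in>J' \<union> J. \<eta> s t \<in> K" for s
    using \<theta> restrict_coeff_K[of J' \<theta>'] by (auto simp: \<eta>_def)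
  have JJ: "finite (J' \<union> J)" "J' \<union> J \<subseteq> I" using J J' by auto
  note [measurable] = lin_form_W[OF JJ(2)]
  have \<eta>: "lin_form (\<eta> s) (J' \<union> J) w = lin_form (restrict_coeff \<theta>') J' w + s * lin_form \<theta> J w" for s w
    unfolding lin_form_scale lin_form_add[OF J'(1) J(1)] \<eta>_def by simp
  note i = integrable_ray_cos[OF F JJ \<eta>K] integrable_ray_cos[where \<theta> = "restrict_coeff \<theta>'", OF F J' restrict_coeff_K]
  have "(LINT w|tilted E F \<theta> J. cos (lin_form \<theta>' J' w)) =
    (LINT p|(E \<Otimes>\<^sub>M \<kappa>). (1 - cos (lin_form \<theta> J (ray F p))) * cos (lin_form \<theta>' J' (ray F p)))"
    by (rule integral_tilted[OF J \<theta> F]) auto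
  also have "\<dots> = (LINT p|(E \<Otimes>\<^sub>M \<kappa>). ((1 - cos (lin_form (\<eta> 1) (J' \<union> J) (ray F p))) + (1 - cos (lin_form (\<eta> (-1)) (J' \<union> J) (ray F p)))) / 2
      - (1 - cos (lin_form (restrict_coeff \<theta>') J' (ray F p))))"
  proof (rule integral_cong_AE)
    show "AE p in E \<Otimes>\<^sub>M \<kappa>. (1 - cos (lin_form \<theta> J (ray F p))) * cos (lin_form \<theta>' J' (ray F p)) =
      ((1 - cos (lin_form (\<eta> 1) (J' \<union> J) (ray F p))) + (1 - cos (lin_form (\<eta> (-1)) (J' \<union> J) (ray F p)))) / 2
      - (1 - cos (lin_form (restrict_coeff \<theta>') J' (ray F p)))"
      using AE_ray_K[OF F]
    proof eventually_elim
      fix p assume "\<forall>t\<in>I. ray F p t \<in> K"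
      then have "lin_form \<theta>' J' (ray F p) = lin_form (restrict_coeff \<theta>') J' (ray F p)"
        using J'(2) by (intro lin_form_restrict_coeff) auto
      then show "(1 - cos (lin_form \<theta> J (ray F p))) * cos (lin_form \<theta>' J' (ray F p)) =
        ((1 - cos (lin_form (\<eta> 1) (J' \<union> J) (ray F p))) + (1 - cos (lin_form (\<eta> (-1)) (J' \<union> J) (ray F p)))) / 2
        - (1 - cos (lin_form (restrict_coeff \<theta>') J' (ray F p)))"
        unfolding \<eta> by (simp add: cos_add cos_diff field_simps)
    qed
  qed measurable
  also have "\<dots> = enn2real C\<^sub>\<alpha> * ((exponent E F (\<eta> 1) (J' \<union> J) + exponent E F (\<eta> (-1)) (J' \<union> J)) / 2 - exponent E F (restrict_coeff \<theta>') J')"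
  proof -
    have "(LINT p|(E \<Otimes>\<^sub>M \<kappa>). (u p + v p) / 2 - r p) =
      ((LINT p|(E \<Otimes>\<^sub>M \<kappa>). u p) + (LINT p|(E \<Otimes>\<^sub>M \<kappa>). v p)) / 2 - (LINT p|(E \<Otimes>\<^sub>M \<kappa>). r p)"
      if "integrable (E \<Otimes>\<^sub>M \<kappa>) u" "integrable (E \<Otimes>\<^sub>M \<kappa>) v" "integrable (E \<Otimes>\<^sub>M \<kappa>) r"
      for u v r :: "'a \<times> complex \<Rightarrow> real"
      using that by simp
    from this[OF i(1,1,3)] show ?thesis unfolding i(2,4) by (simp add: field_simps)
  qed
  finally show ?thesis .
qed

text \<open>The reflection of z to -z preserves \<kappa> and changes the sign of every form; the
  weight is even and the sine odd.\<close>

lemma integral_tilted_sin: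
  assumes F: "kernel E F" and J: "finite J" "J \<subseteq> I" and \<theta>: "\<forall>t\<in>J. \<theta> t \<in> K"
    and J': "finite J'" "J' \<subseteq> I"
  shows "(LINT w|tilted E F \<theta> J. sin (lin_form \<theta>' J' w)) = 0"
proof -
  interpret E: sigma_finite_measure E using F by (simp add: kernel_def)
  note [measurable] = ray_measurable[OF kernel_measurable[OF F] sets_\<kappa>] lin_form_W[OF J(2)] lin_form_W[OF J'(2)]
  define \<sigma> :: "'a \<times> complex \<Rightarrow> 'a \<times> complex" where "\<sigma> = (\<lambda>(x, z). (x, - z))"
  have \<sigma>[measurable]: "\<sigma> \<in> measurable (E \<Otimes>\<^sub>M \<kappa>) (E \<Otimes>\<^sub>M \<kappa>)" unfolding \<sigma>_def by measurable
  have inv: "distr (E \<Otimes>\<^sub>M \<kappa>) (E \<Otimes>\<^sub>M \<kappa>) \<sigma> = E \<Otimes>\<^sub>M \<kappa>"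
  proof (rule measure_eqI)
    fix A assume A0: "A \<in> sets (distr (E \<Otimes>\<^sub>M \<kappa>) (E \<Otimes>\<^sub>M \<kappa>) \<sigma>)"
    then have A[measurable]: "A \<in> sets (E \<Otimes>\<^sub>M \<kappa>)" by simp
    have "emeasure (distr (E \<Otimes>\<^sub>M \<kappa>) (E \<Otimes>\<^sub>M \<kappa>) \<sigma>) A = (\<integral>\<^sup>+p. indicator A p \<partial>distr (E \<Otimes>\<^sub>M \<kappa>) (E \<Otimes>\<^sub>M \<kappa>) \<sigma>)"
      by (rule nn_integral_indicator[OF A0, symmetric])
    also have "\<dots> = (\<integral>\<^sup>+p. indicator A (\<sigma> p) \<partial>(E \<Otimes>\<^sub>M \<kappa>))" by (rule nn_integral_distr) measurable
    also have "\<dots> = (\<integral>\<^sup>+x. \<integral>\<^sup>+z. indicator A (x, - 1 * z) \<partial>\<kappa> \<partial>E)"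
      by (subst \<kappa>.nn_integral_fst[symmetric]) (simp_all add: \<sigma>_def)
    also have "\<dots> = (\<integral>\<^sup>+x. \<integral>\<^sup>+z. indicator A (x, z) \<partial>\<kappa> \<partial>E)"
      by (rule nn_integral_cong, subst nn_integral_\<kappa>_scale) auto
    also have "\<dots> = emeasure (E \<Otimes>\<^sub>M \<kappa>) A" by (subst \<kappa>.nn_integral_fst) (simp_all add: nn_integral_indicator[OF A])
    finally show "emeasure (distr (E \<Otimes>\<^sub>M \<kappa>) (E \<Otimes>\<^sub>M \<kappa>) \<sigma>) A = emeasure (E \<Otimes>\<^sub>M \<kappa>) A" .
  qed simp
  let ?f = "\<lambda>p. (1 - cos (lin_form \<theta> J (ray F p))) * sin (lin_form \<theta>' J' (ray F p))"
  have neg: "lin_form \<theta> J (ray F (\<sigma> p)) = - lin_form \<theta> J (ray F p)" if "J \<subseteq> I" for \<theta> J p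
    by (cases p) (simp add: \<sigma>_def lin_form_ray[OF that])
  have "(LINT p|(E \<Otimes>\<^sub>M \<kappa>). ?f p) = (LINT p|(distr (E \<Otimes>\<^sub>M \<kappa>) (E \<Otimes>\<^sub>M \<kappa>) \<sigma>). ?f p)" by (simp only: inv)
  also have "\<dots> = (LINT p|(E \<Otimes>\<^sub>M \<kappa>). ?f (\<sigma> p))" by (rule integral_distr) measurable
  also have "\<dots> = - (LINT p|(E \<Otimes>\<^sub>M \<kappa>). ?f p)" using J J' by (simp add: neg)
  finally have "(LINT p|(E \<Otimes>\<^sub>M \<kappa>). ?f p) = 0" by simp
  then show ?thesis by (subst integral_tilted[OF J \<theta> F]) auto
qed

text \<open>Exponents enter the characteristic functions of the tilted measures linearly, so the
  assumed identity makes the sums of these measures equal. Mutual singularity then equates the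
  masses of the two positive summands.\<close>

theorem exponent_eq:
  assumes P1: "positive_kernel E1 F1" and N2: "null_kernel E2 F2" and P3: "positive_kernel E3 F3" and N4: "null_kernel E4 F4"
    and eq: "\<And>J \<theta>. finite J \<Longrightarrow> J \<subseteq> I \<Longrightarrow> \<forall>t\<in>J. \<theta> t \<in> K \<Longrightarrow>
      exponent E1 F1 \<theta> J + exponent E2 F2 \<theta> J = exponent E3 F3 \<theta> J + exponent E4 F4 \<theta> J"
    and J: "finite J" "J \<subseteq> I" and \<theta>: "\<forall>t\<in>J. \<theta> t \<in> K"
  shows "exponent E1 F1 \<theta> J = exponent E3 F3 \<theta> J"
proof -
  let ?M1 = "tilted E1 F1 \<theta> J" and ?M2 = "tilted E2 F2 \<theta> J" and ?M3 = "tilted E3 F3 \<theta> J" and ?M4 = "tilted E4 F4 \<theta> J"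
  note k = positive_kernelD[OF P1] null_kernelD[OF N2] positive_kernelD[OF P3] null_kernelD[OF N4]
  note st = sets_tilted[OF J \<theta>]
  have s: "sets ?M2 = sets ?M1" "sets ?M3 = sets ?M1" "sets ?M4 = sets ?M1" "sets ?M4 = sets ?M3"
    by (simp_all add: st)
  note fin = k[THEN finite_measure_tilted[OF J \<theta>]]
  have add: "measure_add ?M1 ?M2 = measure_add ?M3 ?M4"
  proof (rule PiM_complex_eqI)
    show "finite_measure (measure_add ?M1 ?M2)" "finite_measure (measure_add ?M3 ?M4)"
      using fin s by (auto intro: finite_measure_measure_add)
    show "sets (measure_add ?M1 ?M2) = sets (PiM I (\<lambda>_. borel))" "sets (measure_add ?M3 ?M4) = sets (PiM I (\<lambda>_. borel))"
      using s by (simp_all add: sets_measure_add st W_def)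
    fix J' \<theta>' assume J': "finite J'" "J' \<subseteq> (I :: real set)"
    have [measurable]: "lin_form \<theta>' J' \<in> borel_measurable W" by (rule lin_form_W[OF J'(2)])
    have m: "(\<lambda>w. cos (lin_form \<theta>' J' w)) \<in> borel_measurable M" "(\<lambda>w. sin (lin_form \<theta>' J' w)) \<in> borel_measurable M"
      if "sets M = sets W" for M
      using that by (simp_all cong: measurable_cong_sets)
    let ?\<eta> = "\<lambda>s t. (if t \<in> J' then restrict_coeff \<theta>' t else 0) + (if t \<in> J then of_real s * \<theta> t else 0)"
    have JJ: "finite (J' \<union> J)" "J' \<union> J \<subseteq> I" using J J' by auto
    have \<eta>K: "\<forall>t\<in>J' \<union> J. ?\<eta> s t \<in> K" for s
      using \<theta> restrict_coeff_K[of J' \<theta>'] by auto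
    show "(LINT w|measure_add ?M1 ?M2. cos (lin_form \<theta>' J' w)) = (LINT w|measure_add ?M3 ?M4. cos (lin_form \<theta>' J' w))"
      using eq[of "J' \<union> J" "?\<eta> 1", OF JJ \<eta>K] eq[of "J' \<union> J" "?\<eta> (-1)", OF JJ \<eta>K]
        eq[of J' "restrict_coeff \<theta>'", OF J' restrict_coeff_K]
      by (simp add: integral_measure_add_bounded s fin m st integral_tilted_cos[OF _ J \<theta> J'] k distrib_left[symmetric])
         (simp add: field_simps)
    show "(LINT w|measure_add ?M1 ?M2. sin (lin_form \<theta>' J' w)) = (LINT w|measure_add ?M3 ?M4. sin (lin_form \<theta>' J' w))"
      by (simp add: integral_measure_add_bounded s fin m st integral_tilted_sin[OF _ J \<theta> J'] k)
  qed
  have sp: "space ?M1 = space W" by (simp add: space_tilted[OF J \<theta>])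
  obtain N where N: "N \<in> sets W" "emeasure ?M4 N = 0" "emeasure ?M1 (space W - N) = 0"
    using tilted_singular[OF J \<theta> P1 N4] by blast
  obtain N' where N': "N' \<in> sets W" "emeasure ?M2 N' = 0" "emeasure ?M3 (space W - N') = 0"
    using tilted_singular[OF J \<theta> P3 N2] by blast
  have "emeasure ?M1 (space ?M1) = emeasure ?M3 (space ?M1)"
  proof (rule measure_space_eq_of_singular[OF s(1-3)])
    fix A assume A: "A \<in> sets ?M1"
    then show "emeasure ?M1 A + emeasure ?M2 A = emeasure ?M3 A + emeasure ?M4 A"
      using arg_cong[OF add, of "\<lambda>M. emeasure M A"] s by (simp add: emeasure_measure_add)
  qed (use N N' in \<open>simp_all add: sp st\<close>)
  then have "ennreal (exponent E1 F1 \<theta> J) * C\<^sub>\<alpha> = ennreal (exponent E3 F3 \<theta> J) * C\<^sub>\<alpha>"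
    using k by (simp add: sp emeasure_tilted_space[OF J \<theta>])
  \<comment> \<open>Cancellation in the extended reals needs the common factor to be neither 0 nor
    infinite.\<close>
  then have "ennreal (exponent E1 F1 \<theta> J) = ennreal (exponent E3 F3 \<theta> J)"
    using C\<^sub>\<alpha>_finite C\<^sub>\<alpha>_nonzero by (auto simp: mult.commute[of _ C\<^sub>\<alpha>] ennreal_mult_cancel_left)
  moreover have "exponent E1 F1 \<theta> J \<ge> 0" "exponent E3 F3 \<theta> J \<ge> 0" by (simp_all add: exponent_def)
  ultimately show ?thesis by simp
qed

end

section \<open>Flow kernels\<close>

lemma measurable_flow:
  assumes "nonsingular_flow T M \<phi>" "t \<in> T"
  shows "\<phi> t \<in> measurable M M"
proof -
  have "(\<lambda>x. (\<lambda>(t, x). \<phi> t x) (t, x)) \<in> measurable M M"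
    using assms by (intro measurable_compose[OF measurable_Pair1']) (auto simp: nonsingular_flow_def space_restrict_space)
  then show ?thesis by simp
qed

lemma measurable_cocycle:
  assumes "cocycle T K M \<phi> a" "t \<in> T"
  shows "a t \<in> borel_measurable M"
proof -
  have "(\<lambda>x. (\<lambda>(t, x). a t x) (t, x)) \<in> borel_measurable M"
    using assms by (intro measurable_compose[OF measurable_Pair1']) (auto simp: cocycle_def space_restrict_space)
  then show ?thesis by simp
qed

section \<open>Jacobians of a flow\<close>

locale flow_on = sigma_finite_measure M
  for T :: "real set" and M :: "'e measure" and \<phi> :: "real \<Rightarrow> 'e \<Rightarrow> 'e" +
  assumes T: "T = \<int> \<or> T = UNIV" and flow: "nonsingular_flow T M \<phi>"
begin

lemma T_simps [simp, intro]: "0 \<in> T" "1 \<in> T" "s \<in> T \<Longrightarrow> t \<in> T \<Longrightarrow> s + t \<in> T" "t \<in> T \<Longrightarrow> - t \<in> T"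
  using T by auto

lemma flow_measurable: "t \<in> T \<Longrightarrow> \<phi> t \<in> measurable M M"
  by (rule measurable_flow[OF flow])

lemma flow_add: "s \<in> T \<Longrightarrow> t \<in> T \<Longrightarrow> x \<in> space M \<Longrightarrow> \<phi> t (\<phi> s x) = \<phi> (t + s) x"
  using flow by (simp add: nonsingular_flow_def)

lemma flow_inverse: "t \<in> T \<Longrightarrow> x \<in> space M \<Longrightarrow> \<phi> t (\<phi> (- t) x) = x" "t \<in> T \<Longrightarrow> x \<in> space M \<Longrightarrow> \<phi> (- t) (\<phi> t x) = x"
  using flow by (auto simp: nonsingular_flow_def flow_add)

definition jacobian :: "real \<Rightarrow> 'e \<Rightarrow> ennreal" where
  "jacobian t = RN_deriv M (distr M M (\<phi> (- t)))"

lemma jacobian_measurable [measurable]: "jacobian t \<in> borel_measurable M"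
  by (simp add: jacobian_def)

lemma flow_equivalent: "t \<in> T \<Longrightarrow> equivalent_measures (distr M M (\<phi> t)) M"
  using flow by (simp add: nonsingular_flow_def)

lemma density_jacobian: "t \<in> T \<Longrightarrow> density M (jacobian t) = distr M M (\<phi> (- t))"
  unfolding jacobian_def using flow_equivalent[of "- t"]
  by (intro density_RN_deriv) (auto simp: equivalent_measures_def)

lemma nn_integral_jacobian:
  assumes t: "t \<in> T" and [measurable]: "h \<in> borel_measurable M"
  shows "(\<integral>\<^sup>+x. jacobian t x * h x \<partial>M) = (\<integral>\<^sup>+x. h (\<phi> (- t) x) \<partial>M)"
proof -
  have [measurable]: "\<phi> (- t) \<in> measurable M M" using t by (intro flow_measurable) simp
  have "(\<integral>\<^sup>+x. jacobian t x * h x \<partial>M) = (\<integral>\<^sup>+x. h x \<partial>density M (jacobian t))"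
    by (simp add: nn_integral_density)
  also have "\<dots> = (\<integral>\<^sup>+x. h (\<phi> (- t) x) \<partial>M)"
    unfolding density_jacobian[OF t] by (simp add: nn_integral_distr)
  finally show ?thesis .
qed

text \<open>A Radon-Nikodym derivative is finite almost everywhere once the image measure is
  sigma-finite; composing a positive integrable function with \<phi> t gives one that is positive
  and integrable for that image.\<close>

lemma jacobian_finite: assumes t: "t \<in> T" shows "AE x in M. jacobian t x \<noteq> \<infinity>"
  unfolding jacobian_def
proof (rule RN_deriv_finite)
  have [measurable]: "\<phi> (- t) \<in> measurable M M" "\<phi> t \<in> measurable M M" using t by (auto intro: flow_measurable)
  obtain h where h[measurable]: "h \<in> borel_measurable M" and fin: "(\<integral>\<^sup>+x. h x \<partial>M) \<noteq> \<infinity>"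
    and pos: "\<And>x. x \<in> space M \<Longrightarrow> 0 < h x"
    using Ex_finite_integrable_function by blast
  show "sigma_finite_measure (distr M M (\<phi> (- t)))"
  proof (rule sigma_finite_measureI_nn_integral[where f = "\<lambda>_ :: unit. \<lambda>x. h (\<phi> t x)"])
    have "(\<integral>\<^sup>+x. h (\<phi> t x) \<partial>distr M M (\<phi> (- t))) = (\<integral>\<^sup>+x. h x \<partial>M)"
      by (subst nn_integral_distr) (auto intro!: nn_integral_cong simp: flow_inverse t)
    then show "(\<integral>\<^sup>+x. h (\<phi> t x) \<partial>distr M M (\<phi> (- t))) < \<infinity>"
      using fin by (simp add: less_top)
    show "AE x in distr M M (\<phi> (- t)). \<exists>_ :: unit. h (\<phi> t x) > 0"
      using pos flow_measurable[OF t, THEN measurable_space] by (intro AE_I2) auto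
  qed measurable
  show "absolutely_continuous M (distr M M (\<phi> (- t)))"
    using flow_equivalent[of "- t"] t by (simp add: equivalent_measures_def)
qed simp

lemma jacobian_nonzero: assumes t: "t \<in> T" shows "AE x in M. jacobian t x \<noteq> 0"
proof -
  have "AE x in density M (jacobian t). jacobian t x \<noteq> 0" by (subst AE_density) auto
  then have "AE x in distr M M (\<phi> (- t)). jacobian t x \<noteq> 0" unfolding density_jacobian[OF t] .
  moreover have "absolutely_continuous (distr M M (\<phi> (- t))) M"
    using flow_equivalent[of "- t"] t by (simp add: equivalent_measures_def)
  ultimately show ?thesis using absolutely_continuous_AE[of M "distr M M (\<phi> (- t))"] by simp
qed

text \<open>The chain rule: by the flow property both sides are densities of the same image measure
  under \<phi> (- (t + s)), and densities over a sigma-finite measure are unique.\<close>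

lemma jacobian_add:
  assumes t: "t \<in> T" "s \<in> T"
  shows "AE x in M. jacobian (t + s) x = jacobian s x * jacobian t (\<phi> s x)"
proof (rule density_unique)
  have [simp]: "t + s \<in> T" "- t \<in> T" "- s \<in> T" "- (t + s) \<in> T" "- t - s \<in> T"
    using t T_simps(4)[of "t + s"] by (auto simp del: T_simps(4))
  have ms: "\<phi> s \<in> measurable M M" "\<phi> (- s) \<in> measurable M M" "\<phi> (- t) \<in> measurable M M"
    using t by (auto intro: flow_measurable)
  note [measurable] = ms
  show "(\<lambda>x. jacobian s x * jacobian t (\<phi> s x)) \<in> borel_measurable M" by measurable
  show "density M (jacobian (t + s)) = density M (\<lambda>x. jacobian s x * jacobian t (\<phi> s x))"
  proof (rule measure_eqI)
    fix A assume "A \<in> sets (density M (jacobian (t + s)))"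
    then have [measurable]: "A \<in> sets M" by simp
    have "emeasure (density M (\<lambda>x. jacobian s x * jacobian t (\<phi> s x))) A =
      (\<integral>\<^sup>+x. jacobian s x * (jacobian t (\<phi> s x) * indicator A x) \<partial>M)"
      by (subst emeasure_density) (auto simp: mult.assoc)
    also have "\<dots> = (\<integral>\<^sup>+x. jacobian t (\<phi> s (\<phi> (- s) x)) * indicator A (\<phi> (- s) x) \<partial>M)"
      by (rule nn_integral_jacobian[OF t(2)]) measurable
    also have "\<dots> = (\<integral>\<^sup>+x. jacobian t x * indicator A (\<phi> (- s) x) \<partial>M)"
      by (intro nn_integral_cong) (simp add: flow_inverse t)
    also have "\<dots> = (\<integral>\<^sup>+x. indicator A (\<phi> (- s) (\<phi> (- t) x)) \<partial>M)"
      by (rule nn_integral_jacobian[OF t(1)]) measurable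
    also have "\<dots> = (\<integral>\<^sup>+x. indicator A (\<phi> (- s + - t) x) \<partial>M)"
      by (intro nn_integral_cong) (simp add: flow_add t)
    also have "- s + - t = - (t + s)" by simp
    finally have "emeasure (density M (\<lambda>x. jacobian s x * jacobian t (\<phi> s x))) A =
      (\<integral>\<^sup>+x. indicator A (\<phi> (- (t + s)) x) \<partial>M)" .
    also have "\<dots> = (\<integral>\<^sup>+x. jacobian (t + s) x * indicator A x \<partial>M)"
      by (rule nn_integral_jacobian[symmetric]) simp_all
    also have "\<dots> = emeasure (density M (jacobian (t + s))) A"
      by (subst emeasure_density) auto
    finally show "emeasure (density M (jacobian (t + s))) A =
      emeasure (density M (\<lambda>x. jacobian s x * jacobian t (\<phi> s x))) A" by simp
  qed simp
qed simp

end

text \<open>The time-one equation is the product of the cocycle relation and the chain rule for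
  Jacobians, each with first step 1. Since norm (a 1 x) = 1, the \<alpha>-th power of the modulus of
  the multiplier is the Jacobian itself.\<close>

lemma flow_kernel_nonsingular:
  assumes sp: "stable_path \<alpha> K I" and I: "I \<subseteq> T" and T: "T = \<int> \<or> T = UNIV"
    and rep: "flow_representation T K \<alpha> P X M \<phi> a f"
  shows "stable_path.nonsingular_kernel \<alpha> K I M (flow_kernel \<alpha> M \<phi> a f) (\<phi> 1)
    (\<lambda>x. a 1 x * of_real (enn2real (RN_deriv M (distr M M (\<phi> (- 1))) x) powr (1 / \<alpha>)))"
proof -
  interpret stable_path \<alpha> K I by fact
  have flow: "nonsingular_flow T M \<phi>" and coc: "cocycle T K M \<phi> a"
    and F: "sigma_finite_measure M" "\<And>t. t \<in> T \<Longrightarrow> flow_kernel \<alpha> M \<phi> a f t \<in> L_alpha K \<alpha> M"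
    using rep by (auto simp: flow_representation_def integral_representation_def)
  interpret M: sigma_finite_measure M by fact
  interpret flow_on T M \<phi> by unfold_locales fact+
  let ?F = "flow_kernel \<alpha> M \<phi> a f"
  define c where "c x = a 1 x * of_real (enn2real (jacobian 1 x) powr (1 / \<alpha>))" for x
  have F_eq: "?F t x = a t x * of_real (enn2real (jacobian t x) powr (1 / \<alpha>)) * f (\<phi> t x)" for t x
    by (simp add: flow_kernel_def jacobian_def)
  have a1: "a 1 \<in> borel_measurable M" by (rule measurable_cocycle[OF coc]) simp
  have \<phi>1: "\<phi> 1 \<in> measurable M M" by (rule flow_measurable) simp
  note [measurable] = a1 \<phi>1
  have aK: "a 1 x \<in> K" "norm (a 1 x) = 1" if "x \<in> space M" for x
    using coc that by (auto simp: cocycle_def)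
  have step: "AE x in M. ?F (t + 1) x = c x * ?F t (\<phi> 1 x)" if t: "t \<in> T" for t
  proof -
    have "AE x in M. a (t + 1) x = a 1 x * a t (\<phi> 1 x)" using coc t by (simp add: cocycle_def)
    with jacobian_add[OF t T_simps(2)] AE_space show ?thesis
    proof eventually_elim
      fix x assume "jacobian (t + 1) x = jacobian 1 x * jacobian t (\<phi> 1 x)" "x \<in> space M"
        "a (t + 1) x = a 1 x * a t (\<phi> 1 x)"
      then show "?F (t + 1) x = c x * ?F t (\<phi> 1 x)"
        using t by (simp add: F_eq c_def enn2real_mult powr_mult flow_add)
    qed
  qed
  have "AE x in M. c x \<in> K \<and> c x \<noteq> 0 \<and> (\<forall>t\<in>I. ?F (t + 1) x = c x * ?F t (\<phi> 1 x))"
  proof -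
    \<comment> \<open>Each t has its own exceptional set; countability of \<open>I\<close> merges
      them.\<close>
    have "AE x in M. \<forall>t\<in>I. ?F (t + 1) x = c x * ?F t (\<phi> 1 x)"
      using I step by (subst AE_ball_countable[OF countable_I]) auto
    with jacobian_finite[OF T_simps(2)] jacobian_nonzero[OF T_simps(2)] AE_space show ?thesis
    proof eventually_elim
      fix x assume *: "\<forall>t\<in>I. ?F (t + 1) x = c x * ?F t (\<phi> 1 x)" "jacobian 1 x \<noteq> \<infinity>" "jacobian 1 x \<noteq> 0" "x \<in> space M"
      then have "c x \<in> K" unfolding c_def using aK by (intro K_simps) auto
      moreover have "a 1 x \<noteq> 0" using aK(2)[OF *(4)] by auto
      ultimately show "c x \<in> K \<and> c x \<noteq> 0 \<and> (\<forall>t\<in>I. ?F (t + 1) x = c x * ?F t (\<phi> 1 x))"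
        using * by (auto simp: c_def enn2real_eq_0_iff)
    qed
  qed
  moreover have "(\<integral>\<^sup>+x. h (\<phi> 1 x) * ennreal (norm (c x) powr \<alpha>) \<partial>M) = (\<integral>\<^sup>+x. h x \<partial>M)"
    if [measurable]: "h \<in> borel_measurable M" for h
  proof -
    have "(\<integral>\<^sup>+x. h (\<phi> 1 x) * ennreal (norm (c x) powr \<alpha>) \<partial>M) = (\<integral>\<^sup>+x. jacobian 1 x * h (\<phi> 1 x) \<partial>M)"
    proof (rule nn_integral_cong_AE, use jacobian_finite[OF T_simps(2)] AE_space in eventually_elim)
      fix x assume "jacobian 1 x \<noteq> \<infinity>" "x \<in> space M"
      then show "h (\<phi> 1 x) * ennreal (norm (c x) powr \<alpha>) = jacobian 1 x * h (\<phi> 1 x)"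
        using \<alpha> by (simp add: c_def norm_mult aK powr_powr less_top mult.commute)
    qed
    also have "\<dots> = (\<integral>\<^sup>+x. h (\<phi> 1 (\<phi> (- 1) x)) \<partial>M)" by (rule nn_integral_jacobian) simp_all
    also have "\<dots> = (\<integral>\<^sup>+x. h x \<partial>M)" by (intro nn_integral_cong) (simp add: flow_inverse)
    finally show ?thesis .
  qed
  moreover have "kernel M ?F" using F I by (auto simp: kernel_def)
  moreover have "c \<in> borel_measurable M" unfolding c_def by measurable
  ultimately have "nonsingular_kernel M ?F (\<phi> 1) c" by (simp add: nonsingular_kernel_def)
  then show ?thesis by (simp add: c_def[abs_def] jacobian_def)
qed

text \<open>The wandering set is taken from the time-one map. Its null part agrees with that of the
  flow up to null sets, so its preimages cover almost every point.\<close>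

lemma flow_kernel_null:
  assumes sp: "stable_path \<alpha> K I" and I: "I \<subseteq> T" and T: "T = \<int> \<or> T = UNIV"
    and rep: "flow_representation T K \<alpha> P X M \<phi> a f" and nul: "null_flow T M \<phi>"
  shows "stable_path.null_kernel \<alpha> K I M (flow_kernel \<alpha> M \<phi> a f)"
proof -
  interpret stable_path \<alpha> K I by fact
  have "1 \<in> T" using T by auto
  obtain Pos Nul where PN: "positive_null_parts_flow T M \<phi> Pos Nul" "space M - Nul \<in> null_sets M"
    using nul unfolding null_flow_def by blast
  then obtain Pt Nt where *: "positive_null_parts M (\<phi> 1) Pt Nt" "sym_diff Nul Nt \<in> null_sets M" "space M - Nul \<in> null_sets M"
    using \<open>1 \<in> T\<close> zero_less_one[where 'a = real] unfolding positive_null_parts_flow_def by blast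
  from *(1) obtain B n where B: "weakly_wandering_along M (\<phi> 1) n B" "Nt = (\<Union>k. (\<phi> 1 ^^ n k) -` B \<inter> space M)"
    unfolding positive_null_parts_def by (elim conjE exE) 
  have "sym_diff Nul Nt \<union> (space M - Nul) \<in> null_sets M" by (rule null_sets.Un[OF *(2,3)])
  then have "AE x in M. x \<in> Nt" by (rule AE_I') auto
  then have cov: "AE x in M. \<exists>k. (\<phi> 1 ^^ n k) x \<in> B"
    by (rule eventually_mono) (auto simp: B(2))
  have "B \<in> sets M" "disjoint_family (\<lambda>k. (\<phi> 1 ^^ n k) -` B \<inter> space M)"
    using B(1) by (simp_all add: weakly_wandering_along_def)
  with flow_kernel_nonsingular[OF sp I T rep] cov show ?thesis
    unfolding null_kernel_def by (intro exI conjI)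
qed

text \<open>The finite invariant measure lives on the positive part of the time-one map. Extended by
  0 it remains invariant, and it is equivalent to \<open>M\<close> because the complement of that
  part is null.\<close>

lemma flow_kernel_positive:
  assumes sp: "stable_path \<alpha> K I" and I: "I \<subseteq> T" and T: "T = \<int> \<or> T = UNIV"
    and rep: "flow_representation T K \<alpha> P X M \<phi> a f" and pos: "positive_flow T M \<phi>"
  shows "stable_path.positive_kernel \<alpha> K I M (flow_kernel \<alpha> M \<phi> a f)"
proof -
  interpret stable_path \<alpha> K I by fact
  have flow: "nonsingular_flow T M \<phi>" and sf: "sigma_finite_measure M"
    using rep by (auto simp: flow_representation_def integral_representation_def)
  interpret M: sigma_finite_measure M by fact
  interpret flow_on T M \<phi> by unfold_locales fact+
  have \<phi>[measurable]: "\<phi> 1 \<in> measurable M M" by (rule flow_measurable) simp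
  obtain Pos Nul where PN: "positive_null_parts_flow T M \<phi> Pos Nul" "space M - Pos \<in> null_sets M"
    using pos unfolding positive_flow_def by blast
  then obtain Pt Nt where *: "positive_null_parts M (\<phi> 1) Pt Nt" "sym_diff Pos Pt \<in> null_sets M" "space M - Pos \<in> null_sets M"
    using T_simps(2) zero_less_one[where 'a = real] unfolding positive_null_parts_flow_def by blast
  have Pt[measurable]: "Pt \<in> sets M" and pm: "positive_map (restrict_space M Pt) (\<phi> 1)"
    using *(1) by (auto simp: positive_null_parts_def)
  have "sym_diff Pos Pt \<union> (space M - Pos) \<in> null_sets M" by (rule null_sets.Un[OF *(2,3)])
  then have Pt_null: "space M - Pt \<in> null_sets M"
    by (rule null_sets_subset) auto
  obtain \<mu> where \<mu>: "finite_measure \<mu>" "equivalent_measures \<mu> (restrict_space M Pt)" "distr \<mu> \<mu> (\<phi> 1) = \<mu>"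
    using pm by (auto simp: positive_map_def)
  have s\<mu>: "sets \<mu> = sets (restrict_space M Pt)" using \<mu>(2) by (simp add: equivalent_measures_def)
  have sp\<mu>: "space \<mu> = Pt"
    using sets_eq_imp_space_eq[OF s\<mu>] sets.sets_into_space[OF Pt] by (auto simp: space_restrict_space)
  have \<phi>\<mu>: "\<phi> 1 \<in> measurable \<mu> \<mu>"
    using pm by (simp add: positive_map_def nonsingular_map_def cong: measurable_cong_sets[OF s\<mu> s\<mu>])
  have id: "(\<lambda>x. x) \<in> measurable \<mu> M"
    unfolding measurable_cong_sets[OF s\<mu> refl] by (rule measurable_restrict_space1) simp
  \<comment> \<open>Pushing forward along the inclusion of \<open>Pt\<close> is the extension by
    0.\<close>
  define m where "m = distr \<mu> M (\<lambda>x. x)"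
  have m: "emeasure m A = emeasure \<mu> (A \<inter> Pt)" if "A \<in> sets M" for A
    using that id by (simp add: m_def emeasure_distr sp\<mu>)
  have "finite_measure m" unfolding m_def by (intro finite_measure.finite_measure_distr \<mu>(1) id)
  moreover have "equivalent_measures m M"
  proof -
    have "A \<in> null_sets m \<longleftrightarrow> A \<in> null_sets M" for A
    proof (cases "A \<in> sets M")
      case A: True
      have "A \<in> null_sets m \<longleftrightarrow> A \<inter> Pt \<in> null_sets \<mu>"
      proof -
        have "sets m = sets M" by (simp add: m_def)
        moreover have "A \<inter> Pt \<in> sets \<mu>" using A by (auto simp: s\<mu> sets_restrict_space)
        ultimately show ?thesis using A by (simp add: null_sets_def m)
      qed
      also have "\<dots> \<longleftrightarrow> A \<inter> Pt \<in> null_sets (restrict_space M Pt)"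
        using \<mu>(2) by (auto simp: equivalent_measures_def absolutely_continuous_def)
      also have "\<dots> \<longleftrightarrow> A \<inter> Pt \<in> null_sets M"
        using A by (subst null_sets_restrict_space) auto
      also have "\<dots> \<longleftrightarrow> A \<in> null_sets M"
      proof
        assume "A \<inter> Pt \<in> null_sets M"
        then have "A \<inter> Pt \<union> (space M - Pt) \<in> null_sets M" using Pt_null by (rule null_sets.Un)
        then show "A \<in> null_sets M"
          by (rule null_sets_subset[OF _ A]) (use sets.sets_into_space[OF A] in auto)
      qed (auto intro: null_set_Int2)
      finally show ?thesis .
    qed (auto simp: m_def)
    then show ?thesis by (auto simp: equivalent_measures_def absolutely_continuous_def m_def)
  qed
  moreover have "distr m m (\<phi> 1) = m"
  proof -
    have "distr m m (\<phi> 1) = distr m M (\<phi> 1)" by (rule distr_cong) (simp_all add: m_def)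
    also have "\<dots> = distr \<mu> M (\<phi> 1 \<circ> (\<lambda>x. x))" unfolding m_def by (rule distr_distr) (use id in auto)
    also have "\<dots> = distr \<mu> M ((\<lambda>x. x) \<circ> \<phi> 1)" by (simp add: comp_def)
    also have "\<dots> = distr (distr \<mu> \<mu> (\<phi> 1)) M (\<lambda>x. x)" by (rule distr_distr[symmetric, OF id \<phi>\<mu>])
    finally show ?thesis by (simp add: \<mu>(3) m_def)
  qed
  moreover have "\<phi> (- 1) \<in> measurable M M" "\<forall>x\<in>space M. \<phi> 1 (\<phi> (- 1) x) = x \<and> \<phi> (- 1) (\<phi> 1 x) = x"
    by (auto intro: flow_measurable flow_inverse)
  ultimately show ?thesis
    using flow_kernel_nonsingular[OF sp I T rep] unfolding positive_kernel_def by blast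
qed

section \<open>Laws of processes\<close>

lemma lin_form_restrict: "J' \<subseteq> J \<Longrightarrow> lin_form \<theta> J' (\<lambda>t\<in>J. w t) = lin_form \<theta> J' w"
  by (auto simp: lin_form_def intro!: arg_cong[where f = Re] sum.cong)

definition char_fun :: "'w measure \<Rightarrow> (real \<Rightarrow> 'w \<Rightarrow> complex) \<Rightarrow> (real \<Rightarrow> complex) \<Rightarrow> real set \<Rightarrow> complex" where
  "char_fun P Y \<theta> J = (CLINT \<omega>|P. iexp (lin_form \<theta> J (\<lambda>t. Y t \<omega>)))"

lemma measurable_paths:
  assumes "SaS_process T K \<alpha> P Y" "J \<subseteq> T"
  shows "(\<lambda>\<omega>. \<lambda>t\<in>J. Y t \<omega>) \<in> measurable P (PiM J (\<lambda>_. borel))"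
  using assms by (intro measurable_restrict) (auto simp: SaS_process_def)

lemma measurable_lin_form_process:
  assumes "(\<lambda>\<omega>. \<lambda>t\<in>J. Y t \<omega>) \<in> measurable P (PiM J (\<lambda>_. borel))"
  shows "(\<lambda>\<omega>. lin_form \<theta> J (\<lambda>t. Y t \<omega>)) \<in> borel_measurable P"
  using measurable_compose[OF assms lin_form_measurable[OF order_refl, where \<theta> = \<theta>]] by (simp add: lin_form_restrict)

lemma char_fun_distr:
  assumes "(\<lambda>\<omega>. \<lambda>t\<in>J. Y t \<omega>) \<in> measurable P (PiM J (\<lambda>_. borel))"
  shows "char_fun P Y \<theta> J = (CLINT w|distr P (PiM J (\<lambda>_. borel)) (\<lambda>\<omega>. \<lambda>t\<in>J. Y t \<omega>). iexp (lin_form \<theta> J w))"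
proof -
  have [measurable]: "lin_form \<theta> J \<in> borel_measurable (PiM J (\<lambda>_. borel))" by (rule lin_form_measurable) simp
  show ?thesis by (subst integral_distr[OF assms]) (simp_all add: char_fun_def lin_form_restrict)
qed

lemma char_fun_same_law:
  assumes "same_law T P Y Q Y'" "finite J" "J \<subseteq> T"
    and "(\<lambda>\<omega>. \<lambda>t\<in>J. Y t \<omega>) \<in> measurable P (PiM J (\<lambda>_. borel))"
    and "(\<lambda>\<omega>. \<lambda>t\<in>J. Y' t \<omega>) \<in> measurable Q (PiM J (\<lambda>_. borel))"
  shows "char_fun P Y \<theta> J = char_fun Q Y' \<theta> J"
  using assms by (simp add: char_fun_distr same_law_def)

text \<open>Independence of the path maps passes to the two linear forms, which are measurable
  functions of the paths; characteristic functions of real variables are then compared at frequency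
  1.\<close>

lemma char_fun_independent_sum:
  assumes P: "prob_space P" and ind: "independent_processes T P Y Z" and J: "finite J" "J \<subseteq> T"
  shows "char_fun P (\<lambda>t \<omega>. Y t \<omega> + Z t \<omega>) \<theta> J = char_fun P Y \<theta> J * char_fun P Z \<theta> J"
proof -
  interpret prob_space P by fact
  define U where "U V \<omega> = lin_form \<theta> J (\<lambda>t. V t \<omega>)" for V :: "real \<Rightarrow> 'a \<Rightarrow> complex" and \<omega>
  have L: "lin_form \<theta> J \<circ> (\<lambda>\<omega>. \<lambda>t\<in>T. V t \<omega>) = U V" for V
    using J(2) by (auto simp: U_def fun_eq_iff lin_form_restrict)
  have ind': "indep_var borel (U Y) borel (U Z)"
    using indep_var_compose[OF ind[unfolded independent_processes_def] lin_form_measurable[OF J(2), of \<theta>] lin_form_measurable[OF J(2), of \<theta>]]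
    by (simp only: L)
  note [measurable] = indep_var_rv1[OF ind'] indep_var_rv2[OF ind']
  have c: "char (distr P borel V) 1 = (CLINT \<omega>|P. iexp (V \<omega>))" if "V \<in> borel_measurable P" for V
    unfolding char_def using that by (subst integral_distr) auto
  have "U (\<lambda>t \<omega>. Y t \<omega> + Z t \<omega>) = (\<lambda>\<omega>. U Y \<omega> + U Z \<omega>)"
    by (auto simp: U_def lin_form_def fun_eq_iff algebra_simps sum.distrib)
  then have "char_fun P (\<lambda>t \<omega>. Y t \<omega> + Z t \<omega>) \<theta> J = (CLINT \<omega>|P. iexp (U Y \<omega> + U Z \<omega>))"
    by (simp add: char_fun_def U_def fun_eq_iff)
  also have "\<dots> = char (distr P borel (\<lambda>\<omega>. U Y \<omega> + U Z \<omega>)) 1"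
    by (rule c[symmetric]) measurable
  also have "\<dots> = char (distr P borel (U Y)) 1 * char (distr P borel (U Z)) 1"
    by (rule char_distr_add[OF ind'])
  also have "\<dots> = char_fun P Y \<theta> J * char_fun P Z \<theta> J"
    by (simp only: c indep_var_rv1[OF ind'] indep_var_rv2[OF ind'] char_fun_def U_def)
  finally show ?thesis .
qed

context stable_index
begin

lemma integral_cos_sin_process:
  assumes Y: "SaS_process T K \<alpha> P Y" and J: "J \<subseteq> T"
    and J': "finite J'" "J' \<subseteq> J"
  shows "(LINT \<omega>|P. cos (lin_form \<theta> J' (\<lambda>t\<in>J. Y t \<omega>))) = Re (char_fun P Y (restrict_coeff \<theta>) J')"
    and "(LINT \<omega>|P. sin (lin_form \<theta> J' (\<lambda>t\<in>J. Y t \<omega>))) = Im (char_fun P Y (restrict_coeff \<theta>) J')"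
proof -
  interpret prob_space P using Y by (simp add: SaS_process_def)
  let ?U = "\<lambda>\<omega>. lin_form (restrict_coeff \<theta>) J' (\<lambda>t. Y t \<omega>)"
  have [measurable]: "?U \<in> borel_measurable P"
    using Y J J' by (intro measurable_lin_form_process measurable_paths[OF Y]) auto
  have i: "integrable P (\<lambda>\<omega>. iexp (?U \<omega>))"
    by (intro integrable_const_bound[where B = 1]) auto
  have eq: "lin_form \<theta> J' (\<lambda>t\<in>J. Y t \<omega>) = ?U \<omega>" if "\<omega> \<in> space P" for \<omega>
  proof -
    have "\<forall>t\<in>J'. Y t \<omega> \<in> K" using Y that J J' by (auto simp: SaS_process_def)
    from lin_form_restrict_coeff[OF this, of \<theta>] show ?thesis by (simp only: lin_form_restrict[OF J'(2)])
  qed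
  have "Re (char_fun P Y (restrict_coeff \<theta>) J') = (LINT \<omega>|P. Re (iexp (?U \<omega>)))"
    unfolding char_fun_def by (rule integral_Re[OF i, symmetric])
  also have "\<dots> = (LINT \<omega>|P. cos (lin_form \<theta> J' (\<lambda>t\<in>J. Y t \<omega>)))"
    by (intro Bochner_Integration.integral_cong) (simp_all add: eq Re_exp)
  finally show "(LINT \<omega>|P. cos (lin_form \<theta> J' (\<lambda>t\<in>J. Y t \<omega>))) = Re (char_fun P Y (restrict_coeff \<theta>) J')" ..
  have "Im (char_fun P Y (restrict_coeff \<theta>) J') = (LINT \<omega>|P. Im (iexp (?U \<omega>)))"
    unfolding char_fun_def by (rule integral_Im[OF i, symmetric])
  also have "\<dots> = (LINT \<omega>|P. sin (lin_form \<theta> J' (\<lambda>t\<in>J. Y t \<omega>)))"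
    by (intro Bochner_Integration.integral_cong) (simp_all add: eq Im_exp)
  finally show "(LINT \<omega>|P. sin (lin_form \<theta> J' (\<lambda>t\<in>J. Y t \<omega>))) = Im (char_fun P Y (restrict_coeff \<theta>) J')" ..
qed

text \<open>Coefficients in \<open>K\<close> suffice because the paths are \<open>K\<close>-valued,
  so that any complex test form agrees on them with one whose coefficients lie in
  \<open>K\<close>.\<close>

lemma same_law_of_char_fun:
  assumes Y: "SaS_process T K \<alpha> P Y" and Y': "SaS_process T K \<alpha> Q Y'"
    and eq: "\<And>J \<theta>. finite J \<Longrightarrow> J \<subseteq> T \<Longrightarrow> \<forall>t\<in>J. \<theta> t \<in> K \<Longrightarrow> char_fun P Y \<theta> J = char_fun Q Y' \<theta> J"
  shows "same_law T P Y Q Y'"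
  unfolding same_law_def
proof (intro allI impI)
  fix J assume J: "finite J \<and> J \<subseteq> T"
  let ?P = "PiM J (\<lambda>_. borel :: complex measure)"
  interpret P: prob_space P using Y by (simp add: SaS_process_def)
  interpret Q: prob_space Q using Y' by (simp add: SaS_process_def)
  have m: "(\<lambda>\<omega>. \<lambda>t\<in>J. Y t \<omega>) \<in> measurable P ?P" "(\<lambda>\<omega>. \<lambda>t\<in>J. Y' t \<omega>) \<in> measurable Q ?P"
    using measurable_paths[OF Y] measurable_paths[OF Y'] J by auto
  show "distr P ?P (\<lambda>\<omega>. \<lambda>t\<in>J. Y t \<omega>) = distr Q ?P (\<lambda>\<omega>. \<lambda>t\<in>J. Y' t \<omega>)"
  proof (rule PiM_complex_eqI)
    fix J' \<theta> assume J': "finite J'" "J' \<subseteq> J"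
    then have e: "char_fun P Y (restrict_coeff \<theta>) J' = char_fun Q Y' (restrict_coeff \<theta>) J'"
      using J restrict_coeff_K by (intro eq) auto
    have JT: "J \<subseteq> T" using J by simp
    note [measurable] = lin_form_measurable[OF J'(2)]
    show "(LINT w|distr P ?P (\<lambda>\<omega>. \<lambda>t\<in>J. Y t \<omega>). cos (lin_form \<theta> J' w)) =
      (LINT w|distr Q ?P (\<lambda>\<omega>. \<lambda>t\<in>J. Y' t \<omega>). cos (lin_form \<theta> J' w))"
      by (simp add: integral_distr[OF m(1)] integral_distr[OF m(2)] e
          integral_cos_sin_process[OF Y JT J'] integral_cos_sin_process[OF Y' JT J'])
    show "(LINT w|distr P ?P (\<lambda>\<omega>. \<lambda>t\<in>J. Y t \<omega>). sin (lin_form \<theta> J' w)) =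
      (LINT w|distr Q ?P (\<lambda>\<omega>. \<lambda>t\<in>J. Y' t \<omega>). sin (lin_form \<theta> J' w))"
      by (simp add: integral_distr[OF m(1)] integral_distr[OF m(2)] e
          integral_cos_sin_process[OF Y JT J'] integral_cos_sin_process[OF Y' JT J'])
  qed (use m in \<open>auto intro: P.finite_measure_distr Q.finite_measure_distr\<close>)
qed

end

lemma stable_path_translates:
  assumes "stable_index \<alpha> K" "finite J"
  shows "stable_path \<alpha> K {t + of_int k | t k. t \<in> J}"
proof -
  interpret stable_index \<alpha> K by fact
  show ?thesis
  proof
    have "{t + of_int k | t k. t \<in> J} = (\<lambda>(t, k). t + of_int k) ` (J \<times> (UNIV :: int set))" by auto
    then show "countable {t + of_int k | t k. t \<in> J}" using assms(2) by (simp add: countable_finite)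
    fix s assume "s \<in> {t + of_int k | t k. t \<in> J}"
    then obtain t k where s: "s = t + of_int k" "t \<in> J" by blast
    have "s + 1 = t + of_int (k + 1)" "s - 1 = t + of_int (k - 1)" using s by simp_all
    then show "s + 1 \<in> {t + of_int k | t k. t \<in> J}" "s - 1 \<in> {t + of_int k | t k. t \<in> J}" using s by blast+
  qed
qed

lemma char_fun_flow:
  assumes "flow_representation T K \<alpha> P X M \<phi> a f" "finite J" "J \<subseteq> T" "\<forall>t\<in>J. \<theta> t \<in> K"
  shows "char_fun P X \<theta> J = of_real (exp (- (LINT x|M. norm (\<Sum>t\<in>J. \<theta> t * flow_kernel \<alpha> M \<phi> a f t x) powr \<alpha>)))"
  using assms by (simp add: char_fun_def lin_form_def flow_representation_def integral_representation_def del: Re_sum)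

theorem theorem2p4:
  fixes \<alpha> :: real and T :: "real set" and K :: "complex set"
    and P :: "'w measure" and X :: "real \<Rightarrow> 'w \<Rightarrow> complex"
    and P1 :: "'w1 measure" and Y1 Z1 :: "real \<Rightarrow> 'w1 \<Rightarrow> complex"
    and P2 :: "'w2 measure" and Y2 Z2 :: "real \<Rightarrow> 'w2 \<Rightarrow> complex"
  assumes "0 < \<alpha>" "\<alpha> < 2"
    and "T = \<int> \<or> T = UNIV"
    and "K = \<real> \<or> K = UNIV"
    and "measurable_stationary_SaS T K \<alpha> P X"
    and "measurable_stationary_SaS T K \<alpha> P1 Y1" "measurable_stationary_SaS T K \<alpha> P1 Z1"
    and "measurable_stationary_SaS T K \<alpha> P2 Y2" "measurable_stationary_SaS T K \<alpha> P2 Z2"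
    and "independent_processes T P1 Y1 Z1"
    and "independent_processes T P2 Y2 Z2"
    and "same_law T P X P1 (\<lambda>t \<omega>. Y1 t \<omega> + Z1 t \<omega>)"
    and "same_law T P X P2 (\<lambda>t \<omega>. Y2 t \<omega> + Z2 t \<omega>)"
    and "generated_by_positive_flow TYPE('e1) T K \<alpha> P1 Y1"
    and "generated_by_null_flow TYPE('e2) T K \<alpha> P1 Z1"
    and "generated_by_positive_flow TYPE('e3) T K \<alpha> P2 Y2"
    and "generated_by_null_flow TYPE('e4) T K \<alpha> P2 Z2"
  shows "same_law T P1 Y1 P2 Y2 \<and> same_law T P1 Z1 P2 Z2"
proof -
  have rep1: "\<exists>(M :: 'e1 measure) \<phi> a f. flow_representation T K \<alpha> P1 Y1 M \<phi> a f \<and> positive_flow T M \<phi>"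
    and rep2: "\<exists>(M :: 'e2 measure) \<phi> a f. flow_representation T K \<alpha> P1 Z1 M \<phi> a f \<and> null_flow T M \<phi>"
    and rep3: "\<exists>(M :: 'e3 measure) \<phi> a f. flow_representation T K \<alpha> P2 Y2 M \<phi> a f \<and> positive_flow T M \<phi>"
    and rep4: "\<exists>(M :: 'e4 measure) \<phi> a f. flow_representation T K \<alpha> P2 Z2 M \<phi> a f \<and> null_flow T M \<phi>"
    using assms(14-17) unfolding generated_by_positive_flow_def generated_by_null_flow_def by blast+
  obtain M1 :: "'e1 measure" and \<phi>1 a1 f1 where r1: "flow_representation T K \<alpha> P1 Y1 M1 \<phi>1 a1 f1" "positive_flow T M1 \<phi>1"
    using rep1 by blast
  obtain M2 :: "'e2 measure" and \<phi>2 a2 f2 where r2: "flow_representation T K \<alpha> P1 Z1 M2 \<phi>2 a2 f2" "null_flow T M2 \<phi>2"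
    using rep2 by blast
  obtain M3 :: "'e3 measure" and \<phi>3 a3 f3 where r3: "flow_representation T K \<alpha> P2 Y2 M3 \<phi>3 a3 f3" "positive_flow T M3 \<phi>3"
    using rep3 by blast
  obtain M4 :: "'e4 measure" and \<phi>4 a4 f4 where r4: "flow_representation T K \<alpha> P2 Z2 M4 \<phi>4 a4 f4" "null_flow T M4 \<phi>4"
    using rep4 by blast
  have idx: "stable_index \<alpha> K" using assms(1,2,4) by unfold_locales
  interpret stable_index \<alpha> K by fact
  have S: "SaS_process T K \<alpha> P1 Y1" "SaS_process T K \<alpha> P1 Z1" "SaS_process T K \<alpha> P2 Y2" "SaS_process T K \<alpha> P2 Z2"
    using assms(6-9) by (simp_all add: measurable_stationary_SaS_def)
  have pr: "prob_space P1" "prob_space P2" using S by (simp_all add: SaS_process_def)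
  have same: "same_law T P1 (\<lambda>t \<omega>. Y1 t \<omega> + Z1 t \<omega>) P2 (\<lambda>t \<omega>. Y2 t \<omega> + Z2 t \<omega>)"
    using assms(12,13) by (simp add: same_law_def)
  define e1 where "e1 \<theta> J = (LINT x|M1. norm (\<Sum>t\<in>J. \<theta> t * flow_kernel \<alpha> M1 \<phi>1 a1 f1 t x) powr \<alpha>)" for \<theta> J
  define e2 where "e2 \<theta> J = (LINT x|M2. norm (\<Sum>t\<in>J. \<theta> t * flow_kernel \<alpha> M2 \<phi>2 a2 f2 t x) powr \<alpha>)" for \<theta> J
  define e3 where "e3 \<theta> J = (LINT x|M3. norm (\<Sum>t\<in>J. \<theta> t * flow_kernel \<alpha> M3 \<phi>3 a3 f3 t x) powr \<alpha>)" for \<theta> J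
  define e4 where "e4 \<theta> J = (LINT x|M4. norm (\<Sum>t\<in>J. \<theta> t * flow_kernel \<alpha> M4 \<phi>4 a4 f4 t x) powr \<alpha>)" for \<theta> J
  note char_funs = char_fun_flow[OF r1(1), folded e1_def] char_fun_flow[OF r2(1), folded e2_def]
    char_fun_flow[OF r3(1), folded e3_def] char_fun_flow[OF r4(1), folded e4_def]
  have sum: "e1 \<theta> J + e2 \<theta> J = e3 \<theta> J + e4 \<theta> J"
    if J: "finite J" "J \<subseteq> T" and \<theta>: "\<forall>t\<in>J. \<theta> t \<in> K" for J \<theta>
  proof -
    have paths: "(\<lambda>\<omega>. \<lambda>t\<in>J. V t \<omega> + V' t \<omega>) \<in> measurable Q (PiM J (\<lambda>_. borel))"
      if "SaS_process T K \<alpha> Q V" "SaS_process T K \<alpha> Q V'" for Q :: "'z measure" and V V'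
      using that J by (intro measurable_restrict borel_measurable_add) (auto simp: SaS_process_def)
    have "char_fun P1 Y1 \<theta> J * char_fun P1 Z1 \<theta> J = char_fun P2 Y2 \<theta> J * char_fun P2 Z2 \<theta> J"
      using char_fun_same_law[OF same J paths[OF S(1,2)] paths[OF S(3,4)], of \<theta>]
      by (simp add: char_fun_independent_sum[OF pr(1) assms(10) J] char_fun_independent_sum[OF pr(2) assms(11) J])
    \<comment> \<open>Both sides are exponentials of real numbers, so no ambiguity modulo 2 pi
      arises in taking logarithms.\<close>
    then have "of_real (exp (- e1 \<theta> J - e2 \<theta> J)) = (of_real (exp (- e3 \<theta> J - e4 \<theta> J)) :: complex)"
      using J \<theta> by (simp add: char_funs exp_diff exp_minus field_simps)
    then show ?thesis by (simp only: of_real_eq_iff exp_inj_iff)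
  qed
  have eq13: "e1 \<theta> J = e3 \<theta> J" if J: "finite J" "J \<subseteq> T" and \<theta>: "\<forall>t\<in>J. \<theta> t \<in> K" for J \<theta>
  proof -
    \<comment> \<open>Integer translates of \<open>J\<close> stay in \<open>T\<close>, be it the
      integers or the line, and the translate by 0 is \<open>J\<close> itself.\<close>
    define I where "I = {t + of_int k | t k. t \<in> J}"
    have path: "stable_path \<alpha> K I" unfolding I_def by (rule stable_path_translates[OF idx J(1)])
    interpret path: stable_path \<alpha> K I by (rule path)
    have IT: "I \<subseteq> T" using assms(3) J(2) by (auto simp: I_def)
    have "t \<in> I" if "t \<in> J" for t
      unfolding I_def using that by (intro CollectI exI[of _ t] exI[of _ 0]) simp
    then have JI: "J \<subseteq> I" by blast
    show ?thesis
      using path.exponent_eq[OF flow_kernel_positive[OF path IT assms(3) r1] flow_kernel_null[OF path IT assms(3) r2]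
          flow_kernel_positive[OF path IT assms(3) r3] flow_kernel_null[OF path IT assms(3) r4] _ J(1) JI \<theta>] sum IT
      by (simp add: path.exponent_def e1_def e2_def e3_def e4_def)
  qed
  show ?thesis
  proof
    show "same_law T P1 Y1 P2 Y2"
      using eq13 by (intro same_law_of_char_fun[OF S(1,3)]) (simp add: char_funs)
    have "e2 \<theta> J = e4 \<theta> J" if "finite J" "J \<subseteq> T" "\<forall>t\<in>J. \<theta> t \<in> K" for J \<theta>
      using eq13[OF that] sum[OF that] by simp
    then show "same_law T P1 Z1 P2 Z2"
      by (intro same_law_of_char_fun[OF S(2,4)]) (simp add: char_funs)
  qed
qed

end
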